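(* Let $x,y,z$ be non-negative integers and let $\mathbf a=(a_1,\dots,a_m)$, $\mathbf b=(b_1,\dots,b_n)$ be sequences of non-negative integers. Put $\mu=2\lfloor\frac{m+1}{2}\rfloor$, $\mu'=2\lceil\frac{m-1}{2}\rceil$, $\nu=2\lfloor\frac{n+1}{2}\rfloor$, $\nu'=2\lceil\frac{n-1}{2}\rceil$, and $$\mathbf t^{+}=(0,a_1,\dots,a_{\mu-1},\,a_{\mu}+x+y+b_{\nu},\,b_{\nu-1},\dots,b_1),\qquad \mathbf t^{-}=(a_1,\dots,a_{\mu'},\,a_{\mu'+1}+x+y+b_{\nu'+1},\,b_{\nu'},\dots,b_1,z).$$ Then $$M(N^{(3)}_{x,y,z}(\mathbf a;\mathbf b))=\frac{M(N^{(3)}_{x+y,0,z}(\mathbf a;\mathbf b))\,M(N^{(3)}_{0,y,z}(\mathbf a;\mathbf b))}{M(N^{(3)}_{y,0,z}(\mathbf a;\mathbf b))}\cdot\frac{T(x+1,2a+b+2y+z-1,y)\,T(x+a+1,b+2y+z-1,y)}{T(1,2a+b+2y+z-1,y)\,T(a+1,b+2y+z-1,y)}$$ $$=2^{-y}\,K(\mathbf t^{+})\,Q'(\mathbf t^{-})\cdot\frac{H_2(2o_a+2o_b)\,H_2(2e_a+2e_b+2z+1)}{H_2(2o_a+2o_b+2y)\,H_2(2e_a+2e_b+2y+2z+1)}\cdot\frac{H(2a+b+2y+z)\,H(b+y+z)}{H(2a+b+y+z)\,H(b+z)}$$ $$\cdot\frac{T(x+1,2a+b+2y+z-1,y)\,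T(x+a+1,b+2y+z-1,y)}{T(1,2a+b+2y+z-1,y)\,T(a+1,b+2y+z-1,y)}.$$
   Context: Lattice and tilings. For real $u,k$ let $[u;k]$ be the point of the plane with Cartesian coordinates $(u,\frac{\sqrt3}{2}k)$. The triangular lattice has as vertices all $[u;k]$ with $k\in\mathbb Z$, $u-k/2\in\mathbb Z$; its faces are unit equilateral triangles, up-pointing or down-pointing. A region is a finite union of unit triangles. A lozenge is the union of two unit triangles sharing an edge; it is vertical if that edge is horizontal. A tiling of a region is a covering of it by lozenges contained in it, without gaps or overlaps. $M(R)$ is the sum of the weights of all tilings of $R$, the weight of a tiling being the product of the weights of its lozenges; lozenges have weight $1$ unless stated otherwise; $M(\emptyset)=1$. Sequences. $a=\sum a_i$, $b=\sum b_j$; $o_a,e_a$ are the sums of the $a_i$ with $i$ odd, resp. even; $o_b,e_b$ likewise. $a_i=0$ for $i>m$, $b_j=0$ for $j>n$; an empty sequence is treated as the one-term sequence $(0)$. Functions. $H(n)=\prod_{i=0}^{n-1}i!$; $H_2(n)=\prod_{i=1}^{\lfloor n/2\rfloor}(n-2i)!$; for $n\ge0$, $(x)_n=x(x+1)\cdots(x+n-1)$ ($1$ for $n=0$); $T(x,n,m)=\prod_{i=0}^{m-1}(x+i)_{n-2i}$. Empty products are $1$. Quartered hexagons. For a sequence $\mathbf t=(t_1,\dots,t_{2l})$ of non-negative integers let $s_k=t_1+\dots+t_k$, $o_t=\sum_{i\text{ odd}}t_i$, $e_t=\sum_{i\text{ even}}t_i$. $Q'(\mathbf t)$: take the region bounded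 by the base from $[0;0]$ to $[o_t+e_t;0]$, the segment from $[o_t+e_t;0]$ to $[o_t;2e_t]$, the north side from $[o_t;2e_t]$ to $[0;2e_t]$, and the west zigzag through $[0;0],[-\frac12;1],[0;2],[-\frac12;3],\dots,[0;2e_t]$; remove from it, for each $1\le i\le l$, the up-pointing triangle with base from $[s_{2i-1};0]$ to $[s_{2i};0]$; give weight $\frac12$ to each vertical lozenge whose two western (left) sides both lie on the west zigzag. $Q'(\mathbf t)$ is $M$ of this weighted region. $K(\mathbf t)$: if $e_t\ge1$, take the region bounded by the base from $[0;0]$ to $[o_t+e_t;0]$, the segment from $[o_t+e_t;0]$ to $[o_t+\frac12;2e_t-1]$, the north side from there to $[\frac12;2e_t-1]$, and the west zigzag through $[0;0],[\frac12;1],[0;2],[\frac12;3],\dots,[\frac12;2e_t-1]$; remove the same up-pointing triangles. $K(\mathbf t)$ is the number of tilings of the resulting region; if $e_t=0$, $K(\mathbf t)=1$. The region $N^{(3)}_{x,y,z}(\mathbf a;\mathbf b)$. Let $L=x+y+a+b$, $A=2(y+o_a+o_b)-1$, $B=2(y+z+e_a+e_b)$, and let $\ell$ be the line $k=0$. Upper part (empty if $A=-1$): bounded by $\ell$ between $[0;0]$ and $[L;0]$, the segment from $[L;0]$ to $[L-\frac A2;A]$, the horizontal north side at height $k=A$, and the west zigzag through the points $[\alpha(k);k]$, $0\le k\le A$, with $\alpha(k)=0$ for $k$ even and $\frac12$ for $k$ odd. Lower part: bounded by $\ell$ between $[0;0]$ and $[L;0]$, the segments from $[L;0]$ to $[L+\frac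 z2;-z]$ and from there to $[L+z-\frac B2;-B]$, the horizontal south side at $k=-B$, and the west zigzag through $[\beta(k);-k]$, $0\le k\le B$, with $\beta(k)=0$ for $k$ even and $-\frac12$ for $k$ odd. The region is the union of the two parts (lozenges may cross $\ell$) after removing: (i) from the upper part, everything at points $[u;k]$ with $u<a_1-k/2$ (an up-pointing half triangle of side $2a_1$); (ii) for $2\le i\le m$, the triangle of side $a_i$ having a side on $\ell$ from $[a_1+\dots+a_{i-1};0]$ to $[a_1+\dots+a_i;0]$, down-pointing (below $\ell$) if $i$ is even, up-pointing (above $\ell$) if $i$ is odd; (iii) for $1\le j\le n$, the triangle of side $b_j$ having a side on $\ell$ from $[L-b_1-\dots-b_j;0]$ to $[L-b_1-\dots-b_{j-1};0]$, up-pointing (above $\ell$) if $j$ is odd, down-pointing (below $\ell$) if $j$ is even. Each vertical lozenge whose two western (left) sides both lie on the lower west zigzag has weight $\frac12$; all others have weight $1$. *)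

theory Defs
  imports Complex_Main "HOL-Library.Disjoint_Sets"
begin

section \<open>Triangular lattice, regions and tilings\<close>

text \<open>
  Write \<open>[u;k]\<close> for the point of the plane with Cartesian coordinates
  \<open>(u, k * sqrt 3 / 2)\<close>.  The vertices of the triangular lattice are the points \<open>[u;k]\<close>
  with \<open>k\<close> and \<open>j = u - k/2\<close> both integers; the pair \<open>(j, k)\<close> encodes the
  vertex \<open>[j + k/2; k]\<close>.
\<close>

type_synonym vertex = "int \<times> int"

definition absc :: "vertex \<Rightarrow> real" where
  "absc v = of_int (fst v) + of_int (snd v) / 2"

definition height :: "vertex \<Rightarrow> int" where
  "height v = snd v"

text \<open>
  Both \<open>Up j k\<close> and \<open>Down j k\<close> lie in the strip between the heights \<open>k\<close> and \<open>k + 1\<close>.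
  The base of \<open>Up j k\<close> starts at the vertex \<open>(j, k)\<close>, the top side of
  \<open>Down j k\<close> starts at the vertex \<open>(j, k + 1)\<close>.
\<close>

datatype triangle = Up int int | Down int int

fun vertices :: "triangle \<Rightarrow> vertex set" where
  "vertices (Up j k) = {(j, k), (j + 1, k), (j, k + 1)}"
| "vertices (Down j k) = {(j, k + 1), (j + 1, k + 1), (j + 1, k)}"

type_synonym region = "triangle set"

definition lozenge :: "triangle set \<Rightarrow> bool" where
  "lozenge l \<longleftrightarrow> (\<exists>s t. l = {s, t} \<and> s \<noteq> t \<and> card (vertices s \<inter> vertices t) = 2)"

definition tiling :: "region \<Rightarrow> triangle set set \<Rightarrow> bool" where
  "tiling R T \<longleftrightarrow> partition_on R T \<and> (\<forall>l\<in>T. lozenge l)"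

definition M :: "(triangle set \<Rightarrow> real) \<Rightarrow> region \<Rightarrow> real" where
  "M w R = (\<Sum>T | tiling R T. \<Prod>l\<in>T. w l)"

definition unit_weight :: "triangle set \<Rightarrow> real" where
  "unit_weight l = 1"

text \<open>
  The set of lattice triangles contained in a planar domain, given by a predicate on points.
  All domains below meet each closed strip between consecutive lattice lines \<open>k\<close> and
  \<open>k + 1\<close> in a convex set (a possibly degenerate trapezoid, or nothing), so a triangle is
  contained in the domain iff its three vertices are.
\<close>

definition triangles_in :: "(vertex \<Rightarrow> bool) \<Rightarrow> region" where
  "triangles_in P = {t. \<forall>v\<in>vertices t. P v}"

text \<open>
  Abscissa, at integer height \<open>k\<close>, of a zigzag through \<open>[0;k]\<close> for even \<open>k\<close> and
  \<open>[d;k]\<close> for odd \<open>k\<close>.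
\<close>

definition zigzag :: "real \<Rightarrow> int \<Rightarrow> real" where
  "zigzag d k = (if even k then 0 else d)"

text \<open>Lattice triangles of side \<open>s\<close> with the horizontal side from \<open>[c;0]\<close> to \<open>[c + s;0]\<close>.\<close>

definition up_hole :: "nat \<Rightarrow> nat \<Rightarrow> region" where
  "up_hole c s = triangles_in (\<lambda>v. 0 \<le> height v \<and>
     real c + of_int (height v) / 2 \<le> absc v \<and>
     absc v \<le> real c + real s - of_int (height v) / 2)"

definition down_hole :: "nat \<Rightarrow> nat \<Rightarrow> region" where
  "down_hole c s = triangles_in (\<lambda>v. height v \<le> 0 \<and>
     real c - of_int (height v) / 2 \<le> absc v \<and>
     absc v \<le> real c + real s + of_int (height v) / 2)"

text \<open>
  The vertical lozenge \<open>{Up j k, Down j (k - 1)}\<close> has its west corner at the vertex \<open>(j, k)\<close>; its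
  western sides join that corner to the vertices \<open>(j, k + 1)\<close> and \<open>(j + 1, k - 1)\<close>.  A zigzag
  is given by the set \<open>Z\<close> of its lattice points, one on each lattice line that it meets, so a
  side joining two points of \<open>Z\<close> on consecutive lattice lines lies on the zigzag.
\<close>

definition zigzag_weight :: "vertex set \<Rightarrow> triangle set \<Rightarrow> real" where
  "zigzag_weight Z l =
     (if \<exists>j k. l = {Up j k, Down j (k - 1)} \<and> {(j, k + 1), (j, k), (j + 1, k - 1)} \<subseteq> Z
      then 1 / 2 else 1)"


section \<open>Sequences\<close>

text \<open>Sequences are indexed from 1 and extended by zero beyond their length.\<close>

definition entry :: "nat list \<Rightarrow> nat \<Rightarrow> nat" where
  "entry as i = (if 1 \<le> i \<and> i \<le> length as then as ! (i - 1) else 0)"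

definition partial_sum :: "nat list \<Rightarrow> nat \<Rightarrow> nat" where
  "partial_sum as k = (\<Sum>i = 1..k. entry as i)"

definition odd_sum :: "nat list \<Rightarrow> nat" where
  "odd_sum as = (\<Sum>i | i \<in> {1..length as} \<and> odd i. entry as i)"

definition even_sum :: "nat list \<Rightarrow> nat" where
  "even_sum as = (\<Sum>i | i \<in> {1..length as} \<and> even i. entry as i)"

text \<open>
  An empty sequence is treated as the one-term sequence \<open>(0)\<close>.  Because of the zero extension
  this matters only where the length itself enters.
\<close>

definition seq_length :: "nat list \<Rightarrow> nat" where
  "seq_length as = (if as = [] then 1 else length as)"


section \<open>Product functions\<close>

definition H :: "nat \<Rightarrow> real" where
  "H n = (\<Prod>i<n. fact i)"

definition H2 :: "nat \<Rightarrow> real" where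
  "H2 n = (\<Prod>i = 1..n div 2. fact (n - 2 * i))"

text \<open>Used only with \<open>n - 2 i \<ge> 0\<close> for all \<open>i < m\<close> (for \<open>m = 0\<close>, \<open>n\<close> may be \<open>-1\<close>).\<close>

definition T_prod :: "real \<Rightarrow> int \<Rightarrow> nat \<Rightarrow> real" where
  "T_prod x n m = (\<Prod>i<m. pochhammer (x + real i) (nat (n - 2 * int i)))"


section \<open>Quartered hexagons\<close>

text \<open>Here \<open>t\<close> is a sequence of even length.\<close>

definition quartered_holes :: "nat list \<Rightarrow> region" where
  "quartered_holes t =
     (\<Union>i\<in>{1..length t div 2}. up_hole (partial_sum t (2 * i - 1)) (entry t (2 * i)))"

definition quartered_hexagon :: "real \<Rightarrow> int \<Rightarrow> nat list \<Rightarrow> region" where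
  "quartered_hexagon d h t =
     triangles_in (\<lambda>v. 0 \<le> height v \<and> height v \<le> h \<and>
       zigzag d (height v) \<le> absc v \<and>
       absc v \<le> real (odd_sum t + even_sum t) - of_int (height v) / 2)
     - quartered_holes t"

definition Q' :: "nat list \<Rightarrow> real" where
  "Q' t = M (zigzag_weight {v. 0 \<le> height v \<and> height v \<le> 2 * int (even_sum t) \<and>
                               absc v = zigzag (- (1 / 2)) (height v)})
            (quartered_hexagon (- (1 / 2)) (2 * int (even_sum t)) t)"

definition K :: "nat list \<Rightarrow> real" where
  "K t = (if even_sum t = 0 then 1
          else M unit_weight (quartered_hexagon (1 / 2) (2 * int (even_sum t) - 1) t))"


section \<open>The region \<open>N\<^sup>(\<^sup>3\<^sup>)\<close>\<close>

definition N3_width :: "nat \<Rightarrow> nat \<Rightarrow> nat list \<Rightarrow> nat list \<Rightarrow> nat" where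
  "N3_width x y as bs = x + y + sum_list as + sum_list bs"

definition N3_top :: "nat \<Rightarrow> nat list \<Rightarrow> nat list \<Rightarrow> int" where
  "N3_top y as bs = 2 * int (y + odd_sum as + odd_sum bs) - 1"

definition N3_depth :: "nat \<Rightarrow> nat \<Rightarrow> nat list \<Rightarrow> nat list \<Rightarrow> int" where
  "N3_depth y z as bs = 2 * int (y + z + even_sum as + even_sum bs)"

definition N3_upper :: "nat \<Rightarrow> nat \<Rightarrow> nat list \<Rightarrow> nat list \<Rightarrow> region" where
  "N3_upper x y as bs = triangles_in (\<lambda>v. 0 \<le> height v \<and> height v \<le> N3_top y as bs \<and>
     zigzag (1 / 2) (height v) \<le> absc v \<and>
     absc v \<le> real (N3_width x y as bs) - of_int (height v) / 2)"

text \<open>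
  Below the line \<open>k = 0\<close> the eastern boundary passes through \<open>[L;0]\<close>, \<open>[L + z/2; -z]\<close> and
  \<open>[L + z - B/2; -B]\<close>.
\<close>

definition N3_lower :: "nat \<Rightarrow> nat \<Rightarrow> nat \<Rightarrow> nat list \<Rightarrow> nat list \<Rightarrow> region" where
  "N3_lower x y z as bs = triangles_in (\<lambda>v. - N3_depth y z as bs \<le> height v \<and> height v \<le> 0 \<and>
     zigzag (- (1 / 2)) (height v) \<le> absc v \<and>
     absc v \<le> (if - int z \<le> height v
               then real (N3_width x y as bs) - of_int (height v) / 2
               else real (N3_width x y as bs) + real z + of_int (height v) / 2))"

definition N3_half_hole :: "nat list \<Rightarrow> region" where
  "N3_half_hole as = triangles_in (\<lambda>v. 0 \<le> height v \<and>
     absc v \<le> real (entry as 1) - of_int (height v) / 2)"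

definition N3_a_holes :: "nat list \<Rightarrow> region" where
  "N3_a_holes as = (\<Union>i\<in>{2..length as}.
     (if even i then down_hole else up_hole) (partial_sum as (i - 1)) (entry as i))"

definition N3_b_holes :: "nat \<Rightarrow> nat list \<Rightarrow> region" where
  "N3_b_holes L bs = (\<Union>j\<in>{1..length bs}.
     (if even j then down_hole else up_hole) (L - partial_sum bs j) (entry bs j))"

definition N3 :: "nat \<Rightarrow> nat \<Rightarrow> nat \<Rightarrow> nat list \<Rightarrow> nat list \<Rightarrow> region" where
  "N3 x y z as bs = (N3_upper x y as bs \<union> N3_lower x y z as bs)
     - (N3_half_hole as \<union> N3_a_holes as \<union> N3_b_holes (N3_width x y as bs) bs)"

definition N3_west_zigzag :: "nat \<Rightarrow> nat \<Rightarrow> nat list \<Rightarrow> nat list \<Rightarrow> vertex set" where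
  "N3_west_zigzag y z as bs = {v. - N3_depth y z as bs \<le> height v \<and> height v \<le> 0 \<and>
     absc v = zigzag (- (1 / 2)) (height v)}"

definition M_N3 :: "nat \<Rightarrow> nat \<Rightarrow> nat \<Rightarrow> nat list \<Rightarrow> nat list \<Rightarrow> real" where
  "M_N3 x y z as bs = M (zigzag_weight (N3_west_zigzag y z as bs)) (N3 x y z as bs)"


section \<open>The sequences \<open>t\<^sup>+\<close> and \<open>t\<^sup>-\<close>\<close>

definition t_plus :: "nat \<Rightarrow> nat \<Rightarrow> nat list \<Rightarrow> nat list \<Rightarrow> nat list" where
  "t_plus x y as bs =
     (let \<mu> = 2 * nat \<lfloor>(real (seq_length as) + 1) / 2\<rfloor>;
          \<nu> = 2 * nat \<lfloor>(real (seq_length bs) + 1) / 2\<rfloor>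
      in [0] @ map (entry as) [1..<\<mu>] @ [entry as \<mu> + x + y + entry bs \<nu>]
           @ rev (map (entry bs) [1..<\<nu>]))"

definition t_minus :: "nat \<Rightarrow> nat \<Rightarrow> nat \<Rightarrow> nat list \<Rightarrow> nat list \<Rightarrow> nat list" where
  "t_minus x y z as bs =
     (let \<mu>' = 2 * nat \<lceil>(real (seq_length as) - 1) / 2\<rceil>;
          \<nu>' = 2 * nat \<lceil>(real (seq_length bs) - 1) / 2\<rceil>
      in map (entry as) [1..<\<mu>' + 1]
           @ [entry as (\<mu>' + 1) + x + y + entry bs (\<nu>' + 1)]
           @ rev (map (entry bs) [1..<\<nu>' + 1]) @ [z])"

end

theory Submission
  imports "Jordan_Normal_Form.Determinant" Defs
begin

text \<open>
  Cut the region along \<open>\<ell>\<close>. Exactly \<open>y\<close> of the unit segments of \<open>\<ell>\<close> between the two ferns are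
  crossed by vertical lozenges; let \<open>S\<close> be their set. Then \<open>M_N3\<close> is the sum over \<open>S\<close> of products of
  two counts, of an upper quartered hexagon of type \<open>K\<close> and of a lower one of type \<open>Q'\<close>, whose
  bases have dents at \<open>S\<close> and at the segments of the ferns.

  The dents of consecutive lattice rows interlace, so the count of a dented quartered hexagon can be
  computed row by row. With the distances of the dents from the axis as variables, it is a
  determinant of central factorials, since summing over the interlacing dents of a row turns each
  central factorial into the next one. The determinant is a constant times the Vandermonde product
  of the squares of the distances, in type \<open>Q'\<close> also times the product of the distances.
  The product of the two counts therefore depends on \<open>S\<close> only
  through the squared Vandermonde product of \<open>S\<close> and a product over \<open>S\<close> of a weight, and because the
  ferns together fill the segments outside the gap, this weight is that of the Racah polynomials.
  By Andreief's identity the sum is a determinant of moments; in a suitable basis each moment is a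
  summable hypergeometric sum, and the determinant is a product.
\<close>

section \<open>Weighted tilings\<close>

text \<open>Two devices let one induction serve both halves. The lower half is reflected in the line
  \<open>k = 0\<close>, so both halves are trapezoids on a common base, and each triangular hole
  becomes a run of dents because its filling is forced from below. The weight 1/2 is attached to
  vertical lozenges centred on the axis; in type \<open>K\<close> there are none. The weight is just
  what closes the recursion in type \<open>Q'\<close>: halving the central term removes the lower
  end of the telescoping sum, as the odd central factorials are odd functions. The moments become
  summable because Andreief's identity allows two different monic bases. One has its zeros at the
  start of the gap, the other just beyond the east end of the dents; multiplying the Racah weight by
  either only shifts a parameter, so a single formula for the total mass evaluates every moment. In
  the two forms of the answer, \<open>x\<close> enters through \<open>x + y\<close> in the sequences
  and through a factor that is 1 at \<open>x = 0\<close>; for \<open>y = 0\<close> the two halves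
  decouple.\<close>

lemma tilingD:
  assumes "tiling R T"
  shows "\<Union>T = R" and "\<And>l m. l \<in> T \<Longrightarrow> m \<in> T \<Longrightarrow> l \<inter> m \<noteq> {} \<Longrightarrow> l = m"
    and "\<And>l. l \<in> T \<Longrightarrow> lozenge l" and "\<And>l. l \<in> T \<Longrightarrow> l \<subseteq> R"
  using assms unfolding tiling_def partition_on_def disjoint_def by blast+

lemma lozenge_nonempty: "lozenge l \<Longrightarrow> l \<noteq> {}"
  unfolding lozenge_def by blast

lemma tilingI:
  assumes "\<Union>T = R" "\<And>l m. l \<in> T \<Longrightarrow> m \<in> T \<Longrightarrow> l \<inter> m \<noteq> {} \<Longrightarrow> l = m"
    and "\<And>l. l \<in> T \<Longrightarrow> lozenge l"
  shows "tiling R T"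
  using assms lozenge_nonempty unfolding tiling_def partition_on_def disjoint_def by blast

lemma finite_tilings: "finite R \<Longrightarrow> finite {T. tiling R T}"
  by (rule finite_subset[of _ "Pow (Pow R)"]) (auto dest: tilingD(4))

lemma finite_tiling: "finite R \<Longrightarrow> tiling R T \<Longrightarrow> finite T"
  by (rule finite_subset[of _ "Pow R"]) (auto dest: tilingD(4))

lemma lozenge_pair: "lozenge l \<Longrightarrow> \<exists>s t. l = {s, t} \<and> s \<noteq> t"
  unfolding lozenge_def by blast

text \<open>A tiling is determined by the set \<open>S\<close> of its crossing lozenges and by the
  tilings of what they leave of \<open>A\<close> and of \<open>B\<close>; \<open>cross\<close> makes
  \<open>J\<close> a complete list of possible crossings. Used to cut along the base line and to
  peel off single rows.\<close>

lemma M_cut: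
  fixes f g :: "'i \<Rightarrow> triangle"
  assumes fin: "finite A" "finite B" "finite J" and AB: "A \<inter> B = {}"
    and inj: "inj_on f J" "inj_on g J"
    and fA: "f ` J \<subseteq> A" and gB: "g ` J \<subseteq> B"
    and loz: "\<And>j. j \<in> J \<Longrightarrow> lozenge {f j, g j}"
    and cross: "\<And>s t. s \<in> A \<Longrightarrow> t \<in> B \<Longrightarrow> lozenge {s, t} \<Longrightarrow> \<exists>j\<in>J. s = f j \<and> t = g j"
  shows "M w (A \<union> B) = (\<Sum>S\<in>Pow J. (\<Prod>j\<in>S. w {f j, g j}) * M w (A - f ` S) * M w (B - g ` S))"
proof -
  \<comment> \<open>\<open>split\<close> and \<open>join\<close> are the two directions of the
    bijection between the tilings of \<open>A \<union> B\<close> and the triples in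
    \<open>D\<close>; \<open>c j\<close> is the crossing lozenge at \<open>j\<close>.\<close>
  define c where "c j = {f j, g j}" for j
  define D where "D = (SIGMA S:Pow J. {T. tiling (A - f ` S) T} \<times> {T. tiling (B - g ` S) T})"
  define join where "join = (\<lambda>(S, T1, T2). c ` S \<union> T1 \<union> T2)"
  define split where "split T = ({j \<in> J. c j \<in> T}, {l \<in> T. l \<subseteq> A}, {l \<in> T. l \<subseteq> B})" for T
  have c_A: "\<not> c j \<subseteq> A" "\<not> c j \<subseteq> B" if "j \<in> J" for j
    using that fA gB AB unfolding c_def by blast+
  have c_inj: "inj_on c J"
  proof (rule inj_onI)
    fix i j assume ij: "i \<in> J" "j \<in> J" "c i = c j"
    then have "f i \<in> {f j, g j}" unfolding c_def by blast
    then have "f i = f j" using ij fA gB AB by blast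
    then show "i = j" using inj ij by (auto dest: inj_onD)
  qed
  \<comment> \<open>By \<open>cross\<close>, a lozenge of a tiling lies in \<open>A\<close>, lies in
    \<open>B\<close>, or is some \<open>c j\<close>. That \<open>split\<close> yields tilings rests
    on this.\<close>
  have tri: "l \<subseteq> A \<or> l \<subseteq> B \<or> l \<in> c ` J" if T: "tiling (A \<union> B) T" "l \<in> T" for T l
  proof -
    obtain s t where st: "l = {s, t}" "s \<noteq> t" using lozenge_pair tilingD(3)[OF T] by blast
    have L: "lozenge {s, t}" "lozenge {t, s}" using tilingD(3)[OF T] st by (auto simp: insert_commute)
    have "s \<in> A \<union> B" "t \<in> A \<union> B" using tilingD(4)[OF T] st by auto
    then consider "s \<in> A" "t \<in> A" | "s \<in> B" "t \<in> B" | "s \<in> A" "t \<in> B" | "t \<in> A" "s \<in> B" by blast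
    then show ?thesis
    proof cases
      case 3 then show ?thesis using cross[OF 3 L(1)] st unfolding c_def by blast
    next
      case 4 then show ?thesis using cross[OF 4 L(2)] st unfolding c_def by blast
    qed (use st in auto)
  qed
  have split_D: "split T \<in> D" if T: "tiling (A \<union> B) T" for T
  proof -
    let ?S = "{j \<in> J. c j \<in> T}"
    note d = tilingD[OF T]
    have "tiling (A - f ` ?S) {l \<in> T. l \<subseteq> A}"
    proof (rule tilingI)
      show "\<Union> {l \<in> T. l \<subseteq> A} = A - f ` ?S"
      proof (intro subset_antisym subsetI)
        fix t assume "t \<in> \<Union> {l \<in> T. l \<subseteq> A}"
        then obtain l where l: "l \<in> T" "l \<subseteq> A" "t \<in> l" by blast
        have "t \<notin> f ` ?S"
        proof
          assume "t \<in> f ` ?S"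
          then obtain j where j: "j \<in> J" "c j \<in> T" "t = f j" by blast
          then have "l = c j" using d(2)[OF l(1) j(2)] l(3) unfolding c_def by blast
          then show False using c_A j l by blast
        qed
        then show "t \<in> A - f ` ?S" using l by blast
      next
        fix t assume t: "t \<in> A - f ` ?S"
        then obtain l where l: "l \<in> T" "t \<in> l" using d(1) by blast
        have "\<not> l \<subseteq> B" using t l AB by blast
        moreover have "l \<notin> c ` J"
        proof
          assume "l \<in> c ` J"
          then obtain j where j: "j \<in> J" "l = c j" by blast
          then have "t = f j" using t l gB AB unfolding c_def by blast
          then show False using j t l by blast
        qed
        ultimately show "t \<in> \<Union> {l \<in> T. l \<subseteq> A}" using tri[OF T l(1)] l by blast
      qed
    qed (use d in auto)
    moreover have "tiling (B - g ` ?S) {l \<in> T. l \<subseteq> B}"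
    proof (rule tilingI)
      show "\<Union> {l \<in> T. l \<subseteq> B} = B - g ` ?S"
      proof (intro subset_antisym subsetI)
        fix t assume "t \<in> \<Union> {l \<in> T. l \<subseteq> B}"
        then obtain l where l: "l \<in> T" "l \<subseteq> B" "t \<in> l" by blast
        have "t \<notin> g ` ?S"
        proof
          assume "t \<in> g ` ?S"
          then obtain j where j: "j \<in> J" "c j \<in> T" "t = g j" by blast
          then have "l = c j" using d(2)[OF l(1) j(2)] l(3) unfolding c_def by blast
          then show False using c_A j l by blast
        qed
        then show "t \<in> B - g ` ?S" using l by blast
      next
        fix t assume t: "t \<in> B - g ` ?S"
        then obtain l where l: "l \<in> T" "t \<in> l" using d(1) by blast
        have "\<not> l \<subseteq> A" using t l AB by blast
        moreover have "l \<notin> c ` J"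
        proof
          assume "l \<in> c ` J"
          then obtain j where j: "j \<in> J" "l = c j" by blast
          then have "t = g j" using t l fA AB unfolding c_def by blast
          then show False using j t l by blast
        qed
        ultimately show "t \<in> \<Union> {l \<in> T. l \<subseteq> B}" using tri[OF T l(1)] l by blast
      qed
    qed (use d in auto)
    ultimately show ?thesis unfolding split_def D_def by blast
  qed
  have join_split: "join (split T) = T" if T: "tiling (A \<union> B) T" for T
    using tri[OF T] unfolding join_def split_def by auto
  have join_tiling: "tiling (A \<union> B) (join p)" and split_join: "split (join p) = p"
    and w_join: "(\<Prod>l\<in>join p. w l) =
      (case p of (S, T1, T2) \<Rightarrow> (\<Prod>j\<in>S. w {f j, g j}) * ((\<Prod>l\<in>T1. w l) * (\<Prod>l\<in>T2. w l)))"
    if p: "p \<in> D" for p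
  proof -
    obtain S T1 T2 where p_def: "p = (S, T1, T2)" by (cases p)
    have S: "S \<subseteq> J" and T1: "tiling (A - f ` S) T1" and T2: "tiling (B - g ` S) T2"
      using p unfolding p_def D_def by auto
    note d1 = tilingD[OF T1] and d2 = tilingD[OF T2]
    have ne: "l \<noteq> {}" if "l \<in> T1 \<or> l \<in> T2" for l
      using that d1(3) d2(3) lozenge_nonempty by blast
    have x: "l \<inter> c j = {}" if "j \<in> S" "l \<in> T1 \<or> l \<in> T2" for l j
      using that d1(4)[of l] d2(4)[of l] S fA gB AB unfolding c_def by blast
    have y: "l \<inter> m = {}" if "l \<in> T1" "m \<in> T2" for l m
      using that d1(4)[of l] d2(4)[of m] AB by blast
    have z: "c i = c j" if "i \<in> S" "j \<in> S" "c i \<inter> c j \<noteq> {}" for i j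
    proof -
      have "f i = f j \<or> g i = g j"
        using that S fA gB AB unfolding c_def by blast
      then show ?thesis using inj that S by (metis inj_onD subsetD)
    qed
    show "tiling (A \<union> B) (join p)"
    proof (rule tilingI)
      have cS: "\<Union> (c ` S) = f ` S \<union> g ` S" unfolding c_def by auto
      have "\<Union> (join p) = f ` S \<union> g ` S \<union> (A - f ` S) \<union> (B - g ` S)"
        unfolding join_def p_def prod.case Union_Un_distrib cS d1(1) d2(1) ..
      also have "\<dots> = f ` S \<union> (A - f ` S) \<union> (g ` S \<union> (B - g ` S))" by (simp only: ac_simps)
      also have "f ` S \<union> (A - f ` S) = A" using S fA by (intro Un_Diff_cancel[THEN trans] Un_absorb1) auto
      also have "g ` S \<union> (B - g ` S) = B" using S gB by (intro Un_Diff_cancel[THEN trans] Un_absorb1) auto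
      finally show "\<Union> (join p) = A \<union> B" .
    next
      fix l m assume lm: "l \<in> join p" "m \<in> join p" "l \<inter> m \<noteq> {}"
      have "l \<in> c ` S \<and> m \<in> c ` S \<or> l \<in> T1 \<and> m \<in> T1 \<or> l \<in> T2 \<and> m \<in> T2"
        using lm x[of _ l] x[of _ m] y[of l m] y[of m l]
        unfolding join_def p_def prod.case Un_iff image_iff by (metis inf_commute)
      then consider "l \<in> c ` S" "m \<in> c ` S" | "l \<in> T1" "m \<in> T1" | "l \<in> T2" "m \<in> T2" by blast
      then show "l = m"
        using z d1(2)[OF _ _ \<open>l \<inter> m \<noteq> {}\<close>] d2(2)[OF _ _ \<open>l \<inter> m \<noteq> {}\<close>] \<open>l \<inter> m \<noteq> {}\<close>
        by cases auto
    next
      fix l assume "l \<in> join p"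
      then show "lozenge l" using d1(3) d2(3) loz S unfolding join_def p_def c_def by auto
    qed
    have cT: "c j \<notin> T1" "c j \<notin> T2" if "j \<in> J" for j
      using that d1(4)[of "c j"] d2(4)[of "c j"] c_A by blast+
    have TA: "l \<subseteq> A" "\<not> l \<subseteq> B" if "l \<in> T1" for l
      using d1(4)[OF that] ne[of l] that AB by blast+
    have TB: "l \<subseteq> B" "\<not> l \<subseteq> A" if "l \<in> T2" for l
      using d2(4)[OF that] ne[of l] that AB by blast+
    have cA: "\<not> l \<subseteq> A" "\<not> l \<subseteq> B" if "l \<in> c ` S" for l using c_A S that by blast+
    have jn: "l \<in> join p \<longleftrightarrow> l \<in> c ` S \<or> l \<in> T1 \<or> l \<in> T2" for l
      unfolding join_def p_def by simp
    have "{j \<in> J. c j \<in> join p} = S"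
      using cT S c_inj unfolding jn by (auto dest: inj_onD)
    moreover have "{l \<in> join p. l \<subseteq> A} = T1"
      by (rule Set.set_eqI) (metis (lifting) mem_Collect_eq jn TA TB cA)
    moreover have "{l \<in> join p. l \<subseteq> B} = T2"
      by (rule Set.set_eqI) (metis (lifting) mem_Collect_eq jn TA TB cA)
    ultimately show "split (join p) = p" unfolding split_def p_def by simp
    have fT: "finite T1" "finite T2" "finite S"
      using finite_tiling[OF _ T1] finite_tiling[OF _ T2] fin S finite_subset by auto
    have e1: "(c ` S) \<inter> T1 = {}" using cT S by blast
    have "T1 \<inter> T2 = {}" "c ` S \<inter> T2 = {}" using cA TA TB by fast+
    then have e2: "(c ` S \<union> T1) \<inter> T2 = {}" by blast
    have "(\<Prod>l\<in>join p. w l) = (\<Prod>l\<in>c ` S. w l) * (\<Prod>l\<in>T1. w l) * (\<Prod>l\<in>T2. w l)"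
      unfolding join_def p_def using fT e1 e2 by (simp add: prod.union_disjoint)
    also have "(\<Prod>l\<in>c ` S. w l) = (\<Prod>j\<in>S. w {f j, g j})"
      by (subst prod.reindex[OF inj_on_subset[OF c_inj S]]) (simp add: c_def)
    finally show "(\<Prod>l\<in>join p. w l) =
      (case p of (S, T1, T2) \<Rightarrow> (\<Prod>j\<in>S. w {f j, g j}) * ((\<Prod>l\<in>T1. w l) * (\<Prod>l\<in>T2. w l)))"
      unfolding p_def by simp
  qed
  have "M w (A \<union> B) = (\<Sum>p\<in>D. case p of (S, T1, T2) \<Rightarrow>
      (\<Prod>j\<in>S. w {f j, g j}) * ((\<Prod>l\<in>T1. w l) * (\<Prod>l\<in>T2. w l)))"
    unfolding M_def
    by (rule sum.reindex_bij_witness[where i = join and j = split])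
      (use split_D join_split join_tiling split_join w_join[symmetric] in \<open>simp_all\<close>)
  also have "\<dots> = (\<Sum>S\<in>Pow J. \<Sum>(T1, T2)\<in>{T. tiling (A - f ` S) T} \<times> {T. tiling (B - g ` S) T}.
      (\<Prod>j\<in>S. w {f j, g j}) * ((\<Prod>l\<in>T1. w l) * (\<Prod>l\<in>T2. w l)))"
    unfolding D_def
    by (subst sum.Sigma[symmetric]) (use fin finite_tilings in \<open>auto simp: case_prod_unfold\<close>)
  also have "\<dots> = (\<Sum>S\<in>Pow J. (\<Prod>j\<in>S. w {f j, g j}) * M w (A - f ` S) * M w (B - g ` S))"
  proof (rule sum.cong[OF refl])
    fix S
    show "(\<Sum>(T1, T2)\<in>{T. tiling (A - f ` S) T} \<times> {T. tiling (B - g ` S) T}.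
      (\<Prod>j\<in>S. w {f j, g j}) * ((\<Prod>l\<in>T1. w l) * (\<Prod>l\<in>T2. w l))) =
      (\<Prod>j\<in>S. w {f j, g j}) * M w (A - f ` S) * M w (B - g ` S)"
      unfolding M_def mult.assoc sum_product sum.cartesian_product
      by (simp add: sum_distrib_left case_prod_unfold)
  qed
  finally show ?thesis .
qed

corollary M_union:
  assumes "finite A" "finite B" "A \<inter> B = {}"
    and "\<And>s t. s \<in> A \<Longrightarrow> t \<in> B \<Longrightarrow> \<not> lozenge {s, t}"
  shows "M w (A \<union> B) = M w A * M w B"
  using M_cut[of A B "{}" undefined undefined w] assms by auto

lemma M_empty [simp]: "M w {} = 1"
proof -
  have "{T. tiling {} T} = {{}}"
    using lozenge_nonempty by (auto simp: tiling_def partition_on_def)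
  then show ?thesis by (simp add: M_def)
qed

text \<open>Deleting \<open>F\<close> and adding it back are inverse to each other, and weight 1
  keeps the products equal. If \<open>R\<close> has no tiling, the hypothesis on \<open>F\<close> is
  vacuous, but then \<open>R - \<Union>F\<close> has none either, since adding \<open>F\<close>
  would tile \<open>R\<close>.\<close>

lemma M_forced:
  assumes fin: "finite R" and F: "\<And>T. tiling R T \<Longrightarrow> F \<subseteq> T"
    and disj: "\<And>l m. l \<in> F \<Longrightarrow> m \<in> F \<Longrightarrow> l \<inter> m \<noteq> {} \<Longrightarrow> l = m"
    and loz: "\<And>l. l \<in> F \<Longrightarrow> lozenge l" and sub: "\<Union>F \<subseteq> R" and w1: "\<And>l. l \<in> F \<Longrightarrow> w l = 1"
  shows "M w R = M w (R - \<Union>F)"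
  unfolding M_def
proof (rule sum.reindex_bij_witness[where i = "\<lambda>T. T \<union> F" and j = "\<lambda>T. T - F"])
  fix T assume "T \<in> {T. tiling R T}"
  then have T: "tiling R T" by simp
  note d = tilingD[OF T] and FT = F[OF T]
  show "T - F \<union> F = T" using FT by blast
  have "\<Union>(T - F) = R - \<Union>F"
  proof (intro subset_antisym subsetI)
    fix t assume "t \<in> \<Union>(T - F)"
    then show "t \<in> R - \<Union>F" using d(1,2) FT by blast
  qed (use d(1) in blast)
  moreover have "l = m" if "l \<in> T - F" "m \<in> T - F" "l \<inter> m \<noteq> {}" for l m
    using d(2)[OF _ _ that(3)] that(1,2) by simp
  moreover have "lozenge l" if "l \<in> T - F" for l using d(3) that by simp
  ultimately have "tiling (R - \<Union>F) (T - F)" by (rule tilingI)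
  then show "T - F \<in> {T. tiling (R - \<Union>F) T}" by simp
  have "prod w T = prod w (T - F) * prod w F"
    using FT finite_tiling[OF fin T] by (metis finite_subset prod.subset_diff)
  then show "prod w (T - F) = prod w T" using w1 by simp
next
  fix T assume "T \<in> {T. tiling (R - \<Union>F) T}"
  then have T: "tiling (R - \<Union>F) T" by simp
  note d = tilingD[OF T]
  have x: "l \<inter> m = {}" if "l \<in> T" "m \<in> F" for l m
    using that(2) d(4)[OF that(1)] by blast
  have "l \<notin> F" if "l \<in> T" for l
    using lozenge_nonempty[OF d(3)[OF that]] x[OF that, of l] by blast
  then show "T \<union> F - F = T" by blast
  have "tiling R (T \<union> F)"
  proof (rule tilingI)
    show "\<Union> (T \<union> F) = R" using d(1) sub by blast
    show "l = m" if "l \<in> T \<union> F" "m \<in> T \<union> F" "l \<inter> m \<noteq> {}" for l m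
      using that(1,2) d(2)[OF _ _ that(3)] disj[OF _ _ that(3)] x[of l m] x[of m l] that(3)
      by (auto simp: Int_commute)
  qed (use d loz in auto)
  then show "T \<union> F \<in> {T. tiling R T}" by simp
qed

text \<open>Transport of a weighted count along a symmetry of the lattice, needed for the reflection
  of the lower half.\<close>

lemma M_image:
  assumes inj: "inj h" and loz: "\<And>l. lozenge (h ` l) \<longleftrightarrow> lozenge l"
  shows "M w (h ` R) = M (\<lambda>l. w (h ` l)) R"
proof -
  have inj': "inj ((`) h)" by (intro injI) (simp add: inj_image_eq_iff[OF inj])
  have img: "tiling (h ` R) ((`) h ` T) \<longleftrightarrow> tiling R T" for T
  proof
    assume T: "tiling (h ` R) ((`) h ` T)"
    note d = tilingD[OF T]
    show "tiling R T"
    proof (rule tilingI)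
      have "h ` \<Union>T = h ` R" using d(1) by (simp add: image_Union)
      then show "\<Union>T = R" by (simp only: inj_image_eq_iff[OF inj])
      show "l = m" if "l \<in> T" "m \<in> T" "l \<inter> m \<noteq> {}" for l m
      proof -
        have "h ` l = h ` m" by (rule d(2)) (use that in blast)+
        then show ?thesis by (simp only: inj_image_eq_iff[OF inj])
      qed
      show "lozenge l" if "l \<in> T" for l using d(3)[of "h ` l"] that loz by simp
    qed
  next
    assume T: "tiling R T"
    note d = tilingD[OF T]
    show "tiling (h ` R) ((`) h ` T)"
    proof (rule tilingI)
      show "\<Union> ((`) h ` T) = h ` R" using d(1) by blast
      fix l m assume "l \<in> (`) h ` T" "m \<in> (`) h ` T" and ne: "l \<inter> m \<noteq> {}"
      then obtain l' m' where lm: "l' \<in> T" "m' \<in> T" "l = h ` l'" "m = h ` m'" by blast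
      then have "l' \<inter> m' \<noteq> {}" using ne inj by (auto dest: injD)
      then show "l = m" using d(2)[OF lm(1,2)] lm by simp
    next
      fix l assume "l \<in> (`) h ` T"
      then show "lozenge l" using d(3) loz by auto
    qed
  qed
  have "{T. tiling (h ` R) T} = (`) ((`) h) ` {T. tiling R T}"
  proof (intro subset_antisym subsetI)
    fix T assume T: "T \<in> {T. tiling (h ` R) T}"
    have ex: "\<exists>l'. l = h ` l'" if "l \<in> T" for l
      using tilingD(4)[of "h ` R" T l] T that by (metis mem_Collect_eq subset_imageE)
    have eq: "T = (`) h ` {l. h ` l \<in> T}"
    proof (intro subset_antisym subsetI)
      fix l assume l: "l \<in> T"
      then obtain l' where "l = h ` l'" using ex by blast
      then show "l \<in> (`) h ` {l. h ` l \<in> T}" using l by simp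
    qed auto
    then have "tiling R {l. h ` l \<in> T}" using T img[of "{l. h ` l \<in> T}"] by simp
    then show "T \<in> (`) ((`) h) ` {T. tiling R T}" by (subst eq, intro imageI CollectI)
  next
    fix T assume "T \<in> (`) ((`) h) ` {T. tiling R T}"
    then show "T \<in> {T. tiling (h ` R) T}" using img by auto
  qed
  moreover have "inj_on ((`) ((`) h)) {T. tiling R T}"
    by (intro inj_onI) (simp add: inj_image_eq_iff[OF inj'])
  ultimately have "M w (h ` R) = (\<Sum>T | tiling R T. prod w ((`) h ` T))"
    unfolding M_def by (simp add: sum.reindex)
  also have "\<dots> = M (\<lambda>l. w (h ` l)) R"
    unfolding M_def
    by (intro sum.cong refl, subst prod.reindex) (use inj' in \<open>auto intro: inj_on_subset\<close>)
  finally show ?thesis .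
qed

lemma M_cong_weight:
  assumes "\<And>l. lozenge l \<Longrightarrow> l \<subseteq> R \<Longrightarrow> w l = w' l"
  shows "M w R = M w' R"
  unfolding M_def by (intro sum.cong prod.cong refl assms) (auto dest: tilingD(3,4))

section \<open>Vandermonde products and Andreief's identity\<close>

definition vdm :: "(nat \<Rightarrow> real) \<Rightarrow> nat \<Rightarrow> real" where
  "vdm t n = (\<Prod>j<n. \<Prod>i<j. t j - t i)"

text \<open>The coefficient matrix of monic polynomials of degrees 0, 1, 2, ... is unitriangular, so
  leaving the monomial basis does not change the determinant.\<close>

lemma det_monic_eq:
  fixes P :: "nat \<Rightarrow> real poly"
  assumes "\<And>k. k < n \<Longrightarrow> degree (P k) = k" "\<And>k. k < n \<Longrightarrow> lead_coeff (P k) = 1"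
  shows "det (mat n n (\<lambda>(i, k). poly (P k) (t i))) = det (mat n n (\<lambda>(i, k). t i ^ k))"
proof -
  let ?V = "mat n n (\<lambda>(i, k). t i ^ k)" and ?C = "mat n n (\<lambda>(j, k). coeff (P k) j)"
  have "mat n n (\<lambda>(i, k). poly (P k) (t i)) = ?V * ?C"
  proof (rule eq_matI)
    fix i k assume "i < dim_row (?V * ?C)" "k < dim_col (?V * ?C)"
    then have ik: "i < n" "k < n" by auto
    have "poly (P k) (t i) = (\<Sum>j\<le>k. coeff (P k) j * t i ^ j)"
      using assms ik by (simp add: poly_altdef)
    also have "\<dots> = (\<Sum>j\<in>{0..<n}. coeff (P k) j * t i ^ j)"
      using ik assms by (intro sum.mono_neutral_left) (auto intro: coeff_eq_0)
    finally show "mat n n (\<lambda>(i, k). poly (P k) (t i)) $$ (i, k) = (?V * ?C) $$ (i, k)"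
      using ik by (simp add: scalar_prod_def mult.commute)
  qed auto
  moreover have "det ?C = 1"
    using assms
    by (subst det_upper_triangular[of _ n])
      (auto simp: prod_list_diag_prod upper_triangular_def intro!: coeff_eq_0 prod.neutral)
  ultimately show ?thesis by (simp add: det_mult[of _ n])
qed

text \<open>The Newton polynomials \<open>N k\<close>, vanishing at \<open>t 0\<close>, ...,
  \<open>t (k - 1)\<close>, give a triangular matrix whose diagonal carries the factors of
  \<open>vdm\<close>; every other monic family has the same determinant.\<close>

lemma det_monic:
  fixes P :: "nat \<Rightarrow> real poly"
  assumes "\<And>k. k < n \<Longrightarrow> degree (P k) = k" "\<And>k. k < n \<Longrightarrow> lead_coeff (P k) = 1"
  shows "det (mat n n (\<lambda>(i, k). poly (P k) (t i))) = vdm t n"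
proof -
  define N where "N k = (\<Prod>i<k. [:- t i, 1:])" for k
  have N: "degree (N k) = k" "lead_coeff (N k) = 1" for k
    unfolding N_def by (simp add: degree_prod_eq_sum_degree) (subst lead_coeff_prod, simp)
  have "vdm t n = det (mat n n (\<lambda>(i, k). poly (N k) (t i)))"
    by (subst det_lower_triangular[of n])
      (auto simp: prod_list_diag_prod N_def poly_prod vdm_def lessThan_atLeast0 prod_zero_iff
        intro!: prod.cong)
  also have "\<dots> = det (mat n n (\<lambda>(i, k). poly (P k) (t i)))"
    using det_monic_eq[of n N t] det_monic_eq[of n P t] N assms by simp
  finally show ?thesis by simp
qed

lemma det_transpose': "det (mat n n (\<lambda>(i, k). f k i)) = det (mat n n (\<lambda>(i, k). f i k :: real))"
proof -
  have "mat n n (\<lambda>(i, k). f k i) = transpose_mat (mat n n (\<lambda>(i, k). f i k))" by (rule eq_matI) auto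
  then show ?thesis using det_transpose[of "mat n n (\<lambda>(i, k). f i k)" n] by simp
qed

text \<open>Left multiplication by a unipotent bidiagonal matrix. The default value 0 keeps row 0 as
  it is.\<close>

lemma det_row_differences:
  fixes g :: "nat \<Rightarrow> nat \<Rightarrow> real"
  shows "det (mat n n (\<lambda>(i, k). g k i - (if i = 0 then 0 else g k (i - 1)))) = det (mat n n (\<lambda>(i, k). g k i))"
proof -
  let ?G = "mat n n (\<lambda>(i, k). g k i)"
  let ?D = "mat n n (\<lambda>(i, j). if i = j then 1 else if i = Suc j then - 1 else 0 :: real)"
  have "mat n n (\<lambda>(i, k). g k i - (if i = 0 then 0 else g k (i - 1))) = ?D * ?G"
  proof (rule eq_matI)
    fix i k assume "i < dim_row (?D * ?G)" "k < dim_col (?D * ?G)"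
    then have ik: "i < n" "k < n" by auto
    have "(\<Sum>j = 0..<n. (if i = j then 1 else if i = Suc j then - 1 else 0) * g k j)
        = (\<Sum>j = 0..<n. (if j = i then g k j else 0) - (if Suc j = i then g k j else 0))"
      by (intro sum.cong) auto
    also have "\<dots> = g k i - (\<Sum>j = 0..<n. if Suc j = i then g k j else 0)"
      using ik by (simp add: sum_subtractf)
    also have "(\<Sum>j = 0..<n. if Suc j = i then g k j else 0) = (if i = 0 then 0 else g k (i - 1))"
    proof (cases i)
      case (Suc m)
      then have "(\<Sum>j = 0..<n. if Suc j = i then g k j else 0) = (\<Sum>j = 0..<n. if j = m then g k j else 0)"
        by (intro sum.cong) auto
      then show ?thesis using ik Suc by simp
    qed simp
    finally show "mat n n (\<lambda>(i, k). g k i - (if i = 0 then 0 else g k (i - 1))) $$ (i, k) = (?D * ?G) $$ (i, k)"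
      using ik by (simp add: scalar_prod_def)
  qed auto
  moreover have "det ?D = 1"
    by (subst det_lower_triangular[of n]) (auto simp: prod_list_diag_prod)
  ultimately show ?thesis by (simp add: det_mult[of _ n])
qed

text \<open>Row differences turn the column of ones into the first unit vector, and expansion along
  it leaves the consecutive differences. In this way \<open>n\<close> intervals with
  \<open>n + 1\<close> end points lead to a determinant of size \<open>n + 1\<close>.\<close>

lemma det_column_of_ones:
  fixes g :: "nat \<Rightarrow> nat \<Rightarrow> real"
  shows "det (mat (Suc n) (Suc n) (\<lambda>(i, k). if k = 0 then 1 else g (k - 1) i)) =
    det (mat n n (\<lambda>(i, k). g k (Suc i) - g k i))"
proof -
  let ?g = "\<lambda>k i. if k = 0 then 1 else g (k - 1) i"
  let ?A = "mat (Suc n) (Suc n) (\<lambda>(i, k). ?g k i - (if i = 0 then 0 else ?g k (i - 1)))"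
  have "det (mat (Suc n) (Suc n) (\<lambda>(i, k). ?g k i)) = det ?A"
    by (rule det_row_differences[symmetric])
  also have "\<dots> = (\<Sum>i<Suc n. ?A $$ (i, 0) * cofactor ?A i 0)"
    by (rule laplace_expansion_column) auto
  also have "\<dots> = (\<Sum>i<Suc n. if i = 0 then cofactor ?A i 0 else 0)"
    by (intro sum.cong) auto
  also have "\<dots> = cofactor ?A 0 0" by (simp add: sum.lessThan_Suc_shift)
  also have "\<dots> = det (mat_delete ?A 0 0)" by (simp add: cofactor_def)
  also have "mat_delete ?A 0 0 = mat n n (\<lambda>(i, k). g k (Suc i) - g k i)"
    by (rule eq_matI) (auto simp: mat_delete_def)
  finally show ?thesis by simp
qed

text \<open>Multilinearity: \<open>y i\<close> occurs in row \<open>i\<close> only, so independent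
  choices can be summed row by row.\<close>

lemma sum_PiE_det:
  fixes u :: "nat \<Rightarrow> 'a \<Rightarrow> real"
  assumes "\<And>i. i < n \<Longrightarrow> finite (B i)"
  shows "(\<Sum>y\<in>PiE {..<n} B. (\<Prod>i<n. u i (y i)) * det (mat n n (\<lambda>(i, k). p k (y i)))) =
    det (mat n n (\<lambda>(i, k). \<Sum>s\<in>B i. u i s * p k s))"
proof -
  let ?P = "{\<pi>. \<pi> permutes {0..<n}}"
  have "(\<Sum>y\<in>PiE {..<n} B. (\<Prod>i<n. u i (y i)) * det (mat n n (\<lambda>(i, k). p k (y i)))) =
      (\<Sum>y\<in>PiE {..<n} B. \<Sum>\<pi>\<in>?P. signof \<pi> * (\<Prod>i<n. u i (y i) * p (\<pi> i) (y i)))"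
  proof (rule sum.cong[OF refl])
    fix y
    have "(\<Prod>i<n. u i (y i)) * det (mat n n (\<lambda>(i, k). p k (y i))) =
       (\<Sum>\<pi>\<in>?P. (\<Prod>i<n. u i (y i)) * (signof \<pi> * (\<Prod>i<n. p (\<pi> i) (y i))))"
      by (simp add: det_def'[of _ n] sum_distrib_left lessThan_atLeast0)
    then show "(\<Prod>i<n. u i (y i)) * det (mat n n (\<lambda>(i, k). p k (y i))) =
       (\<Sum>\<pi>\<in>?P. signof \<pi> * (\<Prod>i<n. u i (y i) * p (\<pi> i) (y i)))"
      by (simp add: prod.distrib mult.left_commute)
  qed
  also have "\<dots> = (\<Sum>\<pi>\<in>?P. \<Sum>y\<in>PiE {..<n} B. signof \<pi> * (\<Prod>i<n. u i (y i) * p (\<pi> i) (y i)))"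
    by (rule sum.swap)
  also have "\<dots> = (\<Sum>\<pi>\<in>?P. signof \<pi> * (\<Prod>i<n. \<Sum>s\<in>B i. u i s * p (\<pi> i) s))"
    using assms by (intro sum.cong refl, subst prod_sum_PiE) (auto simp: sum_distrib_left)
  also have "\<dots> = det (mat n n (\<lambda>(i, k). \<Sum>s\<in>B i. u i s * p k s))"
    by (simp add: det_def'[of _ n] lessThan_atLeast0)
  finally show ?thesis .
qed

definition vset :: "('a::linorder \<Rightarrow> real) \<Rightarrow> 'a set \<Rightarrow> real" where
  "vset v S = (\<Prod>q\<in>S. \<Prod>p | p \<in> S \<and> p < q. v q - v p)"

lemma finite_strict_enumeration:
  fixes S :: "'a::linorder set"
  assumes "finite S"
  obtains e where "strict_mono_on {..<card S} e" "e ` {..<card S} = S"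
proof
  let ?l = "sorted_list_of_set S"
  have len: "length ?l = card S" using assms by simp
  show "strict_mono_on {..<card S} (\<lambda>i. ?l ! i)"
    using sorted_wrt_nth_less[OF strict_sorted_list_of_set] len by (auto intro!: strict_mono_onI)
  show "(\<lambda>i. ?l ! i) ` {..<card S} = S"
    using assms len nth_image[of "length ?l" ?l] by (simp add: lessThan_atLeast0)
qed

lemma vset_enumeration:
  fixes e :: "nat \<Rightarrow> 'a::linorder"
  assumes "strict_mono_on {..<n} e"
  shows "vset v (e ` {..<n}) = vdm (\<lambda>i. v (e i)) n"
proof -
  have inj: "inj_on e {..<n}" using assms by (rule strict_mono_on_imp_inj_on)
  have less: "e i < e j \<longleftrightarrow> i < j" if "i < n" "j < n" for i j
    using assms that by (metis lessThan_iff not_less_iff_gr_or_eq strict_mono_onD)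
  have "{p. p \<in> e ` {..<n} \<and> p < e j} = e ` {..<j}" if "j < n" for j
    using less that by auto
  moreover have "inj_on e {..<j}" if "j < n" for j
    using inj by (rule inj_on_subset) (use that in auto)
  ultimately show ?thesis
    unfolding vset_def vdm_def by (simp add: prod.reindex[OF inj] prod.reindex)
qed

lemma vdm_eq_0:
  assumes "i < j" "j < n" "t i = t j" shows "vdm t n = 0"
proof -
  have "(\<Prod>i<j. t j - t i) = 0" by (rule prod_zero) (use assms in \<open>auto intro: bexI[of _ i]\<close>)
  then show ?thesis unfolding vdm_def using assms(2) by (intro prod_zero) auto
qed

text \<open>Andreief's identity. Expanding the determinant of moments gives a sum over all tuples.
  Tuples with a repetition vanish; those with image \<open>S\<close> are the permutations of one
  enumeration of \<open>S\<close>, and their signs assemble the values of \<open>Q\<close> into a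
  second Vandermonde determinant. That \<open>P\<close> and \<open>Q\<close> may differ is essential
  for the application.\<close>

lemma sum_subsets_vset_squared:
  fixes v w :: "'a::linorder \<Rightarrow> real" and P Q :: "nat \<Rightarrow> real poly"
  assumes I: "finite I"
    and P: "\<And>k. k < n \<Longrightarrow> degree (P k) = k" "\<And>k. k < n \<Longrightarrow> lead_coeff (P k) = 1"
    and Q: "\<And>k. k < n \<Longrightarrow> degree (Q k) = k" "\<And>k. k < n \<Longrightarrow> lead_coeff (Q k) = 1"
  shows "(\<Sum>S | S \<subseteq> I \<and> card S = n. (vset v S)\<^sup>2 * (\<Prod>s\<in>S. w s)) =
    det (mat n n (\<lambda>(i, k). \<Sum>s\<in>I. w s * poly (Q i) (v s) * poly (P k) (v s)))"
proof -
  define f where "f y = (\<Prod>i<n. w (y i) * poly (Q i) (v (y i))) * vdm (\<lambda>i. v (y i)) n" for y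
  have "det (mat n n (\<lambda>(i, k). \<Sum>s\<in>I. w s * poly (Q i) (v s) * poly (P k) (v s))) =
      (\<Sum>y\<in>PiE {..<n} (\<lambda>_. I). f y)"
    unfolding f_def
    using sum_PiE_det[of n "\<lambda>_. I" "\<lambda>i s. w s * poly (Q i) (v s)" "\<lambda>k s. poly (P k) (v s)"] I
      det_monic[of n P] P by simp
  also have "\<dots> = (\<Sum>y | y \<in> PiE {..<n} (\<lambda>_. I) \<and> inj_on y {..<n}. f y)"
  proof (rule sum.mono_neutral_right)
    show "\<forall>y\<in>PiE {..<n} (\<lambda>_. I) - {y \<in> PiE {..<n} (\<lambda>_. I). inj_on y {..<n}}. f y = 0"
    proof
      fix y assume "y \<in> PiE {..<n} (\<lambda>_. I) - {y \<in> PiE {..<n} (\<lambda>_. I). inj_on y {..<n}}"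
      then obtain i j where "i < n" "j < n" "i \<noteq> j" "y i = y j" by (auto simp: inj_on_def)
      then obtain i j where "i < j" "j < n" "y i = y j" by (metis nat_neq_iff)
      then have "vdm (\<lambda>i. v (y i)) n = 0" by (intro vdm_eq_0[of i j]) auto
      then show "f y = 0" by (simp add: f_def)
    qed
  qed (use I in \<open>auto intro!: finite_PiE\<close>)
  also have "\<dots> = (\<Sum>S | S \<subseteq> I \<and> card S = n. \<Sum>y | (y \<in> PiE {..<n} (\<lambda>_. I) \<and> inj_on y {..<n}) \<and> y ` {..<n} = S. f y)"
  proof -
    let ?X = "{y. y \<in> PiE {..<n} (\<lambda>_. I) \<and> inj_on y {..<n}}" and ?T = "{S. S \<subseteq> I \<and> card S = n}"
    have "finite (PiE {..<n} (\<lambda>_. I))" using I by (intro finite_PiE) auto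
    then have 1: "finite ?X" by simp
    have 2: "finite ?T" using I by simp
    have 3: "(\<lambda>y. y ` {..<n}) ` ?X \<subseteq> ?T"
    proof
      fix S assume "S \<in> (\<lambda>y. y ` {..<n}) ` ?X"
      then obtain y where "y \<in> PiE {..<n} (\<lambda>_. I)" "inj_on y {..<n}" "S = y ` {..<n}" by blast
      then show "S \<in> ?T" by (auto simp: card_image)
    qed
    show ?thesis
      using sum.group[OF 1 2 3, of f] unfolding mem_Collect_eq by (rule sym)
  qed
  also have "\<dots> = (\<Sum>S | S \<subseteq> I \<and> card S = n. (vset v S)\<^sup>2 * (\<Prod>s\<in>S. w s))"
  proof (rule sum.cong[OF refl])
    fix S assume "S \<in> {S. S \<subseteq> I \<and> card S = n}"
    then have S: "S \<subseteq> I" "card S = n" and fS: "finite S" using I finite_subset by auto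
    obtain e where e: "strict_mono_on {..<n} e" "e ` {..<n} = S"
      using finite_strict_enumeration[OF fS] S by metis
    have inj: "inj_on e {..<n}" using e(1) by (rule strict_mono_on_imp_inj_on)
    let ?P = "{\<pi>. \<pi> permutes {..<n}}"
    let ?Y = "{y. (y \<in> PiE {..<n} (\<lambda>_. I) \<and> inj_on y {..<n}) \<and> y ` {..<n} = S}"
    have "(\<Sum>y\<in>?Y. f y) = (\<Sum>\<pi>\<in>?P. f (restrict (\<lambda>i. e (\<pi> i)) {..<n}))"
    proof (rule sum.reindex_bij_witness[symmetric, where
          i = "\<lambda>y i. if i < n then inv_into {..<n} e (y i) else i" and j = "\<lambda>\<pi>. restrict (\<lambda>i. e (\<pi> i)) {..<n}"])
      fix \<pi> assume "\<pi> \<in> ?P"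
      then have \<pi>: "\<pi> permutes {..<n}" by simp
      have in_n: "\<pi> i < n" if "i < n" for i using permutes_in_image[OF \<pi>, of i] that by simp
      show "(\<lambda>i. if i < n then inv_into {..<n} e (restrict (\<lambda>i. e (\<pi> i)) {..<n} i) else i) = \<pi>"
        using in_n inj permutes_not_in[OF \<pi>] by (auto simp: fun_eq_iff)
      have "inj_on (e \<circ> \<pi>) {..<n}"
        by (rule comp_inj_on) (use permutes_inj_on[OF \<pi>] permutes_image[OF \<pi>] inj in simp_all)
      then have "inj_on (\<lambda>i. e (\<pi> i)) {..<n}" by (simp add: o_def)
      then have 1: "inj_on (restrict (\<lambda>i. e (\<pi> i)) {..<n}) {..<n}" by (simp only: inj_on_restrict_eq)
      have "(\<lambda>i. e (\<pi> i)) ` {..<n} = S"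
        using permutes_image[OF \<pi>] e(2) by (metis image_image)
      then have 2: "restrict (\<lambda>i. e (\<pi> i)) {..<n} ` {..<n} = S" by (simp only: image_restrict_eq)
      have "e (\<pi> i) \<in> I" if "i < n" for i using S(1) e(2) in_n[OF that] by blast
      then have 3: "restrict (\<lambda>i. e (\<pi> i)) {..<n} \<in> PiE {..<n} (\<lambda>_. I)" by simp
      show "restrict (\<lambda>i. e (\<pi> i)) {..<n} \<in> ?Y"
        by (rule CollectI) (intro conjI 1 2 3)
    next
      fix y assume y: "y \<in> ?Y"
      then have yP: "y \<in> PiE {..<n} (\<lambda>_. I)" and yi: "inj_on y {..<n}" and yim: "y ` {..<n} = S" by blast+
      have yS: "y i \<in> e ` {..<n}" if "i < n" for i
        unfolding e(2) yim[symmetric] using that by simp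
      let ?\<pi> = "\<lambda>i. if i < n then inv_into {..<n} e (y i) else i"
      show "restrict (\<lambda>i. e (?\<pi> i)) {..<n} = y"
        using yS PiE_arb[OF yP] by (auto simp: fun_eq_iff f_inv_into_f)
      have "bij_betw y {..<n} S" using yi yim by (simp add: bij_betw_def)
      moreover have "bij_betw (inv_into {..<n} e) S {..<n}"
        using inj e(2) by (intro bij_betw_inv_into) (simp add: bij_betw_def)
      ultimately have "bij_betw (inv_into {..<n} e \<circ> y) {..<n} {..<n}" by (rule bij_betw_trans)
      then have "bij_betw ?\<pi> {..<n} {..<n}"
        by (rule bij_betw_cong[THEN iffD1, rotated]) simp
      then show "?\<pi> \<in> ?P" by (auto intro!: bij_imp_permutes split: if_splits)
    qed simp
    also have "\<dots> = (\<Sum>\<pi>\<in>?P. vset v S * (\<Prod>s\<in>S. w s) * (signof \<pi> * (\<Prod>i<n. poly (Q i) (v (e (\<pi> i))))))"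
    proof (rule sum.cong[OF refl])
      fix \<pi> assume "\<pi> \<in> ?P"
      then have \<pi>: "\<pi> permutes {..<n}" by simp
      have in_n: "\<pi> i < n" if "i < n" for i using permutes_in_image[OF \<pi>, of i] that by simp
      let ?A = "mat n n (\<lambda>(i, k). poly (P k) (v (e i)))"
      \<comment> \<open>The sign from permuting the rows here is the one that the Leibniz expansion
        of the \<open>Q\<close> determinant asks for.\<close>
      have "vdm (\<lambda>i. v (e (\<pi> i))) n = det (mat n n (\<lambda>(i, k). poly (P k) (v (e (\<pi> i)))))"
        using det_monic[of n P] P by simp
      also have "mat n n (\<lambda>(i, k). poly (P k) (v (e (\<pi> i)))) = mat n n (\<lambda>(i, k). ?A $$ (\<pi> i, k))"
        using in_n by (intro eq_matI) auto
      also have "det \<dots> = signof \<pi> * det ?A"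
        using \<pi> by (intro det_permute_rows) (auto simp: lessThan_atLeast0)
      also have "det ?A = vset v S"
        using det_monic[of n P] P e by (simp add: vset_enumeration[OF e(1), unfolded e(2)])
      finally have 1: "vdm (\<lambda>i. v (e (\<pi> i))) n = signof \<pi> * vset v S" .
      have "(\<Prod>i<n. w (e (\<pi> i))) = (\<Prod>i<n. w (e i))"
        using prod.permute[OF \<pi>, of "\<lambda>i. w (e i)"] by (simp add: o_def)
      also have "\<dots> = (\<Prod>s\<in>S. w s)"
        unfolding e(2)[symmetric] by (simp add: prod.reindex[OF inj])
      finally have 2: "(\<Prod>i<n. w (e (\<pi> i))) = (\<Prod>s\<in>S. w s)" .
      have 3: "vdm (\<lambda>i. v (restrict (\<lambda>i. e (\<pi> i)) {..<n} i)) n = vdm (\<lambda>i. v (e (\<pi> i))) n"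
        unfolding vdm_def by (intro prod.cong refl) auto
      show "f (restrict (\<lambda>i. e (\<pi> i)) {..<n}) =
        vset v S * (\<Prod>s\<in>S. w s) * (signof \<pi> * (\<Prod>i<n. poly (Q i) (v (e (\<pi> i)))))"
        unfolding f_def 3 1 by (simp add: prod.distrib 2)
    qed
    also have "\<dots> = vset v S * (\<Prod>s\<in>S. w s) * det (mat n n (\<lambda>(i, k). poly (Q i) (v (e k))))"
      by (simp add: det_def'[of _ n] lessThan_atLeast0 sum_distrib_left permutes_in_image)
    also have "det (mat n n (\<lambda>(i, k). poly (Q i) (v (e k)))) = vset v S"
      using det_monic[of n Q "\<lambda>k. v (e k)"] Q det_transpose'[of n "\<lambda>i k. poly (Q k) (v (e i))"] e
      by (simp add: vset_enumeration[OF e(1), unfolded e(2)])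
    finally show "(\<Sum>y\<in>?Y. f y) = (vset v S)\<^sup>2 * (\<Prod>s\<in>S. w s)"
      by (simp add: power2_eq_square)
  qed
  finally show ?thesis by simp
qed

section \<open>A discrete Selberg sum of Racah type\<close>

lemma det_scale:
  fixes A :: "nat \<Rightarrow> nat \<Rightarrow> real"
  shows "det (mat n n (\<lambda>(i, k). r i * c k * A i k)) =
    (\<Prod>i<n. r i) * (\<Prod>k<n. c k) * det (mat n n (\<lambda>(i, k). A i k))"
proof -
  have *: "signof \<pi> * (\<Prod>i = 0..<n. r i * c (\<pi> i) * A i (\<pi> i)) =
      (\<Prod>i<n. r i) * (\<Prod>k<n. c k) * (signof \<pi> * (\<Prod>i = 0..<n. A i (\<pi> i)))"
    if "\<pi> permutes {0..<n}" for \<pi>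
  proof -
    have "(\<Prod>i = 0..<n. c (\<pi> i)) = (\<Prod>i = 0..<n. c i)"
      using prod.permute[OF that, of c] by (simp add: o_def)
    then show ?thesis by (simp add: prod.distrib lessThan_atLeast0)
  qed
  have "det (mat n n (\<lambda>(i, k). r i * c k * A i k)) =
      (\<Sum>\<pi> | \<pi> permutes {0..<n}. signof \<pi> * (\<Prod>i = 0..<n. r i * c (\<pi> i) * A i (\<pi> i)))"
    by (simp add: det_def'[of _ n])
  also have "\<dots> = (\<Sum>\<pi> | \<pi> permutes {0..<n}.
      (\<Prod>i<n. r i) * (\<Prod>k<n. c k) * (signof \<pi> * (\<Prod>i = 0..<n. A i (\<pi> i))))"
    by (rule sum.cong[OF refl], rule *) simp
  also have "\<dots> = (\<Prod>i<n. r i) * (\<Prod>k<n. c k) * det (mat n n (\<lambda>(i, k). A i k))"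
    by (simp add: det_def'[of _ n] sum_distrib_left)
  finally show ?thesis .
qed

text \<open>Rows and columns are reversed by the same permutation, whose sign enters
  squared.\<close>

lemma det_reverse:
  fixes A :: "nat \<Rightarrow> nat \<Rightarrow> real"
  shows "det (mat n n (\<lambda>(i, k). A (n - Suc i) (n - Suc k))) = det (mat n n (\<lambda>(i, k). A i k))"
proof -
  define p where "p i = (if i < n then n - Suc i else i)" for i
  have p: "p permutes {0..<n}"
    by (rule bij_imp_permutes, rule bij_betw_byWitness[where f' = p]) (auto simp: p_def)
  have rows: "det (mat n n (\<lambda>(i, k). B (n - Suc i) k)) = signof p * det (mat n n (\<lambda>(i, k). B i k))"
    for B :: "nat \<Rightarrow> nat \<Rightarrow> real"
  proof -
    have "mat n n (\<lambda>(i, k). B (n - Suc i) k) = mat n n (\<lambda>(i, k). mat n n (\<lambda>(i, k). B i k) $$ (p i, k))"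
      by (intro eq_matI) (auto simp: p_def)
    then show ?thesis using det_permute_rows[OF _ p, of "mat n n (\<lambda>(i, k). B i k)"] by simp
  qed
  have "det (mat n n (\<lambda>(i, k). A (n - Suc i) (n - Suc k))) = signof p * det (mat n n (\<lambda>(i, k). A i (n - Suc k)))"
    using rows[of "\<lambda>i k. A i (n - Suc k)"] by simp
  also have "det (mat n n (\<lambda>(i, k). A i (n - Suc k))) = det (mat n n (\<lambda>(k, i). A i (n - Suc k)))"
    using det_transpose'[of n "\<lambda>i k. A i (n - Suc k)"] by simp
  also have "\<dots> = signof p * det (mat n n (\<lambda>(i, k). A i k))"
    using rows[of "\<lambda>k i. A i k"] det_transpose'[of n A] by simp
  finally show ?thesis by (simp add: sign_def)
qed

text \<open>Once \<open>1 / fact (q + n - 1 + k)\<close> is pulled out of column \<open>k\<close>,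
  row \<open>j\<close> is a monic polynomial in \<open>k\<close> of degree \<open>n - Suc j\<close>,
  a falling factorial. Reversal makes the degrees increase, and the Vandermonde product at the
  decreasing points \<open>n - 1, ..., 0\<close> supplies the signs.\<close>

lemma det_inverse_factorials:
  "det (mat n n (\<lambda>(j, k). 1 / fact (q + j + k) :: real)) = (\<Prod>k<n. (- 1) ^ k * fact k / fact (q + n - 1 + k))"
proof (cases "n = 0")
  case False
  define P :: "nat \<Rightarrow> real poly" where "P d = (\<Prod>l<d. [:real (q + n - 1) - real l, 1:])" for d
  have P: "degree (P k) = k" "lead_coeff (P k) = 1" for k
    unfolding P_def by (simp add: degree_prod_eq_sum_degree) (subst lead_coeff_prod, simp)
  have PS: "poly (P (n - Suc j)) (real k) * fact (q + j + k) = fact (q + n - 1 + k)" if "j < n" for j k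
  proof -
    have *: "poly (P d) (real k) * fact (q + n - 1 + k - d) = fact (q + n - 1 + k)" if "d < n" for d
      using that
    proof (induction d)
      case (Suc d)
      have "q + n - 1 + k - d = Suc (q + n - 1 + k - Suc d)" using Suc.prems by simp
      then have "fact (q + n - 1 + k - d) = (real (q + n - 1) - real d + real k) * fact (q + n - 1 + k - Suc d)"
        using Suc.prems by (simp add: of_nat_diff)
      moreover have "poly (P (Suc d)) (real k) = poly (P d) (real k) * (real (q + n - 1) - real d + real k)"
        by (simp add: P_def algebra_simps)
      ultimately have "poly (P (Suc d)) (real k) * fact (q + n - 1 + k - Suc d) =
          poly (P d) (real k) * fact (q + n - 1 + k - d)"
        by (simp only: mult.assoc)
      then show ?case using Suc by simp
    qed (simp add: P_def)
    show ?thesis using *[of "n - Suc j"] that by (simp add: add_ac)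
  qed
  have "det (mat n n (\<lambda>(j, k). 1 / fact (q + j + k) :: real)) =
      det (mat n n (\<lambda>(j, k). 1 * (1 / fact (q + n - 1 + k)) * poly (P (n - Suc j)) (real k)))"
  proof (rule arg_cong[where f = det], rule eq_matI, goal_cases)
    case (1 j k)
    then show ?case using PS[of j k] by (simp add: field_simps)
  qed auto
  also have "\<dots> = (\<Prod>k<n. 1 / fact (q + n - 1 + k)) * det (mat n n (\<lambda>(j, k). poly (P (n - Suc j)) (real k)))"
    by (subst det_scale) simp
  also have "det (mat n n (\<lambda>(j, k). poly (P (n - Suc j)) (real k))) =
      det (mat n n (\<lambda>(j, k). poly (P j) (real (n - Suc k))))"
  proof -
    have "mat n n (\<lambda>(j, k). poly (P (n - Suc j)) (real k)) =
        mat n n (\<lambda>(j, k). poly (P (n - Suc j)) (real (n - Suc (n - Suc k))))"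
      by (rule eq_matI) auto
    then show ?thesis using det_reverse[of n "\<lambda>j k. poly (P j) (real (n - Suc k))"] by simp
  qed
  also have "\<dots> = vdm (\<lambda>k. real (n - Suc k)) n"
    using det_monic[of n P "\<lambda>k. real (n - Suc k)"] P
      det_transpose'[of n "\<lambda>k j. poly (P j) (real (n - Suc k))"] by simp
  also have "\<dots> = (\<Prod>k<n. (- 1) ^ k * fact k)"
    unfolding vdm_def
  proof (rule prod.cong[OF refl])
    fix k assume "k \<in> {..<n}"
    then have "(\<Prod>i<k. real (n - Suc k) - real (n - Suc i)) = (\<Prod>i<k. - 1 * real (k - i))"
      by (intro prod.cong) (auto simp: of_nat_diff)
    also have "\<dots> = (- 1) ^ k * (\<Prod>i<k. real (k - i))"
      by (simp only: prod.distrib prod_constant card_lessThan)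
    also have "(\<Prod>i<k. real (k - i)) = fact k"
      using prod.nat_diff_reindex[of "\<lambda>i. real (Suc i)" k]
      by (simp add: fact_prod_Suc lessThan_atLeast0 Suc_diff_Suc cong: prod.cong_simp)
    finally show "(\<Prod>i<k. real (n - Suc k) - real (n - Suc i)) = (- 1) ^ k * fact k" .
  qed
  finally show ?thesis by (simp add: prod.distrib prod_dividef)
qed simp

text \<open>A form of the Chu-Vandermonde identity. It follows from Pascal's rule because the
  summand satisfies \<open>g q j + g q (Suc j) = g (Suc q) j\<close>. The coefficients
  \<open>i choose j\<close> are free of \<open>k\<close>, so the identity is a matrix
  factorisation.\<close>

lemma fact_quotient_shift:
  fixes m q k i :: nat
  assumes "i \<le> m"
  shows "(fact (q + m + i + k) / fact (q + i + k) :: real) =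
    (\<Sum>j\<le>i. real (i choose j) * (fact m / fact (m - j) * (fact (q + m + k) / fact (q + j + k))))"
  using assms
proof (induction i arbitrary: q)
  case (Suc i)
  define g where "g q j = (fact m / fact (m - j) * (fact (q + m + k) / fact (q + j + k)) :: real)" for q j
  have g: "g q j + g q (Suc j) = g (Suc q) j" if "j < m" for j
  proof -
    have aux: "D / (r * A) * (C / B) + D / A * (C / (t * B)) = D / (r * A) * ((t + r) * C / (t * B))"
      if "r \<noteq> 0" "t \<noteq> 0" "A \<noteq> 0" "B \<noteq> 0" for A B C D r t :: real
      using that by (simp add: field_simps)
    have 1: "fact (m - j) = real (m - j) * fact (m - Suc j)"
      using that by (metis Suc_diff_Suc fact_Suc)
    have 2: "fact (q + Suc j + k) = real (q + j + k + 1) * fact (q + j + k)"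
      "fact (Suc q + j + k) = real (q + j + k + 1) * fact (q + j + k)"
      "fact (Suc q + m + k) = (real (q + j + k + 1) + real (m - j)) * fact (q + m + k)"
      using that by (simp_all add: of_nat_diff algebra_simps)
    show ?thesis
      unfolding g_def 1 2 by (rule aux) (use that in auto)
  qed
  have "fact (q + m + Suc i + k) / fact (q + Suc i + k) = (\<Sum>j\<le>i. real (i choose j) * g (Suc q) j)"
    using Suc.IH[of "Suc q"] Suc.prems unfolding g_def by simp
  also have "\<dots> = (\<Sum>j\<le>i. real (i choose j) * g q j) + (\<Sum>j\<le>i. real (i choose j) * g q (Suc j))"
    unfolding sum.distrib[symmetric]
  proof (rule sum.cong[OF refl])
    fix j assume "j \<in> {..i}"
    then show "real (i choose j) * g (Suc q) j = real (i choose j) * g q j + real (i choose j) * g q (Suc j)"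
      using g[of j] Suc.prems by (simp flip: distrib_left)
  qed
  also have "\<dots> = (\<Sum>j\<le>Suc i. real (Suc i choose j) * g q j)"
  proof -
    have "(\<Sum>j\<le>i. real (i choose j) * g q j) = g q 0 + (\<Sum>j\<le>i. real (i choose Suc j) * g q (Suc j))"
      using sum.atMost_Suc_shift[of "\<lambda>j. real (i choose j) * g q j" i]
      by (simp add: binomial_eq_0)
    then show ?thesis
      by (subst sum.atMost_Suc_shift) (simp add: sum.distrib distrib_right)
  qed
  finally show ?case unfolding g_def .
qed simp

text \<open>By \<open>fact_quotient_shift\<close> the matrix is a unitriangular binomial matrix
  times a row- and column-scaled Hankel matrix of inverse factorials. The bound on \<open>n\<close>
  keeps \<open>m - j\<close> from being truncated.\<close>

lemma det_fact_quotients: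
  assumes "n \<le> Suc m"
  shows "det (mat n n (\<lambda>(i, k). fact (q + m + i + k) / fact (q + i + k) :: real)) =
    (\<Prod>k<n. (- 1) ^ k * fact m * fact (q + m + k) * fact k / (fact (m - k) * fact (q + n - 1 + k)))"
proof -
  let ?L = "mat n n (\<lambda>(i, j). real (i choose j))"
  let ?B = "mat n n (\<lambda>(j, k). fact m / fact (m - j) * fact (q + m + k) * (1 / fact (q + j + k)) :: real)"
  have "mat n n (\<lambda>(i, k). fact (q + m + i + k) / fact (q + i + k) :: real) = ?L * ?B"
  proof (rule eq_matI)
    fix i k assume "i < dim_row (?L * ?B)" "k < dim_col (?L * ?B)"
    then have ik: "i < n" "k < n" by auto
    have "(fact (q + m + i + k) / fact (q + i + k) :: real) =
      (\<Sum>j\<in>{..i}. real (i choose j) * (fact m / fact (m - j) * fact (q + m + k) * (1 / fact (q + j + k))))"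
      using ik assms by (subst fact_quotient_shift) auto
    also have "\<dots> = (\<Sum>j\<in>{0..<n}. real (i choose j) * (fact m / fact (m - j) * fact (q + m + k) * (1 / fact (q + j + k))))"
      using ik by (intro sum.mono_neutral_left) auto
    finally show "mat n n (\<lambda>(i, k). fact (q + m + i + k) / fact (q + i + k)) $$ (i, k) = (?L * ?B) $$ (i, k)"
      using ik by (simp add: scalar_prod_def)
  qed auto
  moreover have "det ?L = 1"
    by (subst det_lower_triangular[of n]) (auto simp: prod_list_diag_prod)
  ultimately have "det (mat n n (\<lambda>(i, k). fact (q + m + i + k) / fact (q + i + k) :: real)) = det ?B"
    by (simp add: det_mult[of _ n])
  also have "\<dots> = (\<Prod>i<n. fact m / fact (m - i)) * (\<Prod>k<n. fact (q + m + k)) *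
      (\<Prod>k<n. (- 1) ^ k * fact k / fact (q + n - 1 + k))"
    by (subst det_scale) (simp add: det_inverse_factorials)
  finally show ?thesis by (simp add: prod.distrib prod_dividef mult_ac)
qed

text \<open>For \<open>a \<le> s < b \<le> c\<close> this is \<open>2 * s + 1\<close> times the
  product of \<open>\<bar>(s + 1/2)^2 - (f + 1/2)^2\<bar>\<close> over all \<open>f < a\<close> and
  all \<open>f\<close> with \<open>b \<le> f < c\<close>, the positions on either side of the gap.
  Only in this range are the subtractions free of truncation.\<close>

definition racah_weight :: "nat \<Rightarrow> nat \<Rightarrow> nat \<Rightarrow> nat \<Rightarrow> real" where
  "racah_weight a b c s = (2 * real s + 1) * fact (s + a) * fact (c - 1 - s) * fact (c + s)
     / (fact (s - a) * fact (b - 1 - s) * fact (b + s))"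

text \<open>The total mass on \<open>n + 1\<close> points, a terminating very-well-poised
  hypergeometric sum. The induction uses a contiguity relation: the constant
  \<open>(b - 1 - a) * (b + a)\<close> is the sum of \<open>(b - 1 - s) * (b + s)\<close>, which
  lowers \<open>b\<close> in the weight, and \<open>(s - a) * (s + a + 1)\<close>, which raises
  \<open>a\<close>. Either way one point is lost.\<close>

lemma sum_racah_weight:
  "(\<Sum>s = a..<a + n + 1. racah_weight a (a + n + 1) (a + n + 1 + \<beta>) s) =
    fact (2 * a + n + 1 + \<beta>) * fact a * fact (a + n + 1 + \<beta>) * fact \<beta>
      / (fact n * fact (a + n) * fact (\<beta> + a + 1))"
proof (induction n arbitrary: a \<beta>)
  case 0
  have *: "fact (a + 1 + a) = (2 * real a + 1) * fact (a + a)" by simp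
  have "2 * real a + 1 \<noteq> 0" by linarith
  then have "racah_weight a (a + 1) (a + 1 + \<beta>) a = fact (a + 1 + \<beta> + a) * fact \<beta>"
    unfolding racah_weight_def * by (simp del: fact_Suc)
  moreover have "fact (2 * a + 0 + 1 + \<beta>) * fact a * fact (a + 0 + 1 + \<beta>) * fact \<beta>
      / (fact 0 * fact (a + 0) * fact (\<beta> + a + 1)) = (fact (a + 1 + \<beta> + a) * fact \<beta> :: real)"
    by (simp add: mult_2 add_ac del: fact_Suc)
  ultimately show ?case by simp
next
  case (Suc n)
  define b c where "b = a + Suc n + 1" and "c = b + \<beta>"
  define C where "C a n \<beta> = (fact (2 * a + n + 1 + \<beta>) * fact a * fact (a + n + 1 + \<beta>) * fact \<beta>
      / (fact n * fact (a + n) * fact (\<beta> + a + 1)) :: real)" for a n \<beta> :: nat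
  \<comment> \<open>The factor \<open>b - 1 - s\<close> kills the last point. Lowering
    \<open>b\<close> with \<open>c\<close> fixed raises \<open>\<beta> = c - b\<close> by
    one.\<close>
  have 1: "(\<Sum>s = a..<b. racah_weight a b c s * (real (b - 1 - s) * real (b + s))) = C a n (Suc \<beta>)"
  proof -
    have "(\<Sum>s = a..<b. racah_weight a b c s * (real (b - 1 - s) * real (b + s))) =
        (\<Sum>s = a..<b - 1. racah_weight a b c s * (real (b - 1 - s) * real (b + s)))"
      by (intro sum.mono_neutral_right) (auto simp: b_def)
    also have "\<dots> = (\<Sum>s = a..<b - 1. racah_weight a (b - 1) c s)"
    proof (rule sum.cong[OF refl])
      fix s assume "s \<in> {a..<b - 1}"
      then have s: "s < b - 1" by simp
      then have *: "b - 1 - s - 1 = b - 1 - 1 - s" "b + s - 1 = b - 1 + s" by auto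
      have 1: "fact (b - 1 - s) = real (b - 1 - s) * fact (b - 1 - 1 - s)"
        and 2: "fact (b + s) = real (b + s) * fact (b - 1 + s)"
        using s by (simp_all only: fact_reduce[of "b - 1 - s"] fact_reduce[of "b + s"] *)
      have aux: "x / (y * (r * p) * (t * q)) * (r * t) = x / (y * p * q)"
        if "r \<noteq> 0" "t \<noteq> 0" for x y r t p q :: real
        using that by (simp add: divide_simps)
      show "racah_weight a b c s * (real (b - 1 - s) * real (b + s)) = racah_weight a (b - 1) c s"
        unfolding racah_weight_def 1 2 by (rule aux) (use s in auto)
    qed
    also have "\<dots> = C a n (Suc \<beta>)" using Suc.IH[of a "Suc \<beta>"] by (simp add: b_def c_def C_def)
    finally show ?thesis .
  qed
  \<comment> \<open>The factor \<open>s - a\<close> kills the first point; \<open>b\<close> and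
    \<open>c\<close>, hence \<open>\<beta>\<close>, stay.\<close>
  have 2: "(\<Sum>s = a..<b. racah_weight a b c s * (real (s - a) * real (s + a + 1))) = C (Suc a) n \<beta>"
  proof -
    have "(\<Sum>s = a..<b. racah_weight a b c s * (real (s - a) * real (s + a + 1))) =
        (\<Sum>s = Suc a..<b. racah_weight a b c s * (real (s - a) * real (s + a + 1)))"
      by (intro sum.mono_neutral_right) (auto simp: b_def)
    also have "\<dots> = (\<Sum>s = Suc a..<b. racah_weight (Suc a) b c s)"
    proof (rule sum.cong[OF refl])
      fix s assume "s \<in> {Suc a..<b}"
      then have "s > a" by simp
      then have 1: "fact (s - a) = real (s - a) * fact (s - Suc a)"
        by (metis Suc_diff_Suc fact_Suc)
      have 2: "fact (s + Suc a) = real (s + a + 1) * fact (s + a)" by simp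
      have aux: "x * p * y * z / (r * q * u * w) * (r * t) = x * (t * p) * y * z / (q * u * w)"
        if "r \<noteq> 0" for x y z r t p q u w :: real
        using that by (simp add: divide_simps)
      show "racah_weight a b c s * (real (s - a) * real (s + a + 1)) = racah_weight (Suc a) b c s"
        unfolding racah_weight_def 1 2 by (rule aux) (use \<open>s > a\<close> in simp)
    qed
    also have "\<dots> = C (Suc a) n \<beta>" using Suc.IH[of "Suc a" \<beta>] by (simp add: b_def c_def C_def add_ac)
    finally show ?thesis .
  qed
  have "real (Suc n) * real (2 * a + n + 2) * (\<Sum>s = a..<b. racah_weight a b c s) =
      C a n (Suc \<beta>) + C (Suc a) n \<beta>"
    unfolding 1[symmetric] 2[symmetric] sum.distrib[symmetric] sum_distrib_left
  proof (rule sum.cong[OF refl])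
    fix s assume "s \<in> {a..<b}"
    then have s: "a \<le> s" "s < b" by auto
    have "real (Suc n) * real (2 * a + n + 2) =
        real (b - 1 - s) * real (b + s) + real (s - a) * real (s + a + 1)"
      using s by (simp add: of_nat_diff b_def algebra_simps)
    then show "real (Suc n) * real (2 * a + n + 2) * racah_weight a b c s =
        racah_weight a b c s * (real (b - 1 - s) * real (b + s)) +
        racah_weight a b c s * (real (s - a) * real (s + a + 1))"
      by (simp only: distrib_left mult_ac)
  qed
  also have "\<dots> = real (Suc n) * real (2 * a + n + 2) * C a (Suc n) \<beta>"
  proof -
    have fS: "fact m = (real k + 1) * fact k" if "m = Suc k" for m k :: nat
      using that by simp
    define E G k where "E = (fact (2 * a + Suc n + 1 + \<beta>) :: real)"
      and "G = (fact (a + Suc n + 1 + \<beta>) :: real)"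
      and "k = E * fact a * G * fact \<beta> / (fact n * fact (a + n) * fact (\<beta> + a + 1))"
    have eqs: "2 * a + n + 1 + Suc \<beta> = 2 * a + Suc n + 1 + \<beta>" "a + n + 1 + Suc \<beta> = a + Suc n + 1 + \<beta>"
      "Suc a + n + 1 + \<beta> = a + Suc n + 1 + \<beta>"
      by simp_all
    have f: "fact (Suc \<beta>) = (real \<beta> + 1) * fact \<beta>"
      "fact (Suc \<beta> + a + 1) = (real (\<beta> + a + 1) + 1) * fact (\<beta> + a + 1)"
      "fact (\<beta> + Suc a + 1) = (real (\<beta> + a + 1) + 1) * fact (\<beta> + a + 1)"
      "fact (2 * Suc a + n + 1 + \<beta>) = (real (2 * a + Suc n + 1 + \<beta>) + 1) * fact (2 * a + Suc n + 1 + \<beta>)"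
      "fact (Suc a) = (real a + 1) * fact a" "fact (Suc n) = (real n + 1) * fact n"
      "fact (Suc a + n) = (real (a + n) + 1) * fact (a + n)"
      "fact (a + Suc n) = (real (a + n) + 1) * fact (a + n)"
      by (rule fS, simp)+
    have "C a n (Suc \<beta>) = k * ((real \<beta> + 1) / (real (\<beta> + a + 1) + 1))"
      unfolding C_def eqs f k_def E_def[symmetric] G_def[symmetric]
      by (simp only: times_divide_eq_left times_divide_eq_right divide_divide_eq_left mult_ac)
    moreover have "C (Suc a) n \<beta> = k * ((real (2 * a + Suc n + 1 + \<beta>) + 1) * (real a + 1)
        / ((real (a + n) + 1) * (real (\<beta> + a + 1) + 1)))"
      unfolding C_def eqs f k_def E_def[symmetric] G_def[symmetric]
      by (simp only: times_divide_eq_left times_divide_eq_right divide_divide_eq_left mult_ac)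
    moreover have "real (Suc n) * real (2 * a + n + 2) * C a (Suc n) \<beta> =
        k * (real (2 * a + n + 2) / (real (a + n) + 1))"
      proof -
      have "real n + 1 \<noteq> 0" by linarith
      then have "(real n + 1) * g * (e / ((real n + 1) * p * (r * q) * w)) = e / (p * q * w) * (g / r)"
        for g e p q w r by (simp add: divide_simps)
      then show ?thesis
        unfolding C_def eqs f k_def E_def[symmetric] G_def[symmetric] of_nat_Suc[of n] add.commute[of 1 "real n"] .
    qed
    \<comment> \<open>All three masses are now multiples of the common \<open>k\<close>; this
      rational identity is what remains of the induction step.\<close>
    moreover have "(real \<beta> + 1) / (real (\<beta> + a + 1) + 1) + (real (2 * a + Suc n + 1 + \<beta>) + 1) * (real a + 1)
        / ((real (a + n) + 1) * (real (\<beta> + a + 1) + 1)) = real (2 * a + n + 2) / (real (a + n) + 1)"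
    proof -
      have "(p + 1) / t + (t + u) * (q + 1) / (u * t) = (t + u - p - 1) / u"
        if "t \<noteq> 0" "u \<noteq> 0" "t = p + q + 2" for p q t u :: real
        using that(1,2) by (simp add: divide_simps) (simp add: that(3) algebra_simps)
      from this[of "real \<beta> + a + 2" "real a + n + 1" "real \<beta>" "real a"]
      show ?thesis by (simp add: algebra_simps)
    qed
    ultimately show ?thesis by (simp only: distrib_left[symmetric])
  qed
  finally have "(\<Sum>s = a..<b. racah_weight a b c s) = C a (Suc n) \<beta>"
    by (rule mult_left_cancel[THEN iffD1, rotated]) (simp del: of_nat_Suc of_nat_add)
  then show ?case unfolding C_def b_def c_def .
qed


text \<open>The factor \<open>(s + 1/2)^2 - (f + 1/2)^2 = (s - f) * (s + f + 1)\<close> with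
  \<open>f = a\<close> or \<open>f = c\<close> is absorbed by the factorials and moves that
  parameter up by one. For \<open>f \<ge> c\<close> it is negative, whence the sign; the points
  \<open>s < a + i\<close> are zeros of the first product.\<close>

lemma racah_weight_shift:
  assumes "a \<le> s" "s < b" "b \<le> c"
  shows "racah_weight a b c s * (\<Prod>l<i. (real s + 1/2)\<^sup>2 - (real (a + l) + 1/2)\<^sup>2)
      * (\<Prod>l<k. (real s + 1/2)\<^sup>2 - (real (c + l) + 1/2)\<^sup>2) =
    (if a + i \<le> s then (- 1) ^ k * racah_weight (a + i) b (c + k) s else 0)"
proof -
  have 1: "fact (s + a) / fact (s - a) * (\<Prod>l<i. (real s + 1/2)\<^sup>2 - (real (a + l) + 1/2)\<^sup>2) =
    (if a + i \<le> s then fact (s + (a + i)) / fact (s - (a + i)) else 0)"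
  proof (induction i)
    case (Suc i)
    show ?case
    proof (cases "a + i < s")
      case True
      have "fact (s - (a + i)) = real (s - (a + i)) * fact (s - (a + Suc i))"
        using True by (metis Suc_diff_Suc add_Suc_right fact_Suc)
      moreover have "real (s - (a + i)) \<noteq> 0" using True by simp
      moreover have "fact (s + (a + Suc i)) = real (s + (a + i) + 1) * fact (s + (a + i))" by simp
      moreover have "(real s + 1/2)\<^sup>2 - (real (a + i) + 1/2)\<^sup>2 = real (s - (a + i)) * real (s + (a + i) + 1)"
        using True by (simp add: of_nat_diff power2_eq_square algebra_simps)
      ultimately show ?thesis using True Suc by (simp add: mult.assoc[symmetric])
    next
      case False
      then show ?thesis using Suc by (cases "s = a + i") (auto simp: mult.assoc[symmetric])
    qed
  qed (use assms in simp)
  have 2: "fact (c - 1 - s) * fact (c + s) * (\<Prod>l<k. (real s + 1/2)\<^sup>2 - (real (c + l) + 1/2)\<^sup>2) =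
    (- 1) ^ k * fact (c + k - 1 - s) * fact (c + k + s)"
  proof (induction k)
    case (Suc k)
    have pos: "0 < c + k - s" and e: "c + Suc k - 1 - s = c + k - s" "c + k - s - 1 = c + k - 1 - s"
      using assms by simp_all
    have "fact (c + Suc k - 1 - s) = real (c + k - s) * fact (c + k - 1 - s)"
      by (simp only: e fact_reduce[OF pos])
    moreover have "fact (c + Suc k + s) = real (c + k + s + 1) * fact (c + k + s)" by simp
    moreover have "(real s + 1/2)\<^sup>2 - (real (c + k) + 1/2)\<^sup>2 = - (real (c + k - s) * real (c + k + s + 1))"
      using assms by (simp add: of_nat_diff power2_eq_square algebra_simps)
    ultimately have "(- 1) ^ k * fact (c + k - 1 - s) * fact (c + k + s) * ((real s + 1/2)\<^sup>2 - (real (c + k) + 1/2)\<^sup>2)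
        = (- 1) ^ Suc k * fact (c + Suc k - 1 - s) * fact (c + Suc k + s)"
      by simp
    then show ?case using Suc by (simp only: prod.lessThan_Suc mult.assoc[symmetric])
  qed simp
  let ?u = "(2 * real s + 1) / (fact (b - 1 - s) * fact (b + s))"
  have r1: "racah_weight a b c s = ?u * (fact (s + a) / fact (s - a)) * (fact (c - 1 - s) * fact (c + s))"
    by (simp add: racah_weight_def mult_ac)
  have r2: "racah_weight (a + i) b (c + k) s =
      ?u * (fact (s + (a + i)) / fact (s - (a + i))) * (fact (c + k - 1 - s) * fact (c + k + s))"
    by (simp add: racah_weight_def mult_ac)
  have reorder: "u * p * q * x * y = u * (p * x) * (q * y)" for u p q x y :: real by simp
  show ?thesis unfolding r1 reorder 1 2 r2 by (simp add: mult_ac)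
qed

text \<open>The bases are chosen so that \<open>racah_weight_shift\<close> applies:
  \<open>Q i\<close> has its zeros at the positions \<open>a, ..., a + i - 1\<close> and
  \<open>P k\<close> at \<open>c, ..., c + k - 1\<close>. Each moment is then a total mass with
  shifted parameters, and \<open>det_fact_quotients\<close> evaluates the matrix.\<close>

theorem sum_subsets_racah:
  fixes a N y \<beta> :: nat
  assumes "y \<le> N + 1"
  defines "b \<equiv> a + N + 1" and "c \<equiv> a + N + 1 + \<beta>"
  shows "(\<Sum>S | S \<subseteq> {a..<b} \<and> card S = y.
      (vset (\<lambda>s. (real s + 1/2)\<^sup>2) S)\<^sup>2 * (\<Prod>s\<in>S. racah_weight a b c s)) =
    (\<Prod>i<y. fact (a + i) * fact (a + N + 1 + \<beta> + i) * fact (\<beta> + i) * fact (2 * a + N + 1 + \<beta> + i) * fact i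
       / (fact (N - i) * fact (a + N - i) * fact (\<beta> + a + y + i)))"
proof -
  let ?v = "\<lambda>s. (real s + 1/2)\<^sup>2"
  define P Q :: "nat \<Rightarrow> real poly"
    where "P k = (\<Prod>l<k. [:- ?v (c + l), 1:])" and "Q i = (\<Prod>l<i. [:- ?v (a + l), 1:])" for k i
  have P: "degree (P k) = k" "lead_coeff (P k) = 1" for k
    unfolding P_def by (simp add: degree_prod_eq_sum_degree) (subst lead_coeff_prod, simp)
  have Q: "degree (Q k) = k" "lead_coeff (Q k) = 1" for k
    unfolding Q_def by (simp add: degree_prod_eq_sum_degree) (subst lead_coeff_prod, simp)
  \<comment> \<open>The factors of a moment that depend on \<open>i\<close> alone or on
    \<open>k\<close> alone; what is left depends on \<open>i + k\<close>.\<close>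
  define r s where "r i = (fact (a + i) / (fact (N - i) * fact (a + N)) :: real)"
    and "s k = ((- 1) ^ k * fact (a + N + 1 + \<beta> + k) * fact (\<beta> + k) :: real)" for i k
  have entry: "(\<Sum>s = a..<b. racah_weight a b c s * poly (Q i) (?v s) * poly (P k) (?v s)) =
      r i * s k * (fact (\<beta> + a + 1 + (a + N) + i + k) / fact (\<beta> + a + 1 + i + k))" if "i \<le> N" for i k
  proof -
    have "(\<Sum>s = a..<b. racah_weight a b c s * poly (Q i) (?v s) * poly (P k) (?v s)) =
        (\<Sum>s = a..<b. if a + i \<le> s then (- 1) ^ k * racah_weight (a + i) b (c + k) s else 0)"
    proof (rule sum.cong[OF refl])
      fix s assume "s \<in> {a..<b}"
      then show "racah_weight a b c s * poly (Q i) (?v s) * poly (P k) (?v s) =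
          (if a + i \<le> s then (- 1) ^ k * racah_weight (a + i) b (c + k) s else 0)"
        using racah_weight_shift[of a s b c i k]
        by (simp add: P_def Q_def poly_prod b_def c_def)
    qed
    also have "\<dots> = (\<Sum>s = a + i..<b. (- 1) ^ k * racah_weight (a + i) b (c + k) s)"
      by (rule sum.mono_neutral_cong_right) (auto split: if_splits)
    also have "\<dots> = (- 1) ^ k * (\<Sum>s = a + i..<b. racah_weight (a + i) b (c + k) s)"
      by (simp add: sum_distrib_left)
    also have "(\<Sum>s = a + i..<b. racah_weight (a + i) b (c + k) s) =
      fact (2 * (a + i) + (N - i) + 1 + (\<beta> + k)) * fact (a + i) * fact (a + i + (N - i) + 1 + (\<beta> + k)) * fact (\<beta> + k)
      / (fact (N - i) * fact (a + i + (N - i)) * fact (\<beta> + k + (a + i) + 1))"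
      using sum_racah_weight[of "a + i" "N - i" "\<beta> + k"] that by (simp add: b_def c_def add_ac)
    also have "2 * (a + i) + (N - i) + 1 + (\<beta> + k) = \<beta> + a + 1 + (a + N) + i + k" using that by simp
    also have "a + i + (N - i) + 1 + (\<beta> + k) = a + N + 1 + \<beta> + k" using that by simp
    also have "a + i + (N - i) = a + N" using that by simp
    also have "\<beta> + k + (a + i) + 1 = \<beta> + a + 1 + i + k" by simp
    finally show ?thesis by (simp add: r_def s_def)
  qed
  have "(\<Sum>S | S \<subseteq> {a..<b} \<and> card S = y. (vset ?v S)\<^sup>2 * (\<Prod>s\<in>S. racah_weight a b c s)) =
    det (mat y y (\<lambda>(i, k). \<Sum>s = a..<b. racah_weight a b c s * poly (Q i) (?v s) * poly (P k) (?v s)))"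
    by (rule sum_subsets_vset_squared) (use P Q in auto)
  also have "\<dots> = det (mat y y (\<lambda>(i, k). r i * s k *
      (fact (\<beta> + a + 1 + (a + N) + i + k) / fact (\<beta> + a + 1 + i + k))))"
    using assms(1) by (intro arg_cong[where f = det] eq_matI) (auto simp: entry simp del: fact_Suc)
  also have "\<dots> = (\<Prod>i<y. r i) * (\<Prod>k<y. s k) * (\<Prod>k<y. (- 1) ^ k * fact (a + N) *
      fact (\<beta> + a + 1 + (a + N) + k) * fact k / (fact (a + N - k) * fact (\<beta> + a + 1 + y - 1 + k)))"
    unfolding det_scale using assms(1) by (subst det_fact_quotients) auto
  also have "\<dots> = (\<Prod>i<y. fact (a + i) * fact (a + N + 1 + \<beta> + i) * fact (\<beta> + i) * fact (2 * a + N + 1 + \<beta> + i) * fact i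
       / (fact (N - i) * fact (a + N - i) * fact (\<beta> + a + y + i)))"
    unfolding prod.distrib[symmetric]
  proof (rule prod.cong[OF refl])
    fix i
    have e: "\<beta> + a + 1 + (a + N) + i = 2 * a + N + 1 + \<beta> + i" "\<beta> + a + 1 + y - 1 + i = \<beta> + a + y + i"
      by simp_all
    have one: "(- 1) ^ i * (- 1) ^ i = (1 :: real)" by (simp flip: power_mult_distrib)
    have aux: "(p / (q * m)) * (e * u * w) * (e * m * x * z / (h * g)) = (e * e) * (p * u * w * x * z / (q * h * g))"
      if "m \<noteq> 0" for p q m e u w x z h g :: real
      using that by (simp add: divide_simps)
    show "r i * s i * ((- 1) ^ i * fact (a + N) *
      fact (\<beta> + a + 1 + (a + N) + i) * fact i / (fact (a + N - i) * fact (\<beta> + a + 1 + y - 1 + i))) =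
      fact (a + i) * fact (a + N + 1 + \<beta> + i) * fact (\<beta> + i) * fact (2 * a + N + 1 + \<beta> + i) * fact i
       / (fact (N - i) * fact (a + N - i) * fact (\<beta> + a + y + i))"
      unfolding r_def s_def e by (simp only: aux[OF fact_nonzero] one mult_1)
  qed
  finally show ?thesis .
qed

section \<open>Central factorials and interlacing sequences\<close>

text \<open>Up to a factor \<open>t\<close> in the odd case, these are the central factorials
  \<open>t\<^bsup>[2k]\<^esup>\<close> and \<open>t\<^bsup>[2k+1]\<^esup>\<close>; central differences map each family to the other.\<close>

definition cf_even :: "nat \<Rightarrow> real \<Rightarrow> real" where
  "cf_even k t = (\<Prod>i<k. t\<^sup>2 - (real i)\<^sup>2)"

definition cf_odd :: "nat \<Rightarrow> real \<Rightarrow> real" where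
  "cf_odd k t = t * (\<Prod>i<k. t\<^sup>2 - (real i + 1/2)\<^sup>2)"

lemma cf_odd_minus: "cf_odd k (- t) = - cf_odd k t"
  by (simp add: cf_odd_def)

lemma cf_odd_0 [simp]: "cf_odd k 0 = 0"
  by (simp add: cf_odd_def)

text \<open>The values at \<open>t + 1/2\<close> and \<open>t - 1/2\<close> share all linear factors
  but the extreme ones, so their difference is the common product times a difference of two
  quadratics, which is linear in \<open>t\<close>.\<close>

lemma cf_even_difference:
  "cf_even (Suc k) (t + 1/2) - cf_even (Suc k) (t - 1/2) = 2 * real (Suc k) * cf_odd k t"
proof -
  have *: "cf_even (Suc k) (s + 1/2) = (s + 1/2) * (s + 1/2 + real k) * (\<Prod>i<k. s\<^sup>2 - (real i + 1/2)\<^sup>2)" for s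
  proof (induction k)
    case (Suc k)
    have "cf_even (Suc (Suc k)) (s + 1/2) = cf_even (Suc k) (s + 1/2) * ((s + 1/2)\<^sup>2 - (real (Suc k))\<^sup>2)"
      by (simp add: cf_even_def)
    also have "\<dots> = (s + 1/2) * (\<Prod>i<k. s\<^sup>2 - (real i + 1/2)\<^sup>2) * ((s + 1/2 + real k) * ((s + 1/2)\<^sup>2 - (real (Suc k))\<^sup>2))"
      unfolding Suc by (simp only: mult_ac)
    also have "(s + 1/2 + real k) * ((s + 1/2)\<^sup>2 - (real (Suc k))\<^sup>2) =
        (s + 1/2 + real (Suc k)) * (s\<^sup>2 - (real k + 1/2)\<^sup>2)"
      by (simp add: power2_eq_square field_simps)
    finally show ?case by (simp add: mult_ac)
  qed (simp add: cf_even_def power2_eq_square)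
  have "cf_even (Suc k) (t - 1/2) = cf_even (Suc k) (- t + 1/2)"
    by (simp add: cf_even_def power2_commute[of "1/2" t])
  also have "\<dots> = (- t + 1/2) * (- t + 1/2 + real k) * (\<Prod>i<k. t\<^sup>2 - (real i + 1/2)\<^sup>2)"
    using *[of "- t"] by simp
  finally have "cf_even (Suc k) (t + 1/2) - cf_even (Suc k) (t - 1/2) =
     ((t + 1/2) * (t + 1/2 + real k) - (- t + 1/2) * (- t + 1/2 + real k)) * (\<Prod>i<k. t\<^sup>2 - (real i + 1/2)\<^sup>2)"
    unfolding * by (simp only: left_diff_distrib)
  also have "(t + 1/2) * (t + 1/2 + real k) - (- t + 1/2) * (- t + 1/2 + real k) = 2 * real (Suc k) * t"
    by (simp add: algebra_simps)
  finally show ?thesis by (simp add: cf_odd_def)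
qed

text \<open>Here the common factor \<open>cf_even k t\<close> appears only after multiplication by
  \<open>t\<close>; hence the separate case \<open>t = 0\<close>.\<close>

lemma cf_odd_difference: "cf_odd k (t + 1/2) - cf_odd k (t - 1/2) = real (2 * k + 1) * cf_even k t"
proof (cases "t = 0")
  case True
  have "cf_odd k (1/2) - cf_odd k (- (1/2)) = 2 * cf_odd k (1/2)" by (simp only: cf_odd_minus)
  also have "\<dots> = real (2 * k + 1) * cf_even k 0"
    by (cases k) (simp_all add: cf_odd_def cf_even_def prod.lessThan_Suc_shift del: prod.lessThan_Suc)
  finally show ?thesis using True by simp
next
  case False
  let ?D = "\<lambda>s. \<Prod>i<k. s\<^sup>2 - (real i + 1/2)\<^sup>2"
  have *: "s * ?D (s + 1/2) = (s + real k) * cf_even k s" for s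
  proof (induction k)
    case (Suc k)
    have "s * (\<Prod>i<Suc k. (s + 1/2)\<^sup>2 - (real i + 1/2)\<^sup>2) =
      s * (\<Prod>i<k. (s + 1/2)\<^sup>2 - (real i + 1/2)\<^sup>2) * ((s + 1/2)\<^sup>2 - (real k + 1/2)\<^sup>2)"
      by simp
    also have "\<dots> = cf_even k s * ((s + real k) * ((s + 1/2)\<^sup>2 - (real k + 1/2)\<^sup>2))"
      unfolding Suc by (simp only: mult_ac)
    also have "(s + real k) * ((s + 1/2)\<^sup>2 - (real k + 1/2)\<^sup>2) = (s + real (Suc k)) * (s\<^sup>2 - (real k)\<^sup>2)"
      by (simp add: power2_eq_square algebra_simps)
    finally show ?case by (simp add: cf_even_def mult_ac)
  qed (simp add: cf_even_def)
  have "cf_even k (- t) = cf_even k t" by (simp add: cf_even_def)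
  then have "t * ?D (t - 1/2) = (t - real k) * cf_even k t"
    using *[of "- t"] by (simp add: power2_commute[of "1/2" t] algebra_simps)
  moreover have "t * (cf_odd k (t + 1/2) - cf_odd k (t - 1/2)) =
      (t + 1/2) * (t * ?D (t + 1/2)) - (t - 1/2) * (t * ?D (t - 1/2))"
    by (simp add: cf_odd_def algebra_simps)
  ultimately have "t * (cf_odd k (t + 1/2) - cf_odd k (t - 1/2)) =
      (t + 1/2) * ((t + real k) * cf_even k t) - (t - 1/2) * ((t - real k) * cf_even k t)"
    by (simp only: *)
  also have "\<dots> = t * (real (2 * k + 1) * cf_even k t)" by (simp add: algebra_simps)
  finally show ?thesis using False by simp
qed

lemma sum_int_telescope:
  fixes f :: "int \<Rightarrow> real"
  assumes "p \<le> q"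
  shows "(\<Sum>y\<in>{p..<q}. f (y + 1) - f y) = f q - f p"
  using assms
proof (induction q rule: int_ge_induct)
  case (step q)
  then have "{p..<q + 1} = insert q {p..<q}" by auto
  then show ?case using step by simp
qed simp

lemma sum_cf_odd:
  assumes "p \<le> q"
  shows "(\<Sum>y\<in>{p..<q}. cf_odd k (of_int y + s + 1/2)) =
    1 / (2 * real (Suc k)) * (cf_even (Suc k) (of_int q + s) - cf_even (Suc k) (of_int p + s))"
proof -
  have "cf_odd k (of_int y + s + 1/2) = 1 / (2 * real (Suc k)) *
      (cf_even (Suc k) (of_int (y + 1) + s) - cf_even (Suc k) (of_int y + s))" for y :: int
  proof -
    have "of_int y + s + 1/2 + 1/2 = of_int (y + 1) + s" "of_int y + s + 1/2 - 1/2 = of_int y + s" by simp_all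
    from cf_even_difference[of k "of_int y + s + 1/2", unfolded this] show ?thesis
      by (simp add: field_simps del: of_int_add)
  qed
  then show ?thesis
    by (simp only: sum_distrib_left[symmetric]
        sum_int_telescope[OF assms, of "\<lambda>y. cf_even (Suc k) (of_int y + s)"])
qed

lemma sum_cf_even:
  assumes "p \<le> q"
  shows "(\<Sum>y\<in>{p..<q}. cf_even k (of_int y + s + 1/2)) =
    1 / real (2 * k + 1) * (cf_odd k (of_int q + s) - cf_odd k (of_int p + s))"
proof -
  have "cf_even k (of_int y + s + 1/2) = 1 / real (2 * k + 1) *
      (cf_odd k (of_int (y + 1) + s) - cf_odd k (of_int y + s))" for y :: int
  proof -
    have "of_int y + s + 1/2 + 1/2 = of_int (y + 1) + s" "of_int y + s + 1/2 - 1/2 = of_int y + s" by simp_all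
    from cf_odd_difference[of k "of_int y + s + 1/2", unfolded this] show ?thesis
      by (simp add: field_simps del: of_int_add)
  qed
  then show ?thesis
    by (simp only: sum_distrib_left[symmetric]
        sum_int_telescope[OF assms, of "\<lambda>y. cf_odd k (of_int y + s)"])
qed

definition half_at_0 :: "real \<Rightarrow> real" where
  "half_at_0 t = (if t = 0 then 1/2 else 1)"

text \<open>Halving the term at \<open>0\<close> makes the sum half of a sum over a symmetric interval.\<close>

lemma sum_cf_even_from_0:
  assumes "p < q" "of_int p + s = 0 \<or> of_int p + s = - (1/2)"
  shows "(\<Sum>y\<in>{p..<q}. half_at_0 (of_int y + s + 1/2) * cf_even k (of_int y + s + 1/2)) =
    1 / real (2 * k + 1) * cf_odd k (of_int q + s)"
  using assms(2)
proof
  \<comment> \<open>The arguments are 1/2, 3/2, ...: no term is halved, and the lower end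
    contributes \<open>cf_odd k 0 = 0\<close>.\<close>
  assume *: "of_int p + s = 0"
  have "of_int y + s + 1/2 \<noteq> 0" if "y \<in> {p..<q}" for y
  proof -
    have "real_of_int p \<le> real_of_int y" using that by simp
    then show ?thesis using * by linarith
  qed
  then have "(\<Sum>y\<in>{p..<q}. half_at_0 (of_int y + s + 1/2) * cf_even k (of_int y + s + 1/2)) =
      (\<Sum>y\<in>{p..<q}. cf_even k (of_int y + s + 1/2))"
    by (intro sum.cong refl) (simp add: half_at_0_def)
  then show ?thesis using sum_cf_even[of p q k s] assms(1) * by simp
next
  \<comment> \<open>The arguments are 0, 1, 2, ...: the halved term at 0 is
    \<open>cf_odd k (1/2)\<close> up to the common factor and cancels the lower end of the remaining
    sum.\<close>
  assume *: "of_int p + s = - (1/2)"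
  have "of_int y + s + 1/2 \<noteq> 0" if "y \<in> {p + 1..<q}" for y
  proof -
    have "p + 1 \<le> y" using that by simp
    then have "real_of_int p + 1 \<le> real_of_int y" by linarith
    then show ?thesis using * by linarith
  qed
  then have "(\<Sum>y\<in>{p + 1..<q}. half_at_0 (of_int y + s + 1/2) * cf_even k (of_int y + s + 1/2)) =
      (\<Sum>y\<in>{p + 1..<q}. cf_even k (of_int y + s + 1/2))"
    by (intro sum.cong refl) (simp add: half_at_0_def)
  also have "\<dots> = 1 / real (2 * k + 1) * (cf_odd k (of_int q + s) - cf_odd k (1/2))"
  proof -
    have e: "of_int (p + 1) + s = 1/2" using * by simp
    show ?thesis using sum_cf_even[of "p + 1" q k s, unfolded e] assms(1) by simp
  qed
  moreover have "half_at_0 (of_int p + s + 1/2) * cf_even k (of_int p + s + 1/2) =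
      1 / real (2 * k + 1) * cf_odd k (1/2)"
  proof -
    have e0: "of_int p + s + 1/2 = 0" using * by simp
    have "2 * cf_odd k (1/2) = real (2 * k + 1) * cf_even k 0"
      using cf_odd_difference[of k 0] cf_odd_minus[of k "1/2"] by simp
    then show ?thesis unfolding e0 by (simp add: half_at_0_def field_simps)
  qed
  moreover have "(\<Sum>y\<in>{p..<q}. f y) = f p + (\<Sum>y\<in>{p + 1..<q}. f y)" for f :: "int \<Rightarrow> real"
  proof -
    have e: "{p..<q} = insert p {p + 1..<q}" using assms(1) by auto
    show ?thesis unfolding e by (subst sum.insert) auto
  qed
  ultimately show ?thesis by (simp only: distrib_left[symmetric]) simp
qed

text \<open>As a function of \<open>t^2\<close>, \<open>cf_even k t\<close> is a monic polynomial of
  degree \<open>k\<close>.\<close>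

lemma det_cf_even: "det (mat n n (\<lambda>(i, k). cf_even k (t i))) = vdm (\<lambda>i. (t i)\<^sup>2) n"
proof -
  define P :: "nat \<Rightarrow> real poly" where "P k = (\<Prod>i<k. [:- ((real i)\<^sup>2), 1:])" for k
  have "degree (P k) = k" "lead_coeff (P k) = 1" for k
    unfolding P_def by (simp add: degree_prod_eq_sum_degree) (subst lead_coeff_prod, simp)
  then show ?thesis
    using det_monic[of n P "\<lambda>i. (t i)\<^sup>2"] by (simp add: P_def poly_prod cf_even_def)
qed

lemma det_cf_odd: "det (mat n n (\<lambda>(i, k). cf_odd k (t i))) = (\<Prod>i<n. t i) * vdm (\<lambda>i. (t i)\<^sup>2) n"
proof -
  define P :: "nat \<Rightarrow> real poly" where "P k = (\<Prod>i<k. [:- ((real i + 1/2)\<^sup>2), 1:])" for k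
  have "degree (P k) = k" "lead_coeff (P k) = 1" for k
    unfolding P_def by (simp add: degree_prod_eq_sum_degree) (subst lead_coeff_prod, simp)
  then show ?thesis
    using det_monic[of n P "\<lambda>i. (t i)\<^sup>2"] det_scale[of n t "\<lambda>_. 1" "\<lambda>i k. poly (P k) ((t i)\<^sup>2)"]
    by (simp add: P_def poly_prod cf_odd_def)
qed

text \<open>One lattice row: the new dents \<open>y\<close> interlace with the old dents \<open>x\<close>.\<close>

lemma sum_interlacing_odd:
  fixes x :: "nat \<Rightarrow> int"
  assumes "\<And>i. i < n \<Longrightarrow> x i < x (Suc i)" and pos: "0 \<le> of_int (x 0) + s"
  shows "(\<Sum>y\<in>PiE {..<n} (\<lambda>i. {x i..<x (Suc i)}). (\<Prod>i<n. half_at_0 (of_int (y i) + s + 1/2)) *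
      ((\<Prod>i<n. of_int (y i) + s + 1/2) * vdm (\<lambda>i. (of_int (y i) + s + 1/2)\<^sup>2) n)) =
    vdm (\<lambda>i. (of_int (x i) + s)\<^sup>2) (Suc n) / (\<Prod>k<n. 2 * real (Suc k))"
proof -
  have x0: "x 0 \<le> x i" if "i \<le> n" for i
    using that
  proof (induction i)
    case (Suc i)
    then show ?case using assms(1)[of i] by simp
  qed simp
  have w: "half_at_0 (of_int u + s + 1/2) = 1" if "i < n" "u \<in> {x i..<x (Suc i)}" for i u
  proof -
    have "real_of_int (x 0) \<le> of_int u" using that x0[of i] by simp
    then show ?thesis using pos by (simp add: half_at_0_def)
  qed
  have "(\<Sum>y\<in>PiE {..<n} (\<lambda>i. {x i..<x (Suc i)}). (\<Prod>i<n. half_at_0 (of_int (y i) + s + 1/2)) *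
      ((\<Prod>i<n. of_int (y i) + s + 1/2) * vdm (\<lambda>i. (of_int (y i) + s + 1/2)\<^sup>2) n)) =
    det (mat n n (\<lambda>(i, k). \<Sum>u\<in>{x i..<x (Suc i)}. half_at_0 (of_int u + s + 1/2) * cf_odd k (of_int u + s + 1/2)))"
    unfolding det_cf_odd[symmetric]
    by (rule sum_PiE_det[of n "\<lambda>i. {x i..<x (Suc i)}" "\<lambda>i u. half_at_0 (of_int u + s + 1/2)"
          "\<lambda>k u. cf_odd k (of_int u + s + 1/2)"]) simp
  also have "\<dots> = det (mat n n (\<lambda>(i, k). 1 * (1 / (2 * real (Suc k))) *
      (cf_even (Suc k) (of_int (x (Suc i)) + s) - cf_even (Suc k) (of_int (x i) + s))))"
  proof (rule arg_cong[where f = det], rule eq_matI, goal_cases)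
    case (1 i k)
    then have ik: "i < n" "k < n" by auto
    have "(\<Sum>u\<in>{x i..<x (Suc i)}. half_at_0 (of_int u + s + 1/2) * cf_odd k (of_int u + s + 1/2)) =
        (\<Sum>u\<in>{x i..<x (Suc i)}. cf_odd k (of_int u + s + 1/2))"
      by (rule sum.cong[OF refl], subst w[OF ik(1)]) simp_all
    then show ?case
      using sum_cf_odd[of "x i" "x (Suc i)" k s] assms(1)[OF ik(1)] ik by simp
  qed auto
  also have "\<dots> = (\<Prod>k<n. 1 / (2 * real (Suc k))) * det (mat n n (\<lambda>(i, k).
      cf_even (Suc k) (of_int (x (Suc i)) + s) - cf_even (Suc k) (of_int (x i) + s)))"
    by (subst det_scale) simp
  \<comment> \<open>The constant \<open>cf_even 0\<close> is the missing column of ones, so the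
    differences come from a Vandermonde determinant in all \<open>n + 1\<close> old dents.\<close>
  also have "det (mat n n (\<lambda>(i, k). cf_even (Suc k) (of_int (x (Suc i)) + s) - cf_even (Suc k) (of_int (x i) + s))) =
      det (mat (Suc n) (Suc n) (\<lambda>(i, k). if k = 0 then 1 else cf_even (Suc (k - 1)) (of_int (x i) + s)))"
    by (rule det_column_of_ones[symmetric])
  also have "mat (Suc n) (Suc n) (\<lambda>(i, k). if k = 0 then 1 else cf_even (Suc (k - 1)) (of_int (x i) + s)) =
      mat (Suc n) (Suc n) (\<lambda>(i, k). cf_even k (of_int (x i) + s))"
    by (rule eq_matI) (auto simp: cf_even_def)
  also have "det \<dots> = vdm (\<lambda>i. (of_int (x i) + s)\<^sup>2) (Suc n)" by (rule det_cf_even)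
  finally show ?thesis by (simp add: prod_dividef)
qed

text \<open>\<open>x 0\<close> is a ghost dent at the axis. The sum over the first interval has no
  lower end, so the rows are successive differences with nothing before the first, and only the
  \<open>n\<close> genuine dents \<open>x 1, ..., x n\<close> survive.\<close>

lemma sum_interlacing_even:
  fixes x :: "nat \<Rightarrow> int"
  assumes "\<And>i. i < n \<Longrightarrow> x i < x (Suc i)" and x0: "of_int (x 0) + s = 0 \<or> of_int (x 0) + s = - (1/2)"
  shows "(\<Sum>y\<in>PiE {..<n} (\<lambda>i. {x i..<x (Suc i)}). (\<Prod>i<n. half_at_0 (of_int (y i) + s + 1/2)) *
      vdm (\<lambda>i. (of_int (y i) + s + 1/2)\<^sup>2) n) =
    (\<Prod>i<n. of_int (x (Suc i)) + s) * vdm (\<lambda>i. (of_int (x (Suc i)) + s)\<^sup>2) n / (\<Prod>k<n. real (2 * k + 1))"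
proof -
  have x_less: "x 0 < x i" if "0 < i" "i \<le> n" for i
    using that
  proof (induction i)
    case (Suc i)
    then show ?case using assms(1)[of i] by (cases "i = 0") auto
  qed simp
  let ?g = "\<lambda>k i. 1 / real (2 * k + 1) * cf_odd k (of_int (x (Suc i)) + s)"
  have "(\<Sum>y\<in>PiE {..<n} (\<lambda>i. {x i..<x (Suc i)}). (\<Prod>i<n. half_at_0 (of_int (y i) + s + 1/2)) *
      vdm (\<lambda>i. (of_int (y i) + s + 1/2)\<^sup>2) n) =
    det (mat n n (\<lambda>(i, k). \<Sum>u\<in>{x i..<x (Suc i)}. half_at_0 (of_int u + s + 1/2) * cf_even k (of_int u + s + 1/2)))"
    unfolding det_cf_even[symmetric]
    by (rule sum_PiE_det[of n "\<lambda>i. {x i..<x (Suc i)}" "\<lambda>i u. half_at_0 (of_int u + s + 1/2)"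
          "\<lambda>k u. cf_even k (of_int u + s + 1/2)"]) simp
  also have "\<dots> = det (mat n n (\<lambda>(i, k). ?g k i - (if i = 0 then 0 else ?g k (i - 1))))"
  proof (rule arg_cong[where f = det], rule eq_matI, goal_cases)
    case (1 i k)
    then have ik: "i < n" "k < n" by auto
    show ?case
    proof (cases "i = 0")
      case True
      then show ?thesis using sum_cf_even_from_0[of "x 0" "x (Suc 0)" s k] assms(1)[OF ik(1)] x0 ik by simp
    next
      case False
      have w: "half_at_0 (of_int u + s + 1/2) = 1" if "u \<in> {x i..<x (Suc i)}" for u
      proof -
        have "x 0 + 1 \<le> u" using that x_less[of i] ik False by simp
        then have "real_of_int (x 0) + 1 \<le> of_int u" by linarith
        then show ?thesis using x0 by (auto simp: half_at_0_def)
      qed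
      have "(\<Sum>u\<in>{x i..<x (Suc i)}. half_at_0 (of_int u + s + 1/2) * cf_even k (of_int u + s + 1/2)) =
          (\<Sum>u\<in>{x i..<x (Suc i)}. cf_even k (of_int u + s + 1/2))"
        by (rule sum.cong[OF refl], subst w) simp_all
      then show ?thesis
        using sum_cf_even[of "x i" "x (Suc i)" k s] assms(1)[OF ik(1)] ik False
        by (simp add: right_diff_distrib)
    qed
  qed auto
  also have "\<dots> = det (mat n n (\<lambda>(i, k). ?g k i))" by (rule det_row_differences)
  also have "\<dots> = det (mat n n (\<lambda>(i, k). 1 * (1 / real (2 * k + 1)) * cf_odd k (of_int (x (Suc i)) + s)))"
    by simp
  also have "\<dots> = (\<Prod>k<n. 1 / real (2 * k + 1)) *
      ((\<Prod>i<n. of_int (x (Suc i)) + s) * vdm (\<lambda>i. (of_int (x (Suc i)) + s)\<^sup>2) n)"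
    by (subst det_scale, subst det_cf_odd) simp
  finally show ?thesis by (simp add: prod_dividef)
qed

section \<open>Tilings of a lattice row\<close>

text \<open>\<open>Up j k\<close> meets \<open>Down j k\<close> along its eastern side,
  \<open>Down (j - 1) k\<close> along its western side and \<open>Down j (k - 1)\<close> along its
  base.\<close>

lemma lozenge_iff:
  "lozenge {Up j k, Down i h} \<longleftrightarrow> i = j \<and> h = k \<or> i = j - 1 \<and> h = k \<or> i = j \<and> h = k - 1"
  "\<not> lozenge {Up j k, Up i h}" "\<not> lozenge {Down j k, Down i h}"
proof -
  have *: "lozenge {s, t} \<longleftrightarrow> s \<noteq> t \<and> card (vertices s \<inter> vertices t) = 2" for s t
    unfolding lozenge_def doubleton_eq_iff by (auto simp: Int_commute)
  show "lozenge {Up j k, Down i h} \<longleftrightarrow> i = j \<and> h = k \<or> i = j - 1 \<and> h = k \<or> i = j \<and> h = k - 1"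
    unfolding * by (auto simp: Int_insert_left card_insert_if split: if_splits)
  show "\<not> lozenge {Up j k, Up i h}"
    unfolding * by (auto simp: Int_insert_left card_insert_if split: if_splits)
  show "\<not> lozenge {Down j k, Down i h}"
    unfolding * by (auto simp: Int_insert_left card_insert_if split: if_splits)
qed

lemma lozenge_iff':
  "lozenge {Down i h, Up j k} \<longleftrightarrow> i = j \<and> h = k \<or> i = j - 1 \<and> h = k \<or> i = j \<and> h = k - 1"
  by (subst insert_commute) (rule lozenge_iff)

lemma lozenge_cases:
  assumes "lozenge l"
  obtains j k i h where "l = {Up j k, Down i h}"
proof -
  obtain s t where st: "l = {s, t}" using lozenge_pair[OF assms] by blast
  show thesis
  proof (cases s; cases t)
    fix j k i h assume "s = Down i h" "t = Up j k"
    then show thesis using st that by (simp add: insert_commute)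
  qed (use st assms that lozenge_iff in auto)
qed

definition ups :: "region \<Rightarrow> region" where "ups R = {t \<in> R. \<exists>j k. t = Up j k}"
definition downs :: "region \<Rightarrow> region" where "downs R = {t \<in> R. \<exists>j k. t = Down j k}"

text \<open>Every lozenge contains one triangle of each orientation. This rules out all wrong dent
  sets later on.\<close>

lemma M_balanced:
  assumes "finite R" "M w R \<noteq> 0"
  shows "card (ups R) = card (downs R)"
proof -
  obtain T where T: "tiling R T" using assms unfolding M_def by (metis (mono_tags, lifting) mem_Collect_eq sum.neutral)
  note d = tilingD[OF T]
  have fT: "finite T" using finite_tiling[OF assms(1) T] .
  have one: "card (ups l) = 1" "card (downs l) = 1" "finite l" if lT: "l \<in> T" for l
  proof -
    obtain j k i h where l: "l = {Up j k, Down i h}" using lozenge_cases[OF d(3)[OF lT]] .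
    have "ups l = {Up j k}" "downs l = {Down i h}" unfolding ups_def downs_def l by auto
    then show "card (ups l) = 1" "card (downs l) = 1" "finite l" using l by auto
  qed
  have disj: "l \<inter> m = {}" if "l \<in> T" "m \<in> T" "l \<noteq> m" for l m using d(2) that by metis
  have "ups R = (\<Union>l\<in>T. ups l)" "downs R = (\<Union>l\<in>T. downs l)"
    unfolding ups_def downs_def d(1)[symmetric] by auto
  moreover have "card (\<Union>l\<in>T. ups l) = (\<Sum>l\<in>T. card (ups l))"
    using fT one disj by (intro card_UN_disjoint) (fastforce simp: ups_def)+
  moreover have "card (\<Union>l\<in>T. downs l) = (\<Sum>l\<in>T. card (downs l))"
    using fT one disj by (intro card_UN_disjoint) (fastforce simp: downs_def)+
  ultimately show ?thesis using one by simp
qed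

text \<open>The triangles of the row above the line of height \<open>h\<close>, numbered from west to east.\<close>

definition tri :: "int \<Rightarrow> int \<Rightarrow> triangle" where
  "tri h p = (if even p then Up (p div 2) h else Down (p div 2) h)"

lemma tri_even [simp]: "tri h (2 * j) = Up j h" by (simp add: tri_def)
lemma tri_odd [simp]: "tri h (2 * j + 1) = Down j h" by (simp add: tri_def)

lemma inj_tri: "inj (tri h)"
proof (rule injI)
  fix p q assume "tri h p = tri h q"
  then have "even p = even q" "p div 2 = q div 2" by (auto simp: tri_def split: if_splits)
  then show "p = q" by presburger
qed

lemma tri_eq_iff [simp]: "tri h p = tri h q \<longleftrightarrow> p = q"
  using inj_tri by (auto dest: injD)

lemma lozenge_tri: "lozenge {tri h p, tri h q} \<longleftrightarrow> q = p + 1 \<or> p = q + 1"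
proof (cases "even p"; cases "even q")
  assume "even p" "odd q"
  then obtain i j where "p = 2 * i" "q = 2 * j + 1" by (auto elim!: evenE oddE)
  then show ?thesis by (simp add: lozenge_iff) presburger
next
  assume "odd p" "even q"
  then obtain i j where "p = 2 * i + 1" "q = 2 * j" by (auto elim!: evenE oddE)
  then show ?thesis by (simp add: lozenge_iff') presburger
next
  assume "even p" "even q"
  then obtain i j where "p = 2 * i" "q = 2 * j" by (auto elim!: evenE)
  then show ?thesis by (simp add: lozenge_iff) presburger
next
  assume "odd p" "odd q"
  then obtain i j where "p = 2 * i + 1" "q = 2 * j + 1" by (auto elim!: oddE)
  then show ?thesis by (simp add: lozenge_iff) presburger
qed

text \<open>In the numbering by \<open>tri\<close>, the numbers in \<open>dbl X\<close> belong to
  up-pointing triangles and those in \<open>dbl1 Y\<close> to down-pointing ones. Below,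
  \<open>X\<close> marks the dents of a row and \<open>Y\<close> the triangles that are matched
  upwards.\<close>

abbreviation dbl :: "int set \<Rightarrow> int set" where "dbl X \<equiv> (\<lambda>j. 2 * j) ` X"
abbreviation dbl1 :: "int set \<Rightarrow> int set" where "dbl1 Y \<equiv> (\<lambda>j. 2 * j + 1) ` Y"

lemma mem_dbl: "2 * j \<in> dbl X \<longleftrightarrow> j \<in> X" "2 * j + 1 \<notin> dbl X" "2 * j \<notin> dbl1 X" "2 * j + 1 \<in> dbl1 X \<longleftrightarrow> j \<in> X"
  by (auto simp: image_iff) presburger+

text \<open>Within one row only neighbours in the numbering form lozenges, so the row is a path, and
  with weight 1 on its edges \<open>Mr V\<close> is the number of perfect matchings of the vertices
  in \<open>V\<close>.\<close>

locale row_weight =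
  fixes w :: "triangle set \<Rightarrow> real" and h :: int
  assumes w_row: "\<And>p. w {tri h p, tri h (p + 1)} = 1"
begin

definition Mr :: "int set \<Rightarrow> real" where
  "Mr V = M w (tri h ` V)"

lemma Mr_split:
  assumes "finite V" "q \<notin> V"
  shows "Mr V = Mr (V \<inter> {..<q}) * Mr (V \<inter> {q<..})"
proof -
  have "V = V \<inter> {..<q} \<union> V \<inter> {q<..}" using assms(2) by (auto simp: not_less order_less_le)
  then have "tri h ` V = tri h ` (V \<inter> {..<q}) \<union> tri h ` (V \<inter> {q<..})" by (metis image_Un)
  then show ?thesis
    unfolding Mr_def using assms(1)
    by (subst M_union[symmetric]) (auto simp: lozenge_tri)
qed

lemma Mr_empty [simp]: "Mr {} = 1" by (simp add: Mr_def)

lemma Mr_even_run: "Mr {p..<p + 2 * int m} = 1"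
proof (induction m arbitrary: p)
  case (Suc m)
  let ?l = "{tri h p, tri h (p + 1)}" and ?V = "{p..<p + 2 * int (Suc m)}"
  have forced: "{?l} \<subseteq> T" if T: "tiling (tri h ` ?V) T" for T
  proof -
    note d = tilingD[OF T]
    have "tri h p \<in> \<Union>T" unfolding d(1) by simp
    then obtain l where l: "l \<in> T" "tri h p \<in> l" by blast
    obtain s t where st: "l = {s, t}" "s \<noteq> t" using lozenge_pair[OF d(3)[OF l(1)]] by blast
    then obtain t' where t': "l = {tri h p, t'}" "t' \<noteq> tri h p" using l(2) by (auto simp: insert_commute)
    then obtain q where q: "q \<in> ?V" "t' = tri h q" using d(4)[OF l(1)] by blast
    then have "q = p + 1" using d(3)[OF l(1)] unfolding t'(1) q(2) lozenge_tri by auto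
    then show ?thesis using l t' q by simp
  qed
  have "Mr ?V = M w (tri h ` ?V - \<Union>{?l})"
    unfolding Mr_def by (rule M_forced) (use forced w_row in \<open>auto simp: lozenge_tri\<close>)
  also have "tri h ` ?V - \<Union>{?l} = tri h ` {p + 2..<p + 2 + 2 * int m}" by auto
  finally show ?case using Suc[of "p + 2"] by (simp add: Mr_def)
qed simp

lemma Mr_balanced:
  assumes "finite V" "Mr V \<noteq> 0"
  shows "card {j. 2 * j \<in> V} = card {j. 2 * j + 1 \<in> V}"
proof -
  have "ups (tri h ` V) = (\<lambda>j. Up j h) ` {j. 2 * j \<in> V}"
    by (auto simp: ups_def tri_def image_iff split: if_splits elim!: evenE intro!: bexI[of _ "2 * _"])
  moreover have "downs (tri h ` V) = (\<lambda>j. Down j h) ` {j. 2 * j + 1 \<in> V}"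
    by (auto simp: downs_def tri_def image_iff split: if_splits elim!: oddE intro!: bexI[of _ "2 * _ + 1"])
  ultimately show ?thesis
    using M_balanced[of "tri h ` V" w] assms by (simp add: Mr_def card_image inj_on_def)
qed

text \<open>Between two missing up-pointing triangles there is one down-pointing triangle too many.
  Exactly one has to be matched upwards, and any choice leaves two runs of even length, each with a
  unique matching.\<close>

lemma Mr_between:
  assumes "p < q" "Y \<subseteq> {p..<q}"
  shows "Mr ({2 * p + 1..2 * q - 1} - dbl1 Y) = (if card Y = 1 then 1 else 0)"
proof (cases "card Y = 1")
  case False
  have "{j. 2 * j \<in> {2 * p + 1..2 * q - 1} - dbl1 Y} = {p<..<q}" by (auto simp: mem_dbl)
  moreover have "{j. 2 * j + 1 \<in> {2 * p + 1..2 * q - 1} - dbl1 Y} = {p..<q} - Y" by (auto simp: mem_dbl)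
  moreover have "card ({p..<q} - Y) + card Y = nat (q - p)"
    using assms card_mono[of "{p..<q}" Y] finite_subset[of Y "{p..<q}"] by (simp add: card_Diff_subset)
  moreover have "card {p<..<q} + 1 = nat (q - p)" using assms by simp
  ultimately show ?thesis
    using Mr_balanced[of "{2 * p + 1..2 * q - 1} - dbl1 Y"] False by (intro if_not_P[THEN trans, symmetric]) auto
next
  case True
  then obtain y where y: "Y = {y}" by (auto simp: card_1_singleton_iff)
  then have py: "p \<le> y" "y < q" using assms by auto
  let ?V = "{2 * p + 1..2 * q - 1} - dbl1 Y"
  have "Mr ?V = Mr (?V \<inter> {..<2 * y + 1}) * Mr (?V \<inter> {2 * y + 1<..})"
    by (rule Mr_split) (auto simp: y)
  also have "?V \<inter> {..<2 * y + 1} = {2 * p + 1..<2 * p + 1 + 2 * int (nat (y - p))}" using y py by auto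
  also have "?V \<inter> {2 * y + 1<..} = {2 * y + 2..<2 * y + 2 + 2 * int (nat (q - 1 - y))}" using y py by auto
  finally show ?thesis using True by (simp only: Mr_even_run) simp
qed

text \<open>Beyond the outermost dents both orientations are equally numerous, so no down-pointing
  triangle can be matched upwards.\<close>

lemma Mr_end:
  assumes "p \<le> q" "Y \<subseteq> {p..<q}"
  shows "Mr ({2 * p..2 * q - 1} - dbl1 Y) = (if Y = {} then 1 else 0)"
    and "Mr ({2 * p + 1..2 * q} - dbl1 Y) = (if Y = {} then 1 else 0)"
proof -
  have fY: "finite Y" using assms finite_subset by blast
  have c: "card ({p..<q} - Y) + card Y = nat (q - p)"
    using assms card_mono[of "{p..<q}" Y] fY by (simp add: card_Diff_subset)
  have e1: "{2 * p..2 * q - 1} = {2 * p..<2 * p + 2 * int (nat (q - p))}"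
    and e2: "{2 * p + 1..2 * q} = {2 * p + 1..<2 * p + 1 + 2 * int (nat (q - p))}" using assms by auto
  have "Mr ({2 * p..2 * q - 1} - dbl1 Y) = 0" if "Y \<noteq> {}"
  proof (rule ccontr)
    assume "Mr ({2 * p..2 * q - 1} - dbl1 Y) \<noteq> 0"
    then have "card {j. 2 * j \<in> {2 * p..2 * q - 1} - dbl1 Y} = card {j. 2 * j + 1 \<in> {2 * p..2 * q - 1} - dbl1 Y}"
      by (intro Mr_balanced) auto
    moreover have "{j. 2 * j \<in> {2 * p..2 * q - 1} - dbl1 Y} = {p..<q}" by (auto simp: mem_dbl)
    moreover have "{j. 2 * j + 1 \<in> {2 * p..2 * q - 1} - dbl1 Y} = {p..<q} - Y" by (auto simp: mem_dbl)
    ultimately show False using c that fY by simp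
  qed
  then show "Mr ({2 * p..2 * q - 1} - dbl1 Y) = (if Y = {} then 1 else 0)"
    using Mr_even_run[of "2 * p" "nat (q - p)"] unfolding e1 by auto
  have "Mr ({2 * p + 1..2 * q} - dbl1 Y) = 0" if "Y \<noteq> {}"
  proof (rule ccontr)
    assume "Mr ({2 * p + 1..2 * q} - dbl1 Y) \<noteq> 0"
    then have "card {j. 2 * j \<in> {2 * p + 1..2 * q} - dbl1 Y} = card {j. 2 * j + 1 \<in> {2 * p + 1..2 * q} - dbl1 Y}"
      by (intro Mr_balanced) auto
    moreover have "{j. 2 * j \<in> {2 * p + 1..2 * q} - dbl1 Y} = {p<..q}" by (auto simp: mem_dbl)
    moreover have "{j. 2 * j + 1 \<in> {2 * p + 1..2 * q} - dbl1 Y} = {p..<q} - Y" by (auto simp: mem_dbl)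
    ultimately show False using c that fY by simp
  qed
  then show "Mr ({2 * p + 1..2 * q} - dbl1 Y) = (if Y = {} then 1 else 0)"
    using Mr_even_run[of "2 * p + 1" "nat (q - p)"] unfolding e2 by auto
qed

text \<open>The dents cut the path into independent runs. By the two preceding lemmas a row can be
  completed, and then in one way, if and only if \<open>Y\<close> interlaces with the dents.\<close>

lemma Mr_row:
  fixes x :: "nat \<Rightarrow> int"
  assumes x: "\<And>i. i < n \<Longrightarrow> x i < x (Suc i)" and l: "l \<le> x 0" and R: "x n < R"
    and Y: "Y \<subseteq> {l..<R - 1}"
  shows "Mr ({2 * l..2 * (R - 1)} - dbl (x ` {..n}) - dbl1 Y) =
    (if Y \<inter> {l..<x 0} = {} \<and> (\<forall>i<n. card (Y \<inter> {x i..<x (Suc i)}) = 1) \<and> Y \<inter> {x n..<R - 1} = {}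
     then 1 else 0)"
proof -
  let ?V = "{2 * l..2 * (R - 1)} - dbl (x ` {..n}) - dbl1 Y"
  have mono: "x i < x j" if "i < j" "j \<le> n" for i j
    using that
  proof (induction j)
    case (Suc j)
    then show ?case using x[of j] by (cases "i = j") auto
  qed simp
  have le0: "x 0 \<le> x i" and len: "x i \<le> x n" if "i \<le> n" for i
    using mono[of 0 i] mono[of i n] that by (cases "i = 0"; cases "i = n"; simp)+
  have fV: "finite ?V" by simp
  have nV: "2 * x i \<notin> ?V" if "i \<le> n" for i using that by auto
  have odd_in: "a \<in> dbl1 (Y \<inter> {p..<q}) \<longleftrightarrow> a \<in> dbl1 Y" if "2 * p \<le> a" "a < 2 * q" for a p q
    using that by (auto simp: image_iff)
  have left: "Mr (?V \<inter> {..<2 * x m}) =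
      (if Y \<inter> {l..<x 0} = {} \<and> (\<forall>i<m. card (Y \<inter> {x i..<x (Suc i)}) = 1) then 1 else 0)" if "m \<le> n" for m
    using that
  proof (induction m)
    case 0
    have "?V \<inter> {..<2 * x 0} = {2 * l..2 * x 0 - 1} - dbl1 (Y \<inter> {l..<x 0})"
      using le0 len R by (force simp: odd_in)
    then show ?case using Mr_end(1)[OF l, of "Y \<inter> {l..<x 0}"] by simp
  next
    case (Suc m)
    have "Mr (?V \<inter> {..<2 * x (Suc m)}) = Mr (?V \<inter> {..<2 * x (Suc m)} \<inter> {..<2 * x m}) *
        Mr (?V \<inter> {..<2 * x (Suc m)} \<inter> {2 * x m<..})"
      using nV[of m] Suc.prems by (intro Mr_split) auto
    also have "?V \<inter> {..<2 * x (Suc m)} \<inter> {..<2 * x m} = ?V \<inter> {..<2 * x m}"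
      using x[of m] Suc.prems by auto
    also have "?V \<inter> {..<2 * x (Suc m)} \<inter> {2 * x m<..} =
        {2 * x m + 1..2 * x (Suc m) - 1} - dbl1 (Y \<inter> {x m..<x (Suc m)})"
    proof (rule Set.set_eqI)
      fix a
      have "a \<notin> dbl (x ` {..n})" if "2 * x m < a" "a < 2 * x (Suc m)"
      proof
        assume "a \<in> dbl (x ` {..n})"
        then obtain i where i: "i \<le> n" "a = 2 * x i" by auto
        then have "x m < x i" "x i < x (Suc m)" using that by auto
        then have "\<not> i \<le> m" "\<not> Suc m \<le> i"
          using mono[of i m] mono[of "Suc m" i] i Suc.prems by (metis Suc_leD less_asym less_irrefl order_le_less)+
        then show False by simp
      qed
      moreover have "2 * l \<le> a" "a \<le> 2 * (R - 1)" if "2 * x m < a" "a < 2 * x (Suc m)"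
        using that le0[of m] len[of "Suc m"] Suc.prems l R by auto
      ultimately show "a \<in> ?V \<inter> {..<2 * x (Suc m)} \<inter> {2 * x m<..} \<longleftrightarrow>
          a \<in> {2 * x m + 1..2 * x (Suc m) - 1} - dbl1 (Y \<inter> {x m..<x (Suc m)})"
        using odd_in[of "x m" a "x (Suc m)"] by auto
    qed
    also have "Mr \<dots> = (if card (Y \<inter> {x m..<x (Suc m)}) = 1 then 1 else 0)"
      using x[of m] Suc.prems by (intro Mr_between) auto
    finally show ?case using Suc by (auto simp: less_Suc_eq)
  qed
  have "Mr ?V = Mr (?V \<inter> {..<2 * x n}) * Mr (?V \<inter> {2 * x n<..})"
    using nV[of n] by (intro Mr_split) auto
  also have "?V \<inter> {2 * x n<..} = {2 * x n + 1..2 * (R - 1)} - dbl1 (Y \<inter> {x n..<R - 1})"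
  proof (rule Set.set_eqI)
    fix a
    have "a \<notin> dbl (x ` {..n})" if "2 * x n < a" using that len by force
    moreover have "2 * l \<le> a" if "2 * x n < a" using that le0[of n] l by auto
    moreover have "a \<in> dbl1 (Y \<inter> {x n..<R - 1}) \<longleftrightarrow> a \<in> dbl1 Y" if "2 * x n < a" "a \<le> 2 * (R - 1)"
      using that by (auto simp: image_iff)
    ultimately show "a \<in> ?V \<inter> {2 * x n<..} \<longleftrightarrow> a \<in> {2 * x n + 1..2 * (R - 1)} - dbl1 (Y \<inter> {x n..<R - 1})"
      by auto
  qed
  also have "Mr \<dots> = (if Y \<inter> {x n..<R - 1} = {} then 1 else 0)"
    using R by (intro Mr_end(2)) auto
  finally show ?thesis using left[of n] by auto
qed

text \<open>An interlacing set is a choice of one element from each interval between consecutive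
  dents; this gives the product form that \<open>sum_PiE_det\<close> needs.\<close>

lemma sum_Mr_row:
  fixes x :: "nat \<Rightarrow> int" and F :: "int set \<Rightarrow> real"
  assumes x: "\<And>i. i < n \<Longrightarrow> x i < x (Suc i)" and l: "l \<le> x 0" and R: "x n < R"
  shows "(\<Sum>Y\<in>Pow {l..<R - 1}. Mr ({2 * l..2 * (R - 1)} - dbl (x ` {..n}) - dbl1 Y) * F Y) =
    (\<Sum>y\<in>PiE {..<n} (\<lambda>i. {x i..<x (Suc i)}). F (y ` {..<n}))"
proof -
  let ?B = "\<lambda>i. {x i..<x (Suc i)}"
  have mono: "x i \<le> x j" if "i \<le> j" "j \<le> n" for i j
    using that
  proof (induction j)
    case (Suc j)
    then show ?case using x[of j] by (cases "i = Suc j") auto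
  qed simp
  have B_disj: "?B i \<inter> ?B j = {}" if "i < n" "j < n" "i \<noteq> j" for i j
    using that mono[of "Suc i" j] mono[of "Suc j" i] by (cases "i < j") auto
  have cover: "\<exists>i<n. u \<in> ?B i" if "x 0 \<le> u" "u < x n" for u
  proof -
    have "\<exists>i<m. u \<in> ?B i" if "m \<le> n" "u < x m" for m
      using that
    proof (induction m)
      case 0 then show ?case using \<open>x 0 \<le> u\<close> by simp
    next
      case (Suc m) then show ?case by (cases "u < x m") (auto simp: less_Suc_eq)
    qed
    then show ?thesis using that by blast
  qed
  define \<Y> where "\<Y> = {Y \<in> Pow {l..<R - 1}. Y \<inter> {l..<x 0} = {} \<and> (\<forall>i<n. card (Y \<inter> ?B i) = 1) \<and> Y \<inter> {x n..<R - 1} = {}}"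
  have "(\<Sum>Y\<in>Pow {l..<R - 1}. Mr ({2 * l..2 * (R - 1)} - dbl (x ` {..n}) - dbl1 Y) * F Y) =
      (\<Sum>Y\<in>Pow {l..<R - 1}. if Y \<in> \<Y> then F Y else 0)"
    by (rule sum.cong[OF refl]) (subst Mr_row[OF x l R], auto simp: \<Y>_def)
  also have "\<dots> = (\<Sum>Y\<in>\<Y>. F Y)"
    by (subst sum.inter_restrict[symmetric]) (auto simp: \<Y>_def Int_def intro!: sum.cong)
  also have "\<dots> = (\<Sum>y\<in>PiE {..<n} ?B. F (y ` {..<n}))"
  proof (rule sum.reindex_bij_witness[where i = "\<lambda>y. y ` {..<n}" and j = "\<lambda>Y. restrict (\<lambda>i. the_elem (Y \<inter> ?B i)) {..<n}"])
    fix Y assume Y: "Y \<in> \<Y>"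
    define u where "u i = the_elem (Y \<inter> ?B i)" for i
    have the: "Y \<inter> ?B i = {u i}" if "i < n" for i
    proof -
      have "card (Y \<inter> ?B i) = 1" using Y that unfolding \<Y>_def by blast
      then obtain v where "Y \<inter> ?B i = {v}" by (rule card_1_singletonE)
      then show ?thesis by (simp only: u_def the_elem_eq)
    qed
    have uY: "u i \<in> Y" "u i \<in> ?B i" if "i < n" for i
    proof -
      have "u i \<in> Y \<inter> ?B i" unfolding the[OF that] by simp
      then show "u i \<in> Y" "u i \<in> ?B i" by (simp_all only: Int_iff)
    qed
    have "Y = u ` {..<n}"
    proof (intro subset_antisym subsetI)
      fix v assume v: "v \<in> Y"
      then have "l \<le> v" "v < R - 1" "v \<notin> {l..<x 0}" "v \<notin> {x n..<R - 1}" using Y unfolding \<Y>_def by auto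
      then have "x 0 \<le> v" "v < x n" by auto
      then obtain i where "i < n" "v \<in> ?B i" using cover by blast
      then have "v \<in> {u i}" unfolding the[OF \<open>i < n\<close>, symmetric] using v by simp
      then show "v \<in> u ` {..<n}" using \<open>i < n\<close> by simp
    next
      fix v assume "v \<in> u ` {..<n}"
      then show "v \<in> Y" using uY(1) by auto
    qed
    then have *: "restrict u {..<n} ` {..<n} = Y" by (simp only: image_restrict_eq)
    show "restrict (\<lambda>i. the_elem (Y \<inter> ?B i)) {..<n} ` {..<n} = Y"
      by (rule *[unfolded u_def])
    show "restrict (\<lambda>i. the_elem (Y \<inter> ?B i)) {..<n} \<in> PiE {..<n} ?B"
    proof (rule PiE_I)
      fix i assume "i \<in> {..<n}"
      then show "restrict (\<lambda>i. the_elem (Y \<inter> ?B i)) {..<n} i \<in> ?B i" using uY(2)[of i] by (simp add: u_def)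
    qed simp
    show "F (restrict (\<lambda>i. the_elem (Y \<inter> ?B i)) {..<n} ` {..<n}) = F Y"
      by (rule arg_cong[where f = F]) (rule *[unfolded u_def])
  next
    fix y assume y: "y \<in> PiE {..<n} ?B"
    have yB: "y i \<in> ?B i" if "i < n" for i
      by (rule PiE_mem[OF y]) (use that in simp)
    have inter: "y ` {..<n} \<inter> ?B i = {y i}" if "i < n" for i
    proof (intro subset_antisym subsetI)
      fix u assume "u \<in> y ` {..<n} \<inter> ?B i"
      then obtain j where j: "j < n" "u = y j" "u \<in> ?B i" by blast
      then have "i = j" using yB[of j] B_disj[of i j] that by blast
      then show "u \<in> {y i}" using j by simp
    qed (use yB that in auto)
    show "restrict (\<lambda>i. the_elem (y ` {..<n} \<inter> ?B i)) {..<n} = y"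
    proof
      fix i show "restrict (\<lambda>i. the_elem (y ` {..<n} \<inter> ?B i)) {..<n} i = y i"
        using inter[of i] PiE_arb[OF y, of i] by simp
    qed
    have range: "x 0 \<le> y i" "y i < x n" if "i < n" for i
      using yB[OF that] mono[of 0 i] mono[of "Suc i" n] that by auto
    have "y ` {..<n} \<subseteq> {l..<R - 1}" "y ` {..<n} \<inter> {l..<x 0} = {}" "y ` {..<n} \<inter> {x n..<R - 1} = {}"
      using range l R by force+
    then show "y ` {..<n} \<in> \<Y>"
      unfolding \<Y>_def using inter by simp
  qed
  finally show ?thesis .
qed

end

section \<open>Quartered hexagons with dents\<close>

text \<open>A quartered hexagon without holes, cut off below the line of height \<open>k\<close>; its west zigzag
  starts at height \<open>- \<delta>\<close>, and \<open>\<delta> = 0, 1\<close> are the cases of \<open>K\<close> and \<open>Q'\<close>.\<close>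

definition trap :: "int \<Rightarrow> int \<Rightarrow> int \<Rightarrow> int \<Rightarrow> region" where
  "trap \<delta> k hi W = {t. case t of
      Up j h \<Rightarrow> k \<le> h \<and> h < hi \<and> 0 \<le> j + (h + \<delta>) div 2 \<and> j + h < W
    | Down j h \<Rightarrow> k \<le> h \<and> h < hi \<and> 0 \<le> j + (h + 1 + \<delta>) div 2 \<and> j + h + 1 < W}"

lemma Up_in_trap [simp]:
  "Up j h \<in> trap \<delta> k hi W \<longleftrightarrow> k \<le> h \<and> h < hi \<and> 0 \<le> j + (h + \<delta>) div 2 \<and> j + h < W"
  by (simp add: trap_def)

lemma Down_in_trap [simp]:
  "Down j h \<in> trap \<delta> k hi W \<longleftrightarrow> k \<le> h \<and> h < hi \<and> 0 \<le> j + (h + 1 + \<delta>) div 2 \<and> j + h + 1 < W"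
  by (simp add: trap_def)

lemma finite_trap [simp]: "finite (trap \<delta> k hi W)"
proof -
  let ?S = "{- ((hi + 1 + \<delta>) div 2)..W - k} \<times> {k..hi}"
  have "trap \<delta> k hi W \<subseteq> (\<lambda>(j, h). Up j h) ` ?S \<union> (\<lambda>(j, h). Down j h) ` ?S"
  proof
    fix t assume t: "t \<in> trap \<delta> k hi W"
    show "t \<in> (\<lambda>(j, h). Up j h) ` ?S \<union> (\<lambda>(j, h). Down j h) ` ?S"
    proof (cases t)
      case (Up j h)
      have "(h + \<delta>) div 2 \<le> (hi + 1 + \<delta>) div 2" using t Up by (intro zdiv_mono1) auto
      then have "(j, h) \<in> ?S" using t Up by simp
      then show ?thesis unfolding Up by (intro UnI1 image_eqI[of _ _ "(j, h)"]) simp_all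
    next
      case (Down j h)
      have "(h + 1 + \<delta>) div 2 \<le> (hi + 1 + \<delta>) div 2" using t Down by (intro zdiv_mono1) auto
      then have "(j, h) \<in> ?S" using t Down by simp
      then show ?thesis unfolding Down by (intro UnI2 image_eqI[of _ _ "(j, h)"]) simp_all
    qed
  qed
  then show ?thesis by (rule finite_subset) simp
qed

text \<open>The abscissa of the centre of the base of \<open>Up j h\<close>.\<close>

definition xi :: "int \<Rightarrow> int \<Rightarrow> real" where
  "xi h j = of_int j + (of_int h + 1) / 2"

text \<open>One weight for both types: it asks only whether the common edge of a vertical lozenge is
  centred at abscissa 0. In a trapezoid with \<open>\<delta> = 0\<close> this never happens; with
  \<open>\<delta> = 1\<close> it singles out the lozenges with two sides on the zigzag.\<close>

definition axis_weight :: "triangle set \<Rightarrow> real" where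
  "axis_weight l = (if \<exists>j h. l = {Up j h, Down j (h - 1)} \<and> xi h j = 0 then 1/2 else 1)"

lemma axis_weight_row: "axis_weight {Up j k, Down i k} = 1"
  by (auto simp: axis_weight_def doubleton_eq_iff)

lemma axis_weight_vertical: "axis_weight {Up j h, Down j (h - 1)} = half_at_0 (xi h j)"
  by (auto simp: axis_weight_def half_at_0_def doubleton_eq_iff)

interpretation row: row_weight axis_weight k for k
proof
  fix p
  show "axis_weight {tri k p, tri k (p + 1)} = 1"
  proof (cases "even p")
    case True
    then obtain i where "p = 2 * i" by (auto elim: evenE)
    then show ?thesis by (simp add: axis_weight_row)
  next
    case False
    then obtain i where "p = 2 * i + 1" by (auto elim: oddE)
    moreover have "2 * i + 1 + 1 = 2 * (i + 1)" by simp
    ultimately show ?thesis by (metis axis_weight_row insert_commute tri_even tri_odd)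
  qed
qed

text \<open>A row that starts with a down-pointing triangle is a row that starts with an up-pointing
  triangle, with a ghost dent at its western end.\<close>

lemma trap_row:
  fixes \<delta> k hi W :: int
  assumes "k < hi"
  defines "l \<equiv> - ((k + 1 + \<delta>) div 2)"
  shows "trap \<delta> k hi W =
    tri k ` ({2 * l..2 * (W - k - 1)} - dbl (if even (k + \<delta>) then {} else {l})) \<union> trap \<delta> (k + 1) hi W"
proof (rule Set.set_eqI)
  fix t
  define G where "G = (if even (k + \<delta>) then {} else {l})"
  have G: "0 \<le> j + (k + \<delta>) div 2 \<longleftrightarrow> l \<le> j \<and> j \<notin> G" for j
  proof (cases "even (k + \<delta>)")
    case True
    then have "(k + \<delta>) div 2 = - l" unfolding l_def by presburger
    then show ?thesis using True by (simp only: G_def if_True) auto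
  next
    case False
    then have "(k + \<delta>) div 2 = - l - 1" unfolding l_def by presburger
    then show ?thesis using False by (simp only: G_def if_False) auto
  qed
  have l: "0 \<le> j + (k + 1 + \<delta>) div 2 \<longleftrightarrow> l \<le> j" for j unfolding l_def by linarith
  show "t \<in> trap \<delta> k hi W \<longleftrightarrow> t \<in> tri k ` ({2 * l..2 * (W - k - 1)} -
      dbl (if even (k + \<delta>) then {} else {l})) \<union> trap \<delta> (k + 1) hi W"
    unfolding G_def[symmetric]
  proof (cases t)
    case (Up j h)
    have up: "t \<in> tri k ` V \<longleftrightarrow> h = k \<and> 2 * j \<in> V" for V
      unfolding Up by (auto simp: tri_def image_iff split: if_splits elim!: evenE intro: bexI[of _ "2 * j"])
    show "t \<in> trap \<delta> k hi W \<longleftrightarrow> t \<in> tri k ` ({2 * l..2 * (W - k - 1)} - dbl G) \<union> trap \<delta> (k + 1) hi W"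
      unfolding Un_iff up
    proof (cases "h = k")
      case True
      show "t \<in> trap \<delta> k hi W \<longleftrightarrow> h = k \<and> 2 * j \<in> {2 * l..2 * (W - k - 1)} - dbl G \<or> t \<in> trap \<delta> (k + 1) hi W"
        unfolding Up True Up_in_trap Diff_iff mem_dbl G using assms(1) by auto
    qed (auto simp: Up)
  next
    case (Down j h)
    have down: "t \<in> tri k ` V \<longleftrightarrow> h = k \<and> 2 * j + 1 \<in> V" for V
      unfolding Down by (auto simp: tri_def image_iff split: if_splits elim!: oddE intro: bexI[of _ "2 * j + 1"])
    show "t \<in> trap \<delta> k hi W \<longleftrightarrow> t \<in> tri k ` ({2 * l..2 * (W - k - 1)} - dbl G) \<union> trap \<delta> (k + 1) hi W"
      unfolding Un_iff down
    proof (cases "h = k")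
      case True
      show "t \<in> trap \<delta> k hi W \<longleftrightarrow> h = k \<and> 2 * j + 1 \<in> {2 * l..2 * (W - k - 1)} - dbl G \<or> t \<in> trap \<delta> (k + 1) hi W"
        unfolding Down True Down_in_trap Diff_iff l using assms(1) mem_dbl(2)[of j G] by auto
    qed (auto simp: Down)
  qed
qed

text \<open>The product of the denominators that arise row by row: an even number \<open>r\<close>
  of rows above calls for \<open>sum_interlacing_odd\<close>, an odd one for
  \<open>sum_interlacing_even\<close>.\<close>

fun row_const :: "nat \<Rightarrow> real" where
  "row_const 0 = 1"
| "row_const (Suc r) = row_const r *
    (\<Prod>i<(r + 1) div 2. if even r then 2 * real (Suc i) else real (2 * i + 1))"

text \<open>Closed form for \<open>r\<close> rows above a base at height \<open>k\<close> with dents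
  \<open>X\<close>. The product of the distances belongs to the odd central factorials, hence to
  even \<open>r\<close>.\<close>

definition dent_count :: "nat \<Rightarrow> int \<Rightarrow> int set \<Rightarrow> real" where
  "dent_count r k X = (if even r then \<Prod>j\<in>X. xi k j else 1) * vset (\<lambda>j. (xi k j)\<^sup>2) X / row_const r"

text \<open>\<open>M_cut\<close> along the line of height \<open>k + 1\<close>: \<open>Y\<close>
  records the vertical lozenges across it, whose upper halves are the dents of the smaller
  trapezoid. \<open>J\<close> is empty when no row is left above.\<close>

lemma M_trap_split:
  fixes \<delta> k hi W :: int and X :: "int set"
  assumes k: "k < hi" and X: "X \<subseteq> {- ((k + \<delta>) div 2)..<W - k}"
  defines "l \<equiv> - ((k + 1 + \<delta>) div 2)"
  defines "X0 \<equiv> X \<union> (if even (k + \<delta>) then {} else {l})"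
    and "J \<equiv> (if k + 1 = hi then {} else {l..<W - k - 1})"
  shows "M axis_weight (trap \<delta> k hi W - (\<lambda>j. Up j k) ` X) =
    (\<Sum>Y\<in>Pow J. row.Mr k ({2 * l..2 * (W - k - 1)} - dbl X0 - dbl1 Y) *
      ((\<Prod>j\<in>Y. half_at_0 (xi (k + 1) j)) * M axis_weight (trap \<delta> (k + 1) hi W - (\<lambda>j. Up j (k + 1)) ` Y)))"
proof -
  let ?A = "tri k ` ({2 * l..2 * (W - k - 1)} - dbl X0)" and ?B = "trap \<delta> (k + 1) hi W"
  have ll: "l \<le> - ((k + \<delta>) div 2)" unfolding l_def by presburger
  have UpX: "(\<lambda>j. Up j k) ` X = tri k ` dbl X" by (simp only: image_image tri_even)
  have dis: "?B \<inter> (\<lambda>j. Up j k) ` X = {}" by auto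
  have X0U: "dbl X0 = dbl (if even (k + \<delta>) then {} else {l}) \<union> dbl X"
    unfolding X0_def by (simp only: image_Un Un_commute)
  have "trap \<delta> k hi W - (\<lambda>j. Up j k) ` X = ?A \<union> ?B"
  proof -
    let ?C = "{2 * l..2 * (W - k - 1)} - dbl (if even (k + \<delta>) then {} else {l})"
    have "trap \<delta> k hi W = tri k ` ?C \<union> ?B"
      using trap_row[OF k, where \<delta> = \<delta> and W = W] unfolding l_def .
    then have "trap \<delta> k hi W - (\<lambda>j. Up j k) ` X = (tri k ` ?C - (\<lambda>j. Up j k) ` X) \<union> ?B"
      using dis by auto
    also have "tri k ` ?C - (\<lambda>j. Up j k) ` X = tri k ` (?C - dbl X)"
      unfolding UpX by (rule image_set_diff[OF inj_tri, symmetric])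
    also have "?C - dbl X = {2 * l..2 * (W - k - 1)} - dbl X0"
      unfolding X0U by auto
    finally show ?thesis .
  qed
  then have "M axis_weight (trap \<delta> k hi W - (\<lambda>j. Up j k) ` X) = M axis_weight (?A \<union> ?B)" by (rule arg_cong)
  also have "\<dots> = (\<Sum>Y\<in>Pow J. (\<Prod>j\<in>Y. axis_weight {Down j k, Up j (k + 1)}) *
      M axis_weight (?A - (\<lambda>j. Down j k) ` Y) * M axis_weight (?B - (\<lambda>j. Up j (k + 1)) ` Y))"
  proof (rule M_cut)
    show "?A \<inter> ?B = {}" by (auto simp: tri_def split: if_splits)
    show "(\<lambda>j. Down j k) ` J \<subseteq> ?A"
    proof
      fix t assume "t \<in> (\<lambda>j. Down j k) ` J"
      then obtain j where t: "t = tri k (2 * j + 1)" and "j \<in> J" by auto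
      have "2 * j + 1 \<in> {2 * l..2 * (W - k - 1)} - dbl X0"
        using \<open>j \<in> J\<close> by (auto simp: J_def mem_dbl split: if_splits)
      then show "t \<in> ?A" unfolding t by (rule imageI)
    qed
    show "(\<lambda>j. Up j (k + 1)) ` J \<subseteq> ?B"
      using k by (auto simp: J_def l_def split: if_splits)
    show "lozenge {Down j k, Up j (k + 1)}" for j by (simp add: lozenge_iff')
    fix s t assume s: "s \<in> ?A" and t: "t \<in> ?B" and L: "lozenge {s, t}"
    have s': "\<exists>j. s = Up j k \<or> s = Down j k" using s by (auto simp: tri_def split: if_splits)
    show "\<exists>j\<in>J. s = Down j k \<and> t = Up j (k + 1)"
    proof (cases t)
      case (Up j h)
      then obtain i where i: "s = Down i k" using s' L lozenge_iff(2) by metis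
      then have "j = i" "h = k + 1" using L Up t by (auto simp: lozenge_iff')
      then show ?thesis using t Up i by (intro bexI[of _ j]) (auto simp: J_def l_def)
    next
      case (Down j h)
      then obtain i where i: "s = Up i k" using s' L lozenge_iff(3) by metis
      then show ?thesis using L Down t by (auto simp: lozenge_iff)
    qed
  next
    show "finite ?A" by (intro finite_imageI finite_Diff finite_atLeastAtMost_int)
    show "finite ?B" by (rule finite_trap)
    show "finite J" unfolding J_def by simp
    show "inj_on (\<lambda>j. Down j k) J" "inj_on (\<lambda>j. Up j (k + 1)) J" by (simp_all add: inj_on_def)
  qed
  also have "\<dots> = (\<Sum>Y\<in>Pow J. row.Mr k ({2 * l..2 * (W - k - 1)} - dbl X0 - dbl1 Y) *
      ((\<Prod>j\<in>Y. half_at_0 (xi (k + 1) j)) * M axis_weight (?B - (\<lambda>j. Up j (k + 1)) ` Y)))"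
  proof (rule sum.cong[OF refl])
    fix Y assume "Y \<in> Pow J"
    have "(\<lambda>j. Down j k) ` Y = tri k ` dbl1 Y" by (simp only: image_image tri_odd)
    then have "?A - (\<lambda>j. Down j k) ` Y = tri k ` ({2 * l..2 * (W - k - 1)} - dbl X0 - dbl1 Y)"
      by (simp only: image_set_diff[OF inj_tri])
    moreover have "axis_weight {Down j k, Up j (k + 1)} = half_at_0 (xi (k + 1) j)" for j
      using axis_weight_vertical[of j "k + 1"] by (simp add: insert_commute)
    ultimately show "(\<Prod>j\<in>Y. axis_weight {Down j k, Up j (k + 1)}) *
      M axis_weight (?A - (\<lambda>j. Down j k) ` Y) * M axis_weight (?B - (\<lambda>j. Up j (k + 1)) ` Y) =
      row.Mr k ({2 * l..2 * (W - k - 1)} - dbl X0 - dbl1 Y) *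
      ((\<Prod>j\<in>Y. half_at_0 (xi (k + 1) j)) * M axis_weight (?B - (\<lambda>j. Up j (k + 1)) ` Y))"
      by (simp add: row.Mr_def)
  qed
  finally show ?thesis .
qed

text \<open>Induction on the number of rows, removing the lowest one. The parity of
  \<open>hi + \<delta>\<close> ties the number of remaining rows to the shape of the western end of
  the row, and thereby to the family of central factorials. The width hypothesis ensures that the
  lowest row is not empty.\<close>

theorem M_dented_trap:
  assumes \<delta>: "\<delta> = 0 \<or> \<delta> = 1" and "odd (hi + \<delta>)" and "hi - k = int r"
    and "X \<subseteq> {- ((k + \<delta>) div 2)..<W - k}" and "r = 0 \<Longrightarrow> X = {}"
    and "int ((r + 1) div 2) \<le> W - k + (k + \<delta>) div 2"
  shows "M axis_weight (trap \<delta> k hi W - (\<lambda>j. Up j k) ` X) =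
    (if card X = (r + 1) div 2 then dent_count r k X else 0)"
  using assms(2-)
proof (induction r arbitrary: k X)
  case 0
  have "trap \<delta> k hi W = {}" using 0 by (auto simp: trap_def split: triangle.splits)
  then show ?case using 0 by (simp add: dent_count_def vset_def)
next
  case (Suc r)
  define l where "l = - ((k + 1 + \<delta>) div 2)"
  define R where "R = W - k"
  define X0 where "X0 = X \<union> (if even (k + \<delta>) then {} else {l})"
  define J where "J = (if k + 1 = hi then {} else {l..<R - 1})"
  have k: "k < hi" using Suc.prems by simp
  have par: "even (k + \<delta>) \<longleftrightarrow> even r"
    using Suc.prems(1,2) by presburger
  have X0: "X0 = X \<union> (if even r then {} else {l})" unfolding X0_def par ..
  have lk: "- ((k + \<delta>) div 2) = (if even r then l else l + 1)"
    unfolding l_def par[symmetric] by presburger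
  have fX: "finite X" using Suc.prems(3) finite_subset by blast
  have X_l: "l \<le> j" "j < R" "odd r \<Longrightarrow> l < j" if "j \<in> X" for j
    using Suc.prems(3) that lk by (auto simp: R_def split: if_splits)
  have cardX0: "card X0 = (if even r then card X else Suc (card X))"
    using fX X_l(3)[of l] by (cases "l \<in> X") (auto simp: X0 insert_absorb)
  have RX: "int ((r + 1) div 2) \<le> R - 1 - l"
    using Suc.prems(5) lk unfolding R_def by (cases "even r") (auto elim!: evenE oddE)
  have split: "M axis_weight (trap \<delta> k hi W - (\<lambda>j. Up j k) ` X) =
    (\<Sum>Y\<in>Pow J. row.Mr k ({2 * l..2 * (R - 1)} - dbl X0 - dbl1 Y) *
      ((\<Prod>j\<in>Y. half_at_0 (xi (k + 1) j)) * M axis_weight (trap \<delta> (k + 1) hi W - (\<lambda>j. Up j (k + 1)) ` Y)))"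
    using M_trap_split[OF k Suc.prems(3)] unfolding l_def R_def X0_def J_def by simp
  show ?case
  proof (cases "X0 = {}")
    case True
    then have "even r" "X = {}" by (auto simp: X0 split: if_splits)
    \<comment> \<open>Without dents the row has more up-pointing triangles than down-pointing ones,
      while at least one dent is required; both sides are 0.\<close>
    have "row.Mr k ({2 * l..2 * (R - 1)} - dbl X0 - dbl1 Y) = 0" if "Y \<in> Pow J" for Y
    proof (rule ccontr)
      assume "row.Mr k ({2 * l..2 * (R - 1)} - dbl X0 - dbl1 Y) \<noteq> 0"
      then have "card {j. 2 * j \<in> {2 * l..2 * (R - 1)} - dbl1 Y} = card {j. 2 * j + 1 \<in> {2 * l..2 * (R - 1)} - dbl1 Y}"
        using True by (intro row.Mr_balanced) auto
      moreover have "{j. 2 * j \<in> {2 * l..2 * (R - 1)} - dbl1 Y} = {l..<R}" by (auto simp: mem_dbl)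
      moreover have "{j. 2 * j + 1 \<in> {2 * l..2 * (R - 1)} - dbl1 Y} \<subseteq> {l..<R - 1}" by auto
      then have "card {j. 2 * j + 1 \<in> {2 * l..2 * (R - 1)} - dbl1 Y} \<le> card {l..<R - 1}"
        by (intro card_mono) auto
      moreover have "l < R" using RX by linarith
      ultimately show False by simp
    qed
    then show ?thesis unfolding split using \<open>X = {}\<close> \<open>even r\<close> by simp
  next
    case False
    define n where "n = card X0 - 1"
    have fX0: "finite X0" using fX by (simp add: X0)
    have n: "card X0 = Suc n" using False fX0 by (simp add: n_def card_gt_0_iff)
    obtain x where x: "strict_mono_on {..<Suc n} x" "x ` {..<Suc n} = X0"
      using finite_strict_enumeration[OF fX0] n by metis
    have xs: "x i < x (Suc i)" if "i < n" for i using strict_mono_onD[OF x(1)] that by simp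
    have x_in: "x i \<in> X0" if "i \<le> n" for i using x(2) that by auto
    have x0: "l \<le> x 0" using x_in[of 0] X_l by (auto simp: X0 split: if_splits)
    have lR: "l < R" using RX by linarith
    have xn: "x n < R" using x_in[of n] X_l lR by (auto simp: X0 split: if_splits)
    have xX0: "dbl (x ` {..n}) = dbl X0" using x(2) by (simp add: lessThan_Suc_atMost)
    have cond: "card X = (Suc r + 1) div 2 \<longleftrightarrow> n = (r + 1) div 2"
      using cardX0 n by (cases "even r") (auto elim!: evenE oddE)
    show ?thesis
    proof (cases "r = 0")
      case True
      \<comment> \<open>A single row: nothing above can be matched with it, so it must have exactly
        one dent.\<close>
      then have "J = {}" using Suc.prems(2) by (simp add: J_def)
      have tr: "trap \<delta> (k + 1) hi W = {}" using True Suc.prems(2) by (auto simp: trap_def split: triangle.splits)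
      have "M axis_weight (trap \<delta> k hi W - (\<lambda>j. Up j k) ` X) = (if n = 0 then 1 else 0)"
        using row.Mr_row[of n x l R "{}", OF xs x0 xn] unfolding split \<open>J = {}\<close> xX0 tr by auto
      moreover have "dent_count (Suc r) k X = 1" if "n = 0"
      proof -
        have "card X = 1" using that n cardX0 True by simp
        then obtain j where X: "X = {j}" by (rule card_1_singletonE)
        have "vset (\<lambda>j. (xi k j)\<^sup>2) X = 1"
          unfolding vset_def X by (intro prod.neutral ballI) auto
        then show ?thesis using True by (simp add: dent_count_def)
      qed
      ultimately show ?thesis using cond True by auto
    next
      case r0: False
      then have J: "J = {l..<R - 1}" using Suc.prems(2) by (simp add: J_def)
      let ?B = "\<lambda>i. {x i..<x (Suc i)}"
      let ?s = "(of_int k + 1) / 2 :: real"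
      let ?F = "\<lambda>Y. (\<Prod>j\<in>Y. half_at_0 (xi (k + 1) j)) * M axis_weight (trap \<delta> (k + 1) hi W - (\<lambda>j. Up j (k + 1)) ` Y)"
      let ?u = "\<lambda>y i. of_int (y i) + ?s + 1/2"
      let ?D = "\<lambda>y. (if even r then \<Prod>i<n. ?u y i else 1) * vdm (\<lambda>i. (?u y i)\<^sup>2) n / row_const r"
      have xi_s: "xi (k + 1) j = of_int j + ?s + 1/2" "xi k j = of_int j + ?s" for j
        by (simp_all add: xi_def field_simps)
      have F: "?F (y ` {..<n}) = (if n = (r + 1) div 2 then (\<Prod>i<n. half_at_0 (?u y i)) * ?D y else 0)"
        if y: "y \<in> PiE {..<n} ?B" for y
      proof -
        have yB: "y i \<in> ?B i" if "i < n" for i by (rule PiE_mem[OF y]) (use that in simp)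
        have x_le: "x i \<le> x j" if "i \<le> j" "j \<le> n" for i j
          using strict_mono_onD[OF x(1), of i j] that by (cases "i = j") auto
        have ym: "strict_mono_on {..<n} y"
        proof (rule strict_mono_onI)
          fix i j assume "i \<in> {..<n}" "j \<in> {..<n}" "i < j"
          then show "y i < y j" using yB[of i] yB[of j] x_le[of "Suc i" j] by auto
        qed
        then have yi: "inj_on y {..<n}" by (rule strict_mono_on_imp_inj_on)
        have sub: "y ` {..<n} \<subseteq> {- ((k + 1 + \<delta>) div 2)..<W - (k + 1)}"
        proof
          fix u assume "u \<in> y ` {..<n}"
          then obtain i where i: "i < n" "u = y i" by auto
          then show "u \<in> {- ((k + 1 + \<delta>) div 2)..<W - (k + 1)}"
            using yB[of i] x_le[of 0 i] x_le[of "Suc i" n] x0 xn by (auto simp: l_def R_def)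
        qed
        have 1: "M axis_weight (trap \<delta> (k + 1) hi W - (\<lambda>j. Up j (k + 1)) ` (y ` {..<n})) =
            (if card (y ` {..<n}) = (r + 1) div 2 then dent_count r (k + 1) (y ` {..<n}) else 0)"
          by (rule Suc.IH) (use Suc.prems sub r0 RX in \<open>auto simp: l_def R_def\<close>)
        have 2: "card (y ` {..<n}) = n" using yi by (simp add: card_image)
        have 3: "dent_count r (k + 1) (y ` {..<n}) = ?D y"
          unfolding dent_count_def vset_enumeration[OF ym] xi_s prod.reindex[OF yi] by (simp add: o_def)
        have 4: "(\<Prod>j\<in>y ` {..<n}. half_at_0 (xi (k + 1) j)) = (\<Prod>i<n. half_at_0 (?u y i))"
          unfolding xi_s prod.reindex[OF yi] by (simp add: o_def)
        have if0: "p * (if c then q else 0) = (if c then p * q else 0)" for p q :: real and c by simp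
        show ?thesis unfolding 4 1 2 3 by (rule if0)
      qed
      have "M axis_weight (trap \<delta> k hi W - (\<lambda>j. Up j k) ` X) = (\<Sum>y\<in>PiE {..<n} ?B. ?F (y ` {..<n}))"
        using row.sum_Mr_row[of n x l R k ?F, OF xs x0 xn] unfolding split J xX0 .
      also have "\<dots> = (\<Sum>y\<in>PiE {..<n} ?B. if n = (r + 1) div 2 then (\<Prod>i<n. half_at_0 (?u y i)) * ?D y else 0)"
        by (rule sum.cong[OF refl F])
      also have "\<dots> = (if n = (r + 1) div 2 then dent_count (Suc r) k X else 0)"
      proof (cases "n = (r + 1) div 2")
        case nr: True
        have "(\<Sum>y\<in>PiE {..<n} ?B. (\<Prod>i<n. half_at_0 (?u y i)) * ?D y) = dent_count (Suc r) k X"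
        proof (cases "even r")
          case True
          \<comment> \<open>The row starts with an up-pointing triangle: all dents are genuine and
            lie at non-negative abscissas.\<close>
          then have X0e: "X0 = X" by (simp add: X0)
          have "0 \<le> real_of_int l + ?s"
          proof -
            have "2 * l = - (k + \<delta>)" using True unfolding l_def par[symmetric] by presburger
            then have "2 * real_of_int l = - (real_of_int k + real_of_int \<delta>)" by (metis of_int_add of_int_minus of_int_mult of_int_numeral)
            then show ?thesis using \<delta> by (auto simp: field_simps)
          qed
          then have pos: "0 \<le> of_int (x 0) + ?s" using x0 by linarith
          have "(\<Sum>y\<in>PiE {..<n} ?B. (\<Prod>i<n. half_at_0 (?u y i)) * ?D y) =
              (\<Sum>y\<in>PiE {..<n} ?B. (\<Prod>i<n. half_at_0 (?u y i)) * ((\<Prod>i<n. ?u y i) * vdm (\<lambda>i. (?u y i)\<^sup>2) n)) / row_const r"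
            using True by (simp add: sum_divide_distrib)
          also have "\<dots> = vdm (\<lambda>i. (of_int (x i) + ?s)\<^sup>2) (Suc n) / (\<Prod>k<n. 2 * real (Suc k)) / row_const r"
            by (subst sum_interlacing_odd[OF xs pos]) simp_all
          also have "vdm (\<lambda>i. (of_int (x i) + ?s)\<^sup>2) (Suc n) = vset (\<lambda>j. (xi k j)\<^sup>2) X"
            using vset_enumeration[OF x(1), of "\<lambda>j. (xi k j)\<^sup>2"] unfolding x(2) X0e xi_s ..
          finally show ?thesis using True nr by (simp add: dent_count_def mult.commute)
        next
          case False
          \<comment> \<open>The row starts with a down-pointing triangle: the ghost \<open>l\<close>
            precedes all dents, and its abscissa \<open>- \<delta> / 2\<close> is one of the two
            starting points that \<open>sum_interlacing_even\<close> admits.\<close>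
          then have X0e: "X0 = insert l X" by (simp add: X0)
          have xl: "x 0 = l"
          proof -
            obtain i where i: "i \<le> n" "x i = l" using x(2) X0e by (metis imageE insertI1 lessThan_iff less_Suc_eq_le)
            show ?thesis using strict_mono_onD[OF x(1), of 0 i] i x0 by (cases "i = 0") auto
          qed
          have xSuc: "(\<lambda>i. x (Suc i)) ` {..<n} = X"
          proof -
            have "x ` {..<Suc n} = insert (x 0) ((\<lambda>i. x (Suc i)) ` {..<n})"
              unfolding lessThan_Suc_eq_insert_0 by (simp add: image_image)
            then have "insert l ((\<lambda>i. x (Suc i)) ` {..<n}) = insert l X"
              unfolding x(2) X0e xl by (rule sym)
            moreover have "l \<notin> (\<lambda>i. x (Suc i)) ` {..<n}"
              using strict_mono_onD[OF x(1), of 0] xl by fastforce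
            moreover have "l \<notin> X" using X_l False by auto
            ultimately show ?thesis using insert_ident[of l "(\<lambda>i. x (Suc i)) ` {..<n}" X] by simp
          qed
          have xSm: "strict_mono_on {..<n} (\<lambda>i. x (Suc i))"
            using strict_mono_onD[OF x(1)] by (intro strict_mono_onI) auto
          have s: "of_int (x 0) + ?s = 0 \<or> of_int (x 0) + ?s = - (1/2)"
          proof -
            have "2 * l = - (k + \<delta> + 1)" using False unfolding l_def par[symmetric] by presburger
            then have "2 * real_of_int l = - (real_of_int k + real_of_int \<delta> + 1)"
              by (metis of_int_1 of_int_add of_int_minus of_int_mult of_int_numeral)
            then show ?thesis using \<delta> unfolding xl by (auto simp: field_simps)
          qed
          have "(\<Sum>y\<in>PiE {..<n} ?B. (\<Prod>i<n. half_at_0 (?u y i)) * ?D y) =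
              (\<Sum>y\<in>PiE {..<n} ?B. (\<Prod>i<n. half_at_0 (?u y i)) * vdm (\<lambda>i. (?u y i)\<^sup>2) n) / row_const r"
            using False by (simp add: sum_divide_distrib)
          also have "\<dots> = (\<Prod>i<n. of_int (x (Suc i)) + ?s) * vdm (\<lambda>i. (of_int (x (Suc i)) + ?s)\<^sup>2) n
              / (\<Prod>k<n. real (2 * k + 1)) / row_const r"
            by (subst sum_interlacing_even[OF xs s]) simp_all
          also have "vdm (\<lambda>i. (of_int (x (Suc i)) + ?s)\<^sup>2) n = vset (\<lambda>j. (xi k j)\<^sup>2) X"
            using vset_enumeration[OF xSm, of "\<lambda>j. (xi k j)\<^sup>2"] unfolding xSuc xi_s ..
          also have "(\<Prod>i<n. of_int (x (Suc i)) + ?s) = (\<Prod>j\<in>X. xi k j)"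
            unfolding xSuc[symmetric] xi_s prod.reindex[OF strict_mono_on_imp_inj_on[OF xSm]] by (simp add: o_def)
          finally show ?thesis using False nr by (simp add: dent_count_def mult.commute)
        qed
        then show ?thesis using nr by (simp only: if_True refl)
      next
        case False
        then show ?thesis by (simp only: if_False sum.neutral_const)
      qed
      finally show ?thesis unfolding cond .
    qed
  qed
qed

section \<open>Triangular holes\<close>

text \<open>Every down-pointing triangle of a hole must be matched with the up-pointing triangle above
  it once the up-pointing triangles on the base of the hole are absent.\<close>

definition hole_in :: "region \<Rightarrow> region \<Rightarrow> bool" where
  "hole_in R P \<longleftrightarrow>
    (\<forall>j k. Down j k \<in> R \<inter> P \<longrightarrow> Up j (k + 1) \<in> R \<inter> P \<and>
      (Up j k \<in> R \<longrightarrow> Up j k \<in> P) \<and> (Up (j + 1) k \<in> R \<longrightarrow> Up (j + 1) k \<in> P)) \<and>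
    (\<forall>j k. 0 \<le> k \<longrightarrow> Up j (k + 1) \<in> R \<inter> P \<longrightarrow> Down j k \<in> R \<inter> P)"

lemma hole_inD:
  assumes "hole_in R P"
  shows "Down j k \<in> R \<Longrightarrow> Down j k \<in> P \<Longrightarrow> Up j (k + 1) \<in> R"
    "Down j k \<in> R \<Longrightarrow> Down j k \<in> P \<Longrightarrow> Up j (k + 1) \<in> P"
    "Down j k \<in> R \<Longrightarrow> Down j k \<in> P \<Longrightarrow> Up j k \<in> R \<Longrightarrow> Up j k \<in> P"
    "Down j k \<in> R \<Longrightarrow> Down j k \<in> P \<Longrightarrow> Up (j + 1) k \<in> R \<Longrightarrow> Up (j + 1) k \<in> P"
    "0 \<le> k \<Longrightarrow> Up j (k + 1) \<in> R \<Longrightarrow> Up j (k + 1) \<in> P \<Longrightarrow> Down j k \<in> R"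
    "0 \<le> k \<Longrightarrow> Up j (k + 1) \<in> R \<Longrightarrow> Up j (k + 1) \<in> P \<Longrightarrow> Down j k \<in> P"
  using assms unfolding hole_in_def Int_iff by blast+

lemma hole_in_Union:
  assumes "\<And>P. P \<in> \<P> \<Longrightarrow> hole_in R P"
  shows "hole_in R (\<Union>\<P>)"
  unfolding hole_in_def
proof (intro conjI allI impI)
  fix j k assume "Down j k \<in> R \<inter> \<Union>\<P>"
  then obtain P where P: "P \<in> \<P>" "Down j k \<in> R" "Down j k \<in> P" by blast
  note h = hole_inD[OF assms[OF P(1)]]
  show "Up j (k + 1) \<in> R \<inter> \<Union>\<P>" using h(1,2)[OF P(2,3)] P(1) by blast
  show "Up j k \<in> \<Union>\<P>" if "Up j k \<in> R" using h(3)[OF P(2,3) that] P(1) by blast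
  show "Up (j + 1) k \<in> \<Union>\<P>" if "Up (j + 1) k \<in> R" using h(4)[OF P(2,3) that] P(1) by blast
next
  fix j k :: int assume "0 \<le> k" "Up j (k + 1) \<in> R \<inter> \<Union>\<P>"
  then obtain P where P: "P \<in> \<P>" "Up j (k + 1) \<in> R" "Up j (k + 1) \<in> P" by blast
  note h = hole_inD[OF assms[OF P(1)]]
  show "Down j k \<in> R \<inter> \<Union>\<P>" using h(5,6)[OF \<open>0 \<le> k\<close> P(2,3)] P(1) by blast
qed

text \<open>Tiling around a hole amounts to tiling the full trapezoid without the base triangles of
  the hole, since the rest of the hole is then filled by forced vertical lozenges. \<open>S\<close>
  carries the dents outside the holes.\<close>

lemma M_forced_holes:
  assumes P: "hole_in (trap \<delta> 0 hi W) P"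
    and w: "\<And>j k. 0 \<le> k \<Longrightarrow> Up j (k + 1) \<in> trap \<delta> 0 hi W \<Longrightarrow> Up j (k + 1) \<in> P \<Longrightarrow> w {Down j k, Up j (k + 1)} = 1"
  shows "M w (trap \<delta> 0 hi W - P - (\<lambda>j. Up j 0) ` S) = M w (trap \<delta> 0 hi W - (\<lambda>j. Up j 0) ` ({j. Up j 0 \<in> trap \<delta> 0 hi W \<inter> P} \<union> S))"
proof -
  define R where "R = trap \<delta> 0 hi W"
  note P = P[folded R_def] and w = w[folded R_def]
  let ?D = "{j. Up j 0 \<in> R \<inter> P}"
  let ?R' = "R - (\<lambda>j. Up j 0) ` (?D \<union> S)"
  define F where "F = {l. \<exists>j k. l = {Down j k, Up j (k + 1)} \<and> Down j k \<in> R \<and> Down j k \<in> P}"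
  note h = hole_inD[OF P]
  have R0: "0 \<le> k" if "Up j k \<in> R \<or> Down j k \<in> R" for j k using that unfolding R_def by auto
  have FI: "{Down j k, Up j (k + 1)} \<in> F" if "Down j k \<in> R" "Down j k \<in> P" for j k
    unfolding F_def mem_Collect_eq by (intro exI conjI, rule refl) (fact that)+
  have FE: thesis if "l \<in> F" "\<And>j k. l = {Down j k, Up j (k + 1)} \<Longrightarrow> Down j k \<in> R \<Longrightarrow> Down j k \<in> P \<Longrightarrow> thesis"
    for l thesis
    using that(1) unfolding F_def by (elim CollectE exE conjE) (rule that(2))
  have UF: "Up j k \<in> \<Union>F \<longleftrightarrow> k \<noteq> 0 \<and> Up j k \<in> R \<and> Up j k \<in> P" for j k
  proof
    assume "Up j k \<in> \<Union>F"
    then obtain l where l: "l \<in> F" "Up j k \<in> l" by (rule UnionE)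
    have "Down j (k - 1) \<in> R \<and> Down j (k - 1) \<in> P" using l by (elim FE) auto
    then have D: "Down j (k - 1) \<in> R" "Down j (k - 1) \<in> P" by simp_all
    then show "k \<noteq> 0 \<and> Up j k \<in> R \<and> Up j k \<in> P" using h(1,2)[OF D] R0[of j "k - 1"] by auto
  next
    assume k: "k \<noteq> 0 \<and> Up j k \<in> R \<and> Up j k \<in> P"
    then have "0 \<le> k - 1" using R0[of j k] by auto
    then have "Down j (k - 1) \<in> R" "Down j (k - 1) \<in> P" using h(5,6)[of "k - 1" j] k by auto
    then have "{Down j (k - 1), Up j (k - 1 + 1)} \<in> F" by (rule FI)
    then show "Up j k \<in> \<Union>F" by (rule UnionI) simp
  qed
  have DF: "Down j k \<in> \<Union>F \<longleftrightarrow> Down j k \<in> R \<and> Down j k \<in> P" for j k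
  proof
    assume "Down j k \<in> \<Union>F"
    then obtain l where l: "l \<in> F" "Down j k \<in> l" by (rule UnionE)
    then show "Down j k \<in> R \<and> Down j k \<in> P" by (elim FE) auto
  next
    assume "Down j k \<in> R \<and> Down j k \<in> P"
    then have "{Down j k, Up j (k + 1)} \<in> F" by (intro FI) simp_all
    then show "Down j k \<in> \<Union>F" by (rule UnionI) simp
  qed
  have "M w ?R' = M w (?R' - \<Union>F)"
  proof (rule M_forced)
    show "finite ?R'" unfolding R_def by simp
    fix T assume T: "tiling ?R' T"
    note d = tilingD[OF T]
    \<comment> \<open>Of the neighbours of \<open>Down j k\<close>, the two in its own row lie in
      the hole if present in \<open>R\<close>: for \<open>k = 0\<close> they are removed, otherwise
      they are already matched downwards by \<open>IH\<close>. Only the upper neighbour is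
      left.\<close>
    have step: "{Down j k, Up j (k + 1)} \<in> T"
      if D: "Down j k \<in> R" "Down j k \<in> P" and IH: "\<And>i. 0 < k \<Longrightarrow> Down i (k - 1) \<in> R \<Longrightarrow> Down i (k - 1) \<in> P \<Longrightarrow>
        {Down i (k - 1), Up i k} \<in> T" for j k
    proof -
      have "Down j k \<in> \<Union>T" unfolding d(1) using D by auto
      then obtain l where l: "l \<in> T" "Down j k \<in> l" by (rule UnionE)
      obtain i h' i' k' where e: "l = {Up i h', Down i' k'}" using lozenge_cases[OF d(3)[OF l(1)]] .
      have "i' = j" "k' = k" using l(2) unfolding e by simp_all
      then have e': "l = {Down j k, Up i h'}" unfolding e by (simp add: insert_commute)
      have "Up i h' \<in> l" unfolding e by simp
      then have "Up i h' \<in> ?R'" using d(4)[OF l(1)] by (rule subsetD[rotated])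
      then have Ri: "Up i h' \<in> R" "Up i h' \<notin> (\<lambda>j. Up j 0) ` (?D \<union> S)" by (simp_all only: Diff_iff simp_thms)
      have no: False if "h' = k" "Up i k \<in> P"
      proof (cases "k = 0")
        case True
        then show False using Ri that by auto
      next
        case False
        then have k: "0 < k" using R0[of i k] Ri(1) that(1) by simp
        have "Down i (k - 1) \<in> R" "Down i (k - 1) \<in> P" using h(5,6)[of "k - 1" i] k Ri(1) that by auto
        from IH[OF k this] have m: "{Down i (k - 1), Up i k} \<in> T" .
        have "l = {Down i (k - 1), Up i k}" by (rule d(2)[OF l(1) m]) (use e' that in auto)
        then show False using l(2) by auto
      qed
      have "lozenge {Down j k, Up i h'}" using d(3)[OF l(1)] e' by simp
      then consider "i = j" "h' = k" | "i = j + 1" "h' = k" | "i = j" "h' = k + 1"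
        unfolding lozenge_iff' by auto
      then show ?thesis
      proof cases
        case 1
        then show ?thesis using no h(3)[OF D] Ri(1) by simp
      next
        case 2
        then show ?thesis using no h(4)[OF D] Ri(1) by simp
      next
        case 3
        then show ?thesis using l(1) e' by simp
      qed
    qed
    have forced: "{Down j (int n), Up j (int n + 1)} \<in> T" if "Down j (int n) \<in> R" "Down j (int n) \<in> P" for j n
      using that
    proof (induction n arbitrary: j)
      case 0
      then show ?case by (intro step) auto
    next
      case (Suc n)
      show ?case by (rule step) (use Suc in \<open>auto simp: add.commute\<close>)
    qed
    show "F \<subseteq> T"
    proof
      fix l assume "l \<in> F"
      then obtain j k where l: "l = {Down j k, Up j (k + 1)}" "Down j k \<in> R" "Down j k \<in> P" by (rule FE)
      then show "l \<in> T" using forced[of j "nat k"] R0[of j k] by simp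
    qed
  next
    fix l m assume lm: "l \<in> F" "m \<in> F" and ne: "l \<inter> m \<noteq> {}"
    obtain j k where l: "l = {Down j k, Up j (k + 1)}" using lm(1) by (rule FE)
    obtain i h where m: "m = {Down i h, Up i (h + 1)}" using lm(2) by (rule FE)
    have "j = i \<and> k = h" using ne unfolding l m by auto
    then show "l = m" unfolding l m by simp
  next
    fix l assume "l \<in> F"
    then obtain j k where l: "l = {Down j k, Up j (k + 1)}" "Down j k \<in> R" "Down j k \<in> P" by (rule FE)
    then show "lozenge l" by (simp add: lozenge_iff')
    show "w l = 1" unfolding l(1) by (rule w) (use R0[of j k] l h(1,2)[OF l(2,3)] in simp_all)
  next
    show "\<Union>F \<subseteq> ?R'"
    proof
      fix t assume t: "t \<in> \<Union>F"
      show "t \<in> ?R'"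
      proof (cases t)
        case (Up j k)
        then show ?thesis using t UF[of j k] by auto
      next
        case (Down j k)
        then show ?thesis using t DF[of j k] by auto
      qed
    qed
  qed
  moreover have "?R' - \<Union>F = R - P - (\<lambda>j. Up j 0) ` S"
  proof (rule Set.set_eqI)
    fix t
    show "t \<in> ?R' - \<Union>F \<longleftrightarrow> t \<in> R - P - (\<lambda>j. Up j 0) ` S"
    proof (cases t)
      case (Up j k)
      have img: "Up j k \<in> (\<lambda>j. Up j 0) ` X \<longleftrightarrow> k = 0 \<and> j \<in> X" for X by auto
      show ?thesis unfolding Up Diff_iff UF img by auto
    next
      case (Down j k)
      have img: "Down j k \<in> (\<lambda>j. Up j 0) ` X \<longleftrightarrow> False" for X by auto
      show ?thesis unfolding Down Diff_iff DF img by auto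
    qed
  qed
  ultimately show ?thesis unfolding R_def by simp
qed

lemma triangles_in_simps:
  "Up j k \<in> triangles_in Q \<longleftrightarrow> Q (j, k) \<and> Q (j + 1, k) \<and> Q (j, k + 1)"
  "Down j k \<in> triangles_in Q \<longleftrightarrow> Q (j, k + 1) \<and> Q (j + 1, k + 1) \<and> Q (j + 1, k)"
  by (auto simp: triangles_in_def)

lemma triangles_in_cong:
  assumes "\<And>j k. p (j, k) \<longleftrightarrow> q (j, k)" shows "triangles_in p = triangles_in q"
proof -
  have "p = q" using assms by auto
  then show ?thesis by simp
qed

lemma in_up_hole:
  "Up j k \<in> up_hole c s \<longleftrightarrow> 0 \<le> k \<and> int c \<le> j \<and> j + k + 1 \<le> int c + int s"
  "Down j k \<in> up_hole c s \<longleftrightarrow> 0 \<le> k \<and> int c \<le> j \<and> j + k + 2 \<le> int c + int s"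
proof -
  have e: "up_hole c s = triangles_in (\<lambda>(j, k). 0 \<le> k \<and> int c \<le> j \<and> j + k \<le> int c + int s)"
    unfolding up_hole_def
  proof (rule triangles_in_cong)
    fix j k :: int
    have "real c + of_int k / 2 \<le> of_int j + of_int k / 2 \<longleftrightarrow> int c \<le> j" by linarith
    moreover have "of_int j + of_int k / 2 \<le> real c + real s - of_int k / 2 \<longleftrightarrow> j + k \<le> int c + int s"
      by linarith
    ultimately show "(0 \<le> height (j, k) \<and> real c + of_int (height (j, k)) / 2 \<le> absc (j, k) \<and>
        absc (j, k) \<le> real c + real s - of_int (height (j, k)) / 2) \<longleftrightarrow>
        (case (j, k) of (j, k) \<Rightarrow> 0 \<le> k \<and> int c \<le> j \<and> j + k \<le> int c + int s)"
      by (simp add: absc_def height_def)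
  qed
  show "Up j k \<in> up_hole c s \<longleftrightarrow> 0 \<le> k \<and> int c \<le> j \<and> j + k + 1 \<le> int c + int s"
    "Down j k \<in> up_hole c s \<longleftrightarrow> 0 \<le> k \<and> int c \<le> j \<and> j + k + 2 \<le> int c + int s"
    unfolding e triangles_in_simps by auto
qed

lemma hole_in_up_hole:
  assumes "\<delta> = 0 \<or> \<delta> = 1" "int s \<le> hi"
  shows "hole_in (trap \<delta> 0 hi W) (up_hole c s)"
proof -
  have div0: "0 \<le> (k + \<delta>) div 2" if "0 \<le> k" for k using that assms(1) by auto
  have le: "0 \<le> j + (k + \<delta>) div 2" if "int c \<le> j" "0 \<le> k" for j k
    using div0[OF that(2)] that(1) by linarith
  show ?thesis
    unfolding hole_in_def Int_iff Up_in_trap Down_in_trap in_up_hole using assms(2) le by auto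
qed

lemma in_half_hole:
  "Up j k \<in> N3_half_hole as \<longleftrightarrow> 0 \<le> k \<and> j + k + 1 \<le> int (entry as 1)"
  "Down j k \<in> N3_half_hole as \<longleftrightarrow> 0 \<le> k \<and> j + k + 2 \<le> int (entry as 1)"
proof -
  have e: "N3_half_hole as = triangles_in (\<lambda>(j, k). 0 \<le> k \<and> j + k \<le> int (entry as 1))"
    unfolding N3_half_hole_def
  proof (rule triangles_in_cong)
    fix j k :: int
    have "of_int j + of_int k / 2 \<le> real (entry as 1) - of_int k / 2 \<longleftrightarrow> j + k \<le> int (entry as 1)"
      by linarith
    then show "(0 \<le> height (j, k) \<and> absc (j, k) \<le> real (entry as 1) - of_int (height (j, k)) / 2) \<longleftrightarrow>
        (case (j, k) of (j, k) \<Rightarrow> 0 \<le> k \<and> j + k \<le> int (entry as 1))"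
      by (simp add: absc_def height_def)
  qed
  show "Up j k \<in> N3_half_hole as \<longleftrightarrow> 0 \<le> k \<and> j + k + 1 \<le> int (entry as 1)"
    "Down j k \<in> N3_half_hole as \<longleftrightarrow> 0 \<le> k \<and> j + k + 2 \<le> int (entry as 1)"
    unfolding e triangles_in_simps by auto
qed

text \<open>Cut by the west zigzag, the half hole occupies \<open>2 * a_1 - 1\<close> rows, where
  \<open>a_1\<close> is the first entry; the hypothesis makes them fit below
  \<open>hi\<close>.\<close>

lemma hole_in_half_hole:
  assumes "2 * int (entry as 1) \<le> hi + 1"
  shows "hole_in (trap 0 0 hi W) (N3_half_hole as)"
  unfolding hole_in_def Int_iff Up_in_trap Down_in_trap in_half_hole
proof (intro conjI allI impI)
  fix j k :: int
  assume a: "(0 \<le> k \<and> k < hi \<and> 0 \<le> j + (k + 1 + 0) div 2 \<and> j + k + 1 < W) \<and> 0 \<le> k \<and> j + k + 2 \<le> int (entry as 1)"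
  then have "k + 2 - (k + 1) div 2 \<le> int (entry as 1)" by simp
  then have "k + 3 \<le> 2 * int (entry as 1)" by presburger
  then show "k + 1 < hi" using assms by simp
qed auto

text \<open>Division by 2 with offset \<open>\<delta>\<close> reproduces the alternation of the
  zigzag, which turns the western boundary into an integer inequality.\<close>

lemma zigzag_le:
  assumes "d = 1/2 \<and> \<delta> = 0 \<or> d = - (1/2) \<and> \<delta> = 1"
  shows "zigzag d k \<le> of_int j + of_int k / 2 \<longleftrightarrow> 0 \<le> j + (k + \<delta>) div 2"
proof (cases "even k")
  case True
  then obtain i where k: "k = 2 * i" by (elim evenE)
  have "(k + \<delta>) div 2 = i" using assms k by auto
  then show ?thesis unfolding k zigzag_def by simp linarith
next
  case False
  then obtain i where k: "k = 2 * i + 1" by (elim oddE)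
  have 1: "(k + \<delta>) div 2 = i + \<delta>" using assms k by auto
  have 2: "real_of_int k / 2 = of_int i + 1/2" unfolding k by simp
  have 3: "zigzag d k = d" using False by (simp add: zigzag_def)
  have 4: "d \<le> of_int j + (of_int i + 1/2) \<longleftrightarrow> 0 \<le> j + (i + \<delta>)"
    using assms by (elim disjE conjE) (simp_all only:, linarith+)
  show ?thesis unfolding 1 2 3 by (rule 4)
qed

lemma triangles_in_trap:
  assumes d: "d = 1/2 \<and> \<delta> = 0 \<or> d = - (1/2) \<and> \<delta> = 1"
  shows "triangles_in (\<lambda>v. 0 \<le> height v \<and> height v \<le> hi \<and> zigzag d (height v) \<le> absc v \<and>
      absc v \<le> real W - of_int (height v) / 2) = trap \<delta> 0 hi (int W)"
proof -
  have e: "triangles_in (\<lambda>v. 0 \<le> height v \<and> height v \<le> hi \<and> zigzag d (height v) \<le> absc v \<and>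
      absc v \<le> real W - of_int (height v) / 2) =
    triangles_in (\<lambda>(j, k). 0 \<le> k \<and> k \<le> hi \<and> 0 \<le> j + (k + \<delta>) div 2 \<and> j + k \<le> int W)"
  proof (rule triangles_in_cong)
    fix j k :: int
    have "of_int j + of_int k / 2 \<le> real W - of_int k / 2 \<longleftrightarrow> j + k \<le> int W" by linarith
    then show "(0 \<le> height (j, k) \<and> height (j, k) \<le> hi \<and> zigzag d (height (j, k)) \<le> absc (j, k) \<and>
      absc (j, k) \<le> real W - of_int (height (j, k)) / 2) \<longleftrightarrow>
      (case (j, k) of (j, k) \<Rightarrow> 0 \<le> k \<and> k \<le> hi \<and> 0 \<le> j + (k + \<delta>) div 2 \<and> j + k \<le> int W)"
      using zigzag_le[OF d, of k j] by (simp add: absc_def height_def)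
  qed
  have m: "(k + \<delta>) div 2 \<le> (k + 1 + \<delta>) div 2" "(k + 1 + \<delta>) div 2 \<le> (k + \<delta>) div 2 + 1" for k by presburger+
  show ?thesis
  proof (rule Set.set_eqI)
    fix t
    show "t \<in> triangles_in (\<lambda>v. 0 \<le> height v \<and> height v \<le> hi \<and> zigzag d (height v) \<le> absc v \<and>
      absc v \<le> real W - of_int (height v) / 2) \<longleftrightarrow> t \<in> trap \<delta> 0 hi (int W)"
    proof (cases t)
      case (Up j k)
      show ?thesis unfolding Up e triangles_in_simps Up_in_trap prod.case using m[of k] by linarith
    next
      case (Down j k)
      show ?thesis unfolding Down e triangles_in_simps Down_in_trap prod.case using m[of k] by linarith
    qed
  qed
qed

section \<open>The two kinds of quartered hexagons\<close>

text \<open>For \<open>\<delta> = 0\<close> every up-pointing triangle has its base centre at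
  abscissa at least 1/2, so no edge is centred on the axis.\<close>

lemma unit_weight_trap:
  assumes "lozenge l" "l \<subseteq> trap 0 0 hi W"
  shows "axis_weight l = 1"
proof -
  have "xi h j \<noteq> 0" if l: "l = {Up j h, Down j (h - 1)}" for j h
  proof -
    have "0 \<le> h" "0 \<le> j + h div 2" using assms(2) unfolding l by simp_all
    then have "0 \<le> 2 * j + h" by presburger
    then have "0 \<le> real_of_int (2 * j + h)" by (simp only: of_int_0_le_iff)
    moreover have "2 * xi h j = real_of_int (2 * j + h) + 1" by (simp add: xi_def)
    ultimately show ?thesis by linarith
  qed
  then show ?thesis unfolding axis_weight_def by auto
qed

definition zz :: "int \<Rightarrow> vertex set" where
  "zz hi = {v. 0 \<le> height v \<and> height v \<le> hi \<and> absc v = zigzag (- (1/2)) (height v)}"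

lemma in_zz: "(j, k) \<in> zz hi \<longleftrightarrow> 0 \<le> k \<and> k \<le> hi \<and> j + (k + 1) div 2 = 0"
proof (cases "even k")
  case True
  then obtain i where k: "k = 2 * i" by (elim evenE)
  have "absc (j, k) = zigzag (- (1/2)) (height (j, k)) \<longleftrightarrow> real_of_int (j + i) = 0"
    by (simp add: absc_def height_def zigzag_def k)
  then have "absc (j, k) = zigzag (- (1/2)) (height (j, k)) \<longleftrightarrow> j + i = 0"
    by (simp only: of_int_eq_0_iff)
  then show ?thesis unfolding zz_def by (simp add: height_def k)
next
  case False
  then obtain i where k: "k = 2 * i + 1" by (elim oddE)
  have "absc (j, k) = zigzag (- (1/2)) (height (j, k)) \<longleftrightarrow> real_of_int (j + i + 1) = 0"
    by (auto simp: absc_def height_def zigzag_def k field_simps)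
  then have "absc (j, k) = zigzag (- (1/2)) (height (j, k)) \<longleftrightarrow> j + i + 1 = 0"
    by (simp only: of_int_eq_0_iff)
  then show ?thesis unfolding zz_def by (auto simp: height_def k)
qed

text \<open>The three points lie on the zigzag together exactly if \<open>2 * j + k + 1 = 0\<close>,
  that is, if the lozenge is centred on the axis; the height bounds hold because the lozenge lies in
  the trapezoid.\<close>

lemma zigzag_weight_trap:
  assumes "l \<subseteq> trap 1 0 hi W"
  shows "zigzag_weight (zz hi) l = axis_weight l"
proof -
  have "{(j, k + 1), (j, k), (j + 1, k - 1)} \<subseteq> zz hi \<longleftrightarrow> xi k j = 0"
    if l: "l = {Up j k, Down j (k - 1)}" for j k
  proof -
    have "0 \<le> k - 1" "k < hi" using assms unfolding l by simp_all
    have "xi k j = 0 \<longleftrightarrow> real_of_int (2 * j + k + 1) = 0" by (simp add: xi_def field_simps)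
    then have "xi k j = 0 \<longleftrightarrow> 2 * j + k + 1 = 0" by (simp only: of_int_eq_0_iff)
    moreover have "(j + (k + 1 + 1) div 2 = 0 \<and> j + (k + 1) div 2 = 0 \<and> j + 1 + (k - 1 + 1) div 2 = 0) \<longleftrightarrow>
        2 * j + k + 1 = 0" by presburger
    ultimately show ?thesis using \<open>0 \<le> k - 1\<close> \<open>k < hi\<close> by (simp add: in_zz)
  qed
  then have "(\<exists>j k. l = {Up j k, Down j (k - 1)} \<and> {(j, k + 1), (j, k), (j + 1, k - 1)} \<subseteq> zz hi) \<longleftrightarrow>
      (\<exists>j k. l = {Up j k, Down j (k - 1)} \<and> xi k j = 0)"
    by (intro ex_cong1 conj_cong refl) 
  then show ?thesis unfolding zigzag_weight_def axis_weight_def by simp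
qed

text \<open>The positions of the unit segments of the base that lie below the holes.\<close>

definition dents :: "nat list \<Rightarrow> int set" where
  "dents t = {j. \<exists>i\<in>{1..length t div 2}. int (partial_sum t (2 * i - 1)) \<le> j \<and>
    j < int (partial_sum t (2 * i - 1) + entry t (2 * i))}"

lemma dents_hole: "Up j 0 \<in> quartered_holes t \<longleftrightarrow> j \<in> dents t"
  by (auto simp: quartered_holes_def dents_def in_up_hole)

lemma entry_le_even_sum:
  assumes "i \<in> {1..length t div 2}" shows "entry t (2 * i) \<le> even_sum t"
  unfolding even_sum_def by (rule member_le_sum) (use assms in auto)

lemma hole_in_quartered:
  assumes "\<delta> = 0 \<or> \<delta> = 1" "int (even_sum t) \<le> hi"
  shows "hole_in (trap \<delta> 0 hi W) (quartered_holes t)"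
  unfolding quartered_holes_def
proof (rule hole_in_Union)
  fix P assume "P \<in> (\<lambda>i. up_hole (partial_sum t (2 * i - 1)) (entry t (2 * i))) ` {1..length t div 2}"
  then obtain i where i: "i \<in> {1..length t div 2}" and P: "P = up_hole (partial_sum t (2 * i - 1)) (entry t (2 * i))"
    by blast
  show "hole_in (trap \<delta> 0 hi W) P"
    unfolding P using assms entry_le_even_sum[OF i] by (intro hole_in_up_hole) auto
qed

lemma axis_weight_hole:
  assumes "0 \<le> k" "0 \<le> j"
  shows "axis_weight {Down j k, Up j (k + 1)} = 1"
proof -
  have "real_of_int j \<ge> 0" "real_of_int k \<ge> 0" using assms by simp_all
  moreover have "xi (k + 1) j = real_of_int j + real_of_int k / 2 + 1" by (simp add: xi_def field_simps)
  ultimately have "xi (k + 1) j > 0" by linarith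
  then show ?thesis
    using axis_weight_vertical[of j "k + 1"] by (simp add: half_at_0_def insert_commute)
qed

lemma M_quartered:
  assumes "\<delta> = 0 \<or> \<delta> = 1" "int (even_sum t) \<le> int r" "odd (int r + \<delta>)"
    and "dents t \<subseteq> {0..<W}" "card (dents t) = even_sum t" "even_sum t = (r + 1) div 2" "r > 0"
  shows "M axis_weight (trap \<delta> 0 (int r) W - quartered_holes t) = dent_count r 0 (dents t)"
proof -
  let ?R = "trap \<delta> 0 (int r) W"
  have "M axis_weight (?R - quartered_holes t - (\<lambda>j. Up j 0) ` {}) =
      M axis_weight (?R - (\<lambda>j. Up j 0) ` ({j. Up j 0 \<in> ?R \<inter> quartered_holes t} \<union> {}))"
  proof (rule M_forced_holes)
    show "hole_in ?R (quartered_holes t)" using assms by (intro hole_in_quartered) auto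
    fix j k :: int assume "0 \<le> k" "Up j (k + 1) \<in> quartered_holes t"
    then show "axis_weight {Down j k, Up j (k + 1)} = 1"
      by (intro axis_weight_hole) (auto simp: quartered_holes_def in_up_hole)
  qed
  moreover have "{j. Up j 0 \<in> ?R \<inter> quartered_holes t} \<union> {} = dents t"
  proof -
    have "Up j 0 \<in> ?R" if "j \<in> dents t" for j
      using assms(1,4,7) that by auto
    then show ?thesis by (auto simp: dents_hole)
  qed
  moreover have "M axis_weight (?R - (\<lambda>j. Up j 0) ` dents t) =
      (if card (dents t) = (r + 1) div 2 then dent_count r 0 (dents t) else 0)"
  proof (rule M_dented_trap[OF assms(1,3)])
    have "card (dents t) \<le> card {0..<W}" using assms(4) by (intro card_mono) auto
    then show "int ((r + 1) div 2) \<le> W - 0 + (0 + \<delta>) div 2" using assms by auto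
  qed (use assms in auto)
  ultimately show ?thesis using assms(5,6) by simp
qed

lemma K_eq:
  assumes "dents t \<subseteq> {0..<int (odd_sum t + even_sum t)}" "card (dents t) = even_sum t"
  shows "K t = dent_count (2 * even_sum t - 1) 0 (dents t)"
proof (cases "even_sum t = 0")
  case True
  \<comment> \<open>Here \<open>2 * even_sum t - 1\<close> is truncated to 0, and
    \<open>dent_count\<close> gives the conventional value 1.\<close>
  then have "dents t = {}" using assms finite_subset[OF assms(1)] by simp
  then show ?thesis using True by (simp add: K_def dent_count_def vset_def)
next
  case False
  let ?r = "2 * even_sum t - 1" and ?W = "odd_sum t + even_sum t"
  have r: "2 * int (even_sum t) - 1 = int ?r" using False by simp
  have "quartered_hexagon (1/2) (2 * int (even_sum t) - 1) t = trap 0 0 (int ?r) (int ?W) - quartered_holes t"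
    unfolding quartered_hexagon_def r by (subst triangles_in_trap[where \<delta> = 0]) auto
  then have "K t = M unit_weight (trap 0 0 (int ?r) (int ?W) - quartered_holes t)"
    using False by (simp add: K_def)
  also have "\<dots> = M axis_weight (trap 0 0 (int ?r) (int ?W) - quartered_holes t)"
  proof (rule M_cong_weight)
    fix l assume l: "lozenge l" "l \<subseteq> trap 0 0 (int ?r) (int ?W) - quartered_holes t"
    then have "l \<subseteq> trap 0 0 (int ?r) (int ?W)" by blast
    then show "unit_weight l = axis_weight l" using unit_weight_trap[OF l(1)] by (simp add: unit_weight_def)
  qed
  also have "\<dots> = dent_count ?r 0 (dents t)"
    by (rule M_quartered) (use assms False in auto)
  finally show ?thesis .
qed

lemma Q'_eq:
  assumes "dents t \<subseteq> {0..<int (odd_sum t + even_sum t)}" "card (dents t) = even_sum t"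
  shows "Q' t = dent_count (2 * even_sum t) 0 (dents t)"
proof -
  let ?r = "2 * even_sum t" and ?W = "odd_sum t + even_sum t"
  have r: "2 * int (even_sum t) = int ?r" by simp
  have q: "quartered_hexagon (- (1/2)) (2 * int (even_sum t)) t = trap 1 0 (int ?r) (int ?W) - quartered_holes t"
    unfolding quartered_hexagon_def r by (subst triangles_in_trap[where \<delta> = 1]) auto
  have "Q' t = M (zigzag_weight (zz (int ?r))) (trap 1 0 (int ?r) (int ?W) - quartered_holes t)"
    unfolding Q'_def q zz_def by (simp only: r)
  also have "\<dots> = M axis_weight (trap 1 0 (int ?r) (int ?W) - quartered_holes t)"
    by (intro M_cong_weight zigzag_weight_trap) auto
  also have "\<dots> = dent_count ?r 0 (dents t)"
  proof (cases "even_sum t = 0")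
    case True
    then have "dents t = {}" using assms finite_subset[OF assms(1)] by simp
    moreover have "trap 1 0 (int ?r) (int ?W) = {}" using True by (auto simp: trap_def split: triangle.splits)
    ultimately show ?thesis using True by (simp add: dent_count_def vset_def)
  next
    case False
    then show ?thesis by (intro M_quartered) (use assms in auto)
  qed
  finally show ?thesis .
qed

section \<open>Reflection of the lower half in the base line\<close>

fun mirror :: "triangle \<Rightarrow> triangle" where
  "mirror (Up j k) = Down (j + k) (- k - 1)"
| "mirror (Down j k) = Up (j + k + 1) (- k - 1)"

text \<open>Reflection negates \<open>k\<close> and preserves the abscissa \<open>j + k/2\<close>,
  which forces \<open>(j + k, - k)\<close>; \<open>mirror\<close> is the induced map on
  triangles.\<close>

definition rv :: "vertex \<Rightarrow> vertex" where "rv v = (fst v + snd v, - snd v)"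

lemma mirror_mirror [simp]: "mirror (mirror t) = t" by (cases t) auto

lemma inj_mirror: "inj mirror" by (metis injI mirror_mirror)

lemma mem_mirror_image: "t \<in> mirror ` R \<longleftrightarrow> mirror t \<in> R"
  by (metis imageE imageI mirror_mirror)

lemma inj_rv: "inj rv" by (rule injI) (auto simp: rv_def prod_eq_iff)

lemma vertices_mirror: "vertices (mirror t) = rv ` vertices t"
  by (cases t) (auto simp: rv_def)

lemma lozenge_mirror: "lozenge (mirror ` l) \<longleftrightarrow> lozenge l"
proof -
  have *: "lozenge (mirror ` l)" if L: "lozenge l" for l
  proof -
    obtain s t where l: "l = {s, t}" "s \<noteq> t" "card (vertices s \<inter> vertices t) = 2"
      using L unfolding lozenge_def by blast
    have "card (vertices (mirror s) \<inter> vertices (mirror t)) = 2"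
      unfolding vertices_mirror image_Int[OF inj_rv, symmetric]
      using l(3) by (simp add: card_image inj_on_subset[OF inj_rv])
    moreover have "mirror s \<noteq> mirror t" using l(2) inj_mirror by (auto dest: injD)
    ultimately show ?thesis unfolding lozenge_def l(1) by (intro exI[of _ "mirror s"] exI[of _ "mirror t"]) simp
  qed
  have "mirror ` mirror ` l = l" by (simp add: image_image)
  then show ?thesis using *[of l] *[of "mirror ` l"] by auto
qed

lemma triangles_in_rv: "triangles_in (\<lambda>v. p (rv v)) = mirror ` triangles_in p"
proof (rule Set.set_eqI)
  fix t
  have "t \<in> mirror ` triangles_in p \<longleftrightarrow> (\<forall>v\<in>rv ` vertices t. p v)"
    unfolding mem_mirror_image triangles_in_def mem_Collect_eq vertices_mirror ..
  then show "t \<in> triangles_in (\<lambda>v. p (rv v)) \<longleftrightarrow> t \<in> mirror ` triangles_in p"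
    by (simp add: triangles_in_def)
qed

lemma absc_rv [simp]: "absc (rv v) = absc v" "height (rv v) = - height v"
  by (simp_all add: absc_def height_def rv_def)

lemma down_hole_mirror: "down_hole c s = mirror ` up_hole c s"
  unfolding up_hole_def triangles_in_rv[symmetric] down_hole_def by simp

lemma zigzag_minus [simp]: "zigzag d (- k) = zigzag d k" by (simp add: zigzag_def)

text \<open>The eastern boundary runs outwards for \<open>z\<close> rows and then inwards. After
  reflection the notch is an up-pointing triangle of side \<open>z\<close> at the eastern end of a
  base of length \<open>L + z\<close>, so \<open>z\<close> acts as one more hole of an ordinary
  trapezoid.\<close>

lemma N3_lower_mirror:
  "N3_lower x y z as bs =
    mirror ` (trap 1 0 (N3_depth y z as bs) (int (N3_width x y as bs + z)) - up_hole (N3_width x y as bs) z)"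
proof -
  define L where "L = N3_width x y as bs"
  define B where "B = N3_depth y z as bs"
  let ?p = "\<lambda>v. 0 \<le> height v \<and> height v \<le> B \<and> zigzag (- (1/2)) (height v) \<le> absc v \<and>
    absc v \<le> (if height v \<le> int z then real L + of_int (height v) / 2 else real L + real z - of_int (height v) / 2)"
  have 1: "N3_lower x y z as bs = triangles_in (\<lambda>v. ?p (rv v))"
    unfolding N3_lower_def L_def[symmetric] B_def[symmetric]
    by (rule triangles_in_cong) (auto simp: minus_le_iff)
  have 4: "triangles_in (\<lambda>v. ?p (rv v)) = mirror ` triangles_in ?p" by (rule triangles_in_rv)
  have 2: "triangles_in ?p = triangles_in (\<lambda>(j, k). 0 \<le> k \<and> k \<le> B \<and> 0 \<le> j + (k + 1) div 2 \<and>
      (if k \<le> int z then j \<le> int L else j + k \<le> int L + int z))"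
  proof (rule triangles_in_cong)
    fix j k :: int
    have "of_int j + of_int k / 2 \<le> real L + of_int k / 2 \<longleftrightarrow> j \<le> int L" by linarith
    moreover have "of_int j + of_int k / 2 \<le> real L + real z - of_int k / 2 \<longleftrightarrow> j + k \<le> int L + int z" by linarith
    ultimately show "?p (j, k) \<longleftrightarrow> (case (j, k) of (j, k) \<Rightarrow> 0 \<le> k \<and> k \<le> B \<and> 0 \<le> j + (k + 1) div 2 \<and>
      (if k \<le> int z then j \<le> int L else j + k \<le> int L + int z))"
      using zigzag_le[of "- (1/2)" 1 k j] by (simp add: absc_def height_def)
  qed
  \<comment> \<open>\<open>p\<close> and \<open>q\<close> stand for the zigzag terms of two
    consecutive heights. Freed from \<open>div\<close>, the claim is linear arithmetic with a case
    split on \<open>k\<close> against \<open>Z\<close>.\<close>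
  have up_aux: "((0 \<le> k \<and> k \<le> B \<and> 0 \<le> j + p \<and> (if k \<le> Z then j \<le> l else j + k \<le> l + Z)) \<and>
      (0 \<le> k \<and> k \<le> B \<and> 0 \<le> j + 1 + p \<and> (if k \<le> Z then j + 1 \<le> l else j + 1 + k \<le> l + Z)) \<and>
      (0 \<le> k + 1 \<and> k + 1 \<le> B \<and> 0 \<le> j + q \<and> (if k + 1 \<le> Z then j \<le> l else j + (k + 1) \<le> l + Z))) \<longleftrightarrow>
      (0 \<le> k \<and> k < B \<and> 0 \<le> j + p \<and> j + k < l + Z) \<and> \<not> (0 \<le> k \<and> l \<le> j \<and> j + k + 1 \<le> l + Z)"
    if "p \<le> q" for j k p q Z l :: int
  proof -
    have G: "(if k \<le> Z then j \<le> l else j + k \<le> l + Z) \<and> (if k \<le> Z then j + 1 \<le> l else j + 1 + k \<le> l + Z) \<and> (if k + 1 \<le> Z then j \<le> l else j + (k + 1) \<le> l + Z) \<longleftrightarrow> j + k < l + Z \<and> \<not> (l \<le> j \<and> j + k + 1 \<le> l + Z)" if "0 \<le> k"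
      using that by (cases k Z rule: linorder_cases) auto
    have kB: "k < B \<longleftrightarrow> k + 1 \<le> B" by auto
    show ?thesis
    proof (cases "0 \<le> k \<and> k + 1 \<le> B \<and> 0 \<le> j + p")
      case True
      then have "0 \<le> k" "k \<le> B" "k + 1 \<le> B" "0 \<le> k + 1" "0 \<le> j + p" "0 \<le> j + 1 + p" "0 \<le> j + q"
        using that by auto
      then show ?thesis unfolding kB using G by (simp only: simp_thms)
    next
      case False
      then show ?thesis unfolding kB by blast
    qed
  qed
  have down_aux: "((0 \<le> k + 1 \<and> k + 1 \<le> B \<and> 0 \<le> j + q \<and> (if k + 1 \<le> Z then j \<le> l else j + (k + 1) \<le> l + Z)) \<and>
      (0 \<le> k + 1 \<and> k + 1 \<le> B \<and> 0 \<le> j + 1 + q \<and> (if k + 1 \<le> Z then j + 1 \<le> l else j + 1 + (k + 1) \<le> l + Z)) \<and>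
      (0 \<le> k \<and> k \<le> B \<and> 0 \<le> j + 1 + p \<and> (if k \<le> Z then j + 1 \<le> l else j + 1 + k \<le> l + Z))) \<longleftrightarrow>
      (0 \<le> k \<and> k < B \<and> 0 \<le> j + q \<and> j + k + 1 < l + Z) \<and> \<not> (0 \<le> k \<and> l \<le> j \<and> j + k + 2 \<le> l + Z)"
    if "q \<le> p + 1" for j k p q Z l :: int
  proof -
    have G: "(if k + 1 \<le> Z then j \<le> l else j + (k + 1) \<le> l + Z) \<and> (if k + 1 \<le> Z then j + 1 \<le> l else j + 1 + (k + 1) \<le> l + Z) \<and> (if k \<le> Z then j + 1 \<le> l else j + 1 + k \<le> l + Z) \<longleftrightarrow> j + k + 1 < l + Z \<and> \<not> (l \<le> j \<and> j + k + 2 \<le> l + Z)" if "0 \<le> k"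
      using that by (cases k Z rule: linorder_cases) auto
    have kB: "k < B \<longleftrightarrow> k + 1 \<le> B" by auto
    show ?thesis
    proof (cases "0 \<le> k \<and> k + 1 \<le> B \<and> 0 \<le> j + q")
      case True
      then have "0 \<le> k" "k \<le> B" "k + 1 \<le> B" "0 \<le> k + 1" "0 \<le> j + q" "0 \<le> j + 1 + p" "0 \<le> j + 1 + q"
        using that by auto
      then show ?thesis unfolding kB using G by (simp only: simp_thms)
    next
      case False
      then show ?thesis unfolding kB by blast
    qed
  qed
  have 3: "triangles_in (\<lambda>(j, k). 0 \<le> k \<and> k \<le> B \<and> 0 \<le> j + (k + 1) div 2 \<and>
      (if k \<le> int z then j \<le> int L else j + k \<le> int L + int z)) = trap 1 0 B (int (L + z)) - up_hole L z"
  proof (rule Set.set_eqI)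
    fix t
    have m: "(k + 1) div 2 \<le> (k + 1 + 1) div 2" "(k + 1 + 1) div 2 \<le> (k + 1) div 2 + 1" for k :: int by presburger+
    show "t \<in> triangles_in (\<lambda>(j, k). 0 \<le> k \<and> k \<le> B \<and> 0 \<le> j + (k + 1) div 2 \<and>
      (if k \<le> int z then j \<le> int L else j + k \<le> int L + int z)) \<longleftrightarrow> t \<in> trap 1 0 B (int (L + z)) - up_hole L z"
    proof (cases t)
      case (Up j k)
      show ?thesis
        unfolding Up triangles_in_simps Diff_iff Up_in_trap in_up_hole prod.case of_nat_add using m(1)[of k]
        by (rule up_aux)
    next
      case (Down j k)
      show ?thesis
        unfolding Down triangles_in_simps Diff_iff Down_in_trap in_up_hole prod.case of_nat_add using m(2)[of k]
        by (rule down_aux)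
    qed
  qed
  have "N3_lower x y z as bs = mirror ` (trap 1 0 B (int (L + z)) - up_hole L z)"
    unfolding 1 4 2 3 ..
  then show ?thesis unfolding L_def B_def .
qed

text \<open>Reflection takes a vertical lozenge to a vertical lozenge and its west corner to the new
  west corner, exchanging the far ends of the two western sides.\<close>

lemma zigzag_weight_mirror:
  "zigzag_weight (N3_west_zigzag y z as bs) (mirror ` l) = zigzag_weight (zz (N3_depth y z as bs)) l"
proof -
  let ?B = "N3_depth y z as bs"
  have W: "v \<in> N3_west_zigzag y z as bs \<longleftrightarrow> rv v \<in> zz ?B" for v
    unfolding N3_west_zigzag_def zz_def mem_Collect_eq absc_rv zigzag_minus by auto
  have rr: "mirror ` m = n \<longleftrightarrow> m = mirror ` n" for m n
    by (auto simp: image_image) 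
  have e: "mirror ` l = {Up j k, Down j (k - 1)} \<longleftrightarrow> l = {Up (j + k) (- k), Down (j + k) (- k - 1)}" for j k
    unfolding rr by (auto simp: insert_commute)
  have s: "{(j, k + 1), (j, k), (j + 1, k - 1)} \<subseteq> N3_west_zigzag y z as bs \<longleftrightarrow>
      {(j + k, - k + 1), (j + k, - k), (j + k + 1, - k - 1)} \<subseteq> zz ?B" for j k
  proof -
    have "rv (j, k + 1) = (j + k + 1, - k - 1)" "rv (j, k) = (j + k, - k)" "rv (j + 1, k - 1) = (j + k, - k + 1)"
      by (simp_all add: rv_def)
    then show ?thesis by (auto simp: W)
  qed
  have "(\<exists>j k. mirror ` l = {Up j k, Down j (k - 1)} \<and> {(j, k + 1), (j, k), (j + 1, k - 1)} \<subseteq> N3_west_zigzag y z as bs) \<longleftrightarrow>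
      (\<exists>j k. l = {Up j k, Down j (k - 1)} \<and> {(j, k + 1), (j, k), (j + 1, k - 1)} \<subseteq> zz ?B)" (is "?l \<longleftrightarrow> ?r")
  proof
    assume ?l
    then obtain j k where "l = {Up (j + k) (- k), Down (j + k) (- k - 1)}"
      "{(j + k, - k + 1), (j + k, - k), (j + k + 1, - k - 1)} \<subseteq> zz ?B" unfolding e s by (elim exE conjE)
    then show ?r by (intro exI[of _ "j + k"] exI[of _ "- k"] conjI)
  next
    assume ?r
    then obtain j k where l: "l = {Up j k, Down j (k - 1)}" "{(j, k + 1), (j, k), (j + 1, k - 1)} \<subseteq> zz ?B"
      by (elim exE conjE)
    show ?l unfolding e s by (intro exI[of _ "j + k"] exI[of _ "- k"] conjI) (use l in simp_all)
  qed
  then show ?thesis unfolding zigzag_weight_def by simp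
qed

section \<open>Ferns\<close>

text \<open>The union of the \<open>i\<close>-th segments with \<open>P i\<close>, if segments of lengths \<open>t\<^sub>1, t\<^sub>2, \<dots>\<close> are laid
  out from \<open>0\<close>.\<close>

fun seg :: "(nat \<Rightarrow> bool) \<Rightarrow> nat list \<Rightarrow> int set" where
  "seg P [] = {}"
| "seg P (n # t) = (if P 1 then {0..<int n} else {}) \<union> (\<lambda>j. int n + j) ` seg (\<lambda>i. P (Suc i)) t"

lemma partial_sum_0 [simp]: "partial_sum t 0 = 0"
  by (simp add: partial_sum_def)

lemma partial_sum_Suc: "partial_sum t (Suc i) = partial_sum t i + entry t (Suc i)"
  by (simp add: partial_sum_def)

lemma entry_Cons: "entry (n # t) (Suc i) = (if i = 0 then n else entry t i)"
  by (cases i) (auto simp: entry_def)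

lemma partial_sum_Cons: "partial_sum (n # t) (Suc i) = n + partial_sum t i"
  by (induction i) (simp_all add: partial_sum_Suc entry_Cons)

text \<open>The recursive definition suits concatenation and reversal of lists; this form suits the
  comparison with the holes, which are placed by partial sums.\<close>

lemma mem_seg:
  "j \<in> seg P t \<longleftrightarrow> (\<exists>i\<in>{1..length t}. P i \<and> int (partial_sum t (i - 1)) \<le> j \<and> j < int (partial_sum t i))"
proof (induction t arbitrary: P j)
  case (Cons n t)
  have "j \<in> seg P (n # t) \<longleftrightarrow> (P 1 \<and> 0 \<le> j \<and> j < int n) \<or> j - int n \<in> seg (\<lambda>i. P (Suc i)) t"
    by (auto simp: image_iff intro: bexI[of _ "j - int n"])
  also have "j - int n \<in> seg (\<lambda>i. P (Suc i)) t \<longleftrightarrow>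
      (\<exists>i\<in>{1..length t}. P (Suc i) \<and> int (partial_sum (n # t) i) \<le> j \<and> j < int (partial_sum (n # t) (Suc i)))"
    unfolding Cons.IH
  proof (intro bex_cong refl)
    fix i assume "i \<in> {1..length t}"
    then obtain k where "i = Suc k" by (cases i) auto
    then show "(P (Suc i) \<and> int (partial_sum t (i - 1)) \<le> j - int n \<and> j - int n < int (partial_sum t i)) \<longleftrightarrow>
      (P (Suc i) \<and> int (partial_sum (n # t) i) \<le> j \<and> j < int (partial_sum (n # t) (Suc i)))"
      by (auto simp: partial_sum_Cons)
  qed
  also have "(P 1 \<and> 0 \<le> j \<and> j < int n) \<or> (\<exists>i\<in>{1..length t}. P (Suc i) \<and>
        int (partial_sum (n # t) i) \<le> j \<and> j < int (partial_sum (n # t) (Suc i))) \<longleftrightarrow>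
      (\<exists>i\<in>{1..length (n # t)}. P i \<and> int (partial_sum (n # t) (i - 1)) \<le> j \<and> j < int (partial_sum (n # t) i))"
    (is "?p \<or> ?q \<longleftrightarrow> ?r")
  proof
    assume "?p \<or> ?q"
    then show ?r
    proof
      assume ?p
      then show ?r by (intro bexI[of _ 1]) (auto simp: partial_sum_Cons partial_sum_Cons[of n t 0, simplified])
    next
      assume ?q
      then obtain i where "i \<in> {1..length t}" "P (Suc i)" "int (partial_sum (n # t) i) \<le> j"
        "j < int (partial_sum (n # t) (Suc i))" by blast
      then show ?r by (intro bexI[of _ "Suc i"]) auto
    qed
  next
    assume ?r
    then obtain i where i: "i \<in> {1..length (n # t)}" "P i" "int (partial_sum (n # t) (i - 1)) \<le> j"
      "j < int (partial_sum (n # t) i)" by blast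
    then obtain k where k: "i = Suc k" by (cases i) auto
    show "?p \<or> ?q"
    proof (cases "k = 0")
      case True
      then show ?thesis using i k partial_sum_Cons[of n t 0] by simp
    next
      case False
      then show ?thesis using i k by (intro disjI2 bexI[of _ k]) auto
    qed
  qed
  finally show ?case .
qed simp

lemma finite_seg [simp]: "finite (seg P t)"
  by (induction t arbitrary: P) auto

lemma seg_subset: "seg P t \<subseteq> {0..<int (sum_list t)}"
proof (induction t arbitrary: P)
  case (Cons n t)
  have "(\<lambda>j. int n + j) ` seg (\<lambda>i. P (Suc i)) t \<subseteq> (\<lambda>j. int n + j) ` {0..<int (sum_list t)}"
    by (rule image_mono) (rule Cons)
  also have "\<dots> = {int n..<int n + int (sum_list t)}" by (simp add: image_add_atLeastLessThan add.commute)
  finally show ?case by (cases "P 1") fastforce+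
qed simp

text \<open>Source of the fact that the dents of the two halves together fill the base outside the
  gap.\<close>

lemma seg_complement:
  "seg P t \<union> seg (\<lambda>i. \<not> P i) t = {0..<int (sum_list t)} \<and> seg P t \<inter> seg (\<lambda>i. \<not> P i) t = {}"
proof (induction t arbitrary: P)
  case (Cons n t)
  let ?f = "\<lambda>j. int n + j"
  let ?A = "?f ` seg (\<lambda>i. P (Suc i)) t" and ?B = "?f ` seg (\<lambda>i. \<not> P (Suc i)) t"
  have AB: "?A \<union> ?B = {int n..<int n + int (sum_list t)}"
    unfolding image_Un[symmetric] Cons[THEN conjunct1] by (simp add: image_add_atLeastLessThan add.commute)
  have "?A \<inter> ?B = ?f ` (seg (\<lambda>i. P (Suc i)) t \<inter> seg (\<lambda>i. \<not> P (Suc i)) t)"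
    by (rule image_Int[symmetric]) (simp add: inj_on_def)
  then have AB0: "?A \<inter> ?B = {}" unfolding Cons[THEN conjunct2] by simp
  have AB': "?A \<union> ?B \<subseteq> {int n..}" unfolding AB by auto
  have "{0..<int n} \<inter> {int n..} = {}" by auto
  then have d: "{0..<int n} \<inter> ?A = {}" "{0..<int n} \<inter> ?B = {}" using AB' by blast+
  have u: "{0..<int n} \<union> {int n..<int n + int (sum_list t)} = {0..<int (sum_list (n # t))}" by auto
  have s1: "(X \<union> A) \<union> ({} \<union> B) = X \<union> (A \<union> B)" "({} \<union> A) \<union> (X \<union> B) = X \<union> (A \<union> B)" for X A B :: "int set"
    by auto
  have s2: "(X \<union> A) \<inter> ({} \<union> B) = {}" "({} \<union> A) \<inter> (X \<union> B) = {}"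
    if "X \<inter> A = {}" "X \<inter> B = {}" "A \<inter> B = {}" for X A B :: "int set"
    using that by auto
  have T: "seg P (n # t) = {0..<int n} \<union> ?A" "seg (\<lambda>i. \<not> P i) (n # t) = {} \<union> ?B" if "P 1"
    using that by simp_all
  have F: "seg P (n # t) = {} \<union> ?A" "seg (\<lambda>i. \<not> P i) (n # t) = {0..<int n} \<union> ?B" if "\<not> P 1"
    using that by simp_all
  show ?case
  proof (cases "P 1")
    case True
    show ?thesis unfolding T[OF True] s1 AB u by (intro conjI refl s2[OF d AB0])
  next
    case False
    show ?thesis unfolding F[OF False] s1 AB u by (intro conjI refl s2[OF d AB0])
  qed
qed simp

lemma card_seg: "card (seg P t) = (\<Sum>i | i \<in> {1..length t} \<and> P i. entry t i)"
proof (induction t arbitrary: P)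
  case (Cons n t)
  have "seg (\<lambda>i. P (Suc i)) t \<subseteq> {0..}" using seg_subset by force
  then have "{0..<int n} \<inter> (\<lambda>j. int n + j) ` seg (\<lambda>i. P (Suc i)) t = {}" by force
  then have "card (seg P (n # t)) = (if P 1 then n else 0) + card (seg (\<lambda>i. P (Suc i)) t)"
    by (simp add: card_Un_disjoint card_image inj_on_def)
  also have "card (seg (\<lambda>i. P (Suc i)) t) = (\<Sum>i | i \<in> {1..length t} \<and> P (Suc i). entry (n # t) (Suc i))"
    unfolding Cons by (rule sum.cong) (auto simp: entry_Cons)
  also have "\<dots> = (\<Sum>i\<in>Suc ` {i. i \<in> {1..length t} \<and> P (Suc i)}. entry (n # t) i)"
    by (simp add: sum.reindex)
  also have "(if P 1 then n else 0) + \<dots> = (\<Sum>i | i \<in> {1..length (n # t)} \<and> P i. entry (n # t) i)"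
  proof -
    have "{i. i \<in> {1..length (n # t)} \<and> P i} =
        (if P 1 then {1} else {}) \<union> Suc ` {i. i \<in> {1..length t} \<and> P (Suc i)}" (is "?A = ?B")
    proof (rule Set.set_eqI)
      fix i show "i \<in> ?A \<longleftrightarrow> i \<in> ?B"
        by (cases i; cases "i = 1") (auto simp: image_iff)
    qed
    moreover have "entry (n # t) 1 = n" by (simp add: entry_def)
    ultimately show ?thesis by (cases "P 1") (simp_all, subst sum.insert, auto)
  qed
  finally show ?case .
qed simp

lemma seg_append:
  "seg P (s @ t) = seg P s \<union> (\<lambda>j. int (sum_list s) + j) ` seg (\<lambda>i. P (i + length s)) t"
  by (induction s arbitrary: P) (simp_all add: image_Un image_image Un_assoc add.assoc)

lemma seg_rev:
  "seg P (rev t) = (\<lambda>j. int (sum_list t) - 1 - j) ` seg (\<lambda>i. P (length t + 1 - i)) t"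
proof (induction t arbitrary: P)
  case (Cons n t)
  let ?s = "int (sum_list t)" and ?S = "seg (\<lambda>i. P (length t + 1 - i)) t"
  have a: "(\<lambda>j. ?s + j) ` (if P (Suc (length t)) then {0..<int n} else {}) =
      (\<lambda>j. ?s + int n - 1 - j) ` (if P (Suc (length t)) then {0..<int n} else {})"
  proof -
    have "(\<lambda>j. ?s + j) ` {0..<int n} = (\<lambda>j. ?s + int n - 1 - j) ` {0..<int n}"
    proof (rule Set.set_eqI)
      fix u
      have "u \<in> (\<lambda>j. ?s + j) ` {0..<int n} \<longleftrightarrow> ?s \<le> u \<and> u < ?s + int n"
        by (auto simp: image_iff intro: bexI[of _ "u - ?s"])
      moreover have "u \<in> (\<lambda>j. ?s + int n - 1 - j) ` {0..<int n} \<longleftrightarrow> ?s \<le> u \<and> u < ?s + int n"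
        by (auto simp: image_iff intro: bexI[of _ "?s + int n - 1 - u"])
      ultimately show "u \<in> (\<lambda>j. ?s + j) ` {0..<int n} \<longleftrightarrow> u \<in> (\<lambda>j. ?s + int n - 1 - j) ` {0..<int n}" by simp
    qed
    then show ?thesis by simp
  qed
  have b: "(\<lambda>j. ?s + int n - 1 - j) ` (\<lambda>j. int n + j) ` ?S = (\<lambda>j. ?s - 1 - j) ` ?S"
    unfolding image_image by (intro image_cong refl) simp
  have "seg P (rev (n # t)) = (\<lambda>j. ?s - 1 - j) ` ?S \<union> (\<lambda>j. ?s + j) ` (if P (Suc (length t)) then {0..<int n} else {})"
    by (simp add: seg_append Cons)
  also have "\<dots> = (\<lambda>j. ?s + int n - 1 - j) ` ((if P (Suc (length t)) then {0..<int n} else {}) \<union> (\<lambda>j. int n + j) ` ?S)"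
    unfolding image_Un a b by (rule Un_commute)
  finally show ?case by (simp add: add.commute add_diff_eq)
qed simp

lemma seg_cong: "(\<And>i. 1 \<le> i \<Longrightarrow> i \<le> length t \<Longrightarrow> P i \<longleftrightarrow> Q i) \<Longrightarrow> seg P t = seg Q t"
  by (intro Set.set_eqI) (auto simp: mem_seg)

lemma partial_sum_length: "length t \<le> n \<Longrightarrow> partial_sum t n = sum_list t"
proof (induction t arbitrary: n)
  case Nil
  then show ?case by (simp add: partial_sum_def entry_def)
next
  case (Cons k t)
  then show ?case by (cases n) (auto simp: partial_sum_Cons)
qed

declare upt_Suc [simp del]

lemma entry_prefix:
  "entry (map (entry t) [1..<Suc n]) i = (if i \<le> n then entry t i else 0)"
  by (auto simp: entry_def)

lemma partial_sum_prefix: "i \<le> n \<Longrightarrow> partial_sum (map (entry t) [1..<Suc n]) i = partial_sum t i"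
  unfolding partial_sum_def by (rule sum.cong[OF refl], subst entry_prefix) simp

lemma sum_list_prefix: "sum_list (map (entry t) [1..<Suc n]) = partial_sum t n"
  using partial_sum_length[of "map (entry t) [1..<Suc n]" n] partial_sum_prefix[of n n t] by simp

text \<open>The list may be cut off or padded with zeros: no index beyond \<open>n\<close> is
  selected, and indices beyond the length give empty segments.\<close>

lemma seg_prefix:
  assumes "\<And>i. i \<le> length t \<Longrightarrow> P i \<Longrightarrow> i \<le> n"
  shows "seg P (map (entry t) [1..<Suc n]) = seg P t"
proof (rule Set.set_eqI)
  fix j
  let ?t = "map (entry t) [1..<Suc n]"
  show "j \<in> seg P ?t \<longleftrightarrow> j \<in> seg P t"
  proof
    assume "j \<in> seg P ?t"
    then obtain i where i0: "i \<in> {1..length ?t}" "P i" "int (partial_sum ?t (i - 1)) \<le> j" "j < int (partial_sum ?t i)"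
      unfolding mem_seg by blast
    then have le: "i \<le> n" by simp
    note le = le le_trans[OF diff_le_self le, of 1]
    have i: "int (partial_sum t (i - 1)) \<le> j" "j < int (partial_sum t i)"
      using i0(3,4) unfolding partial_sum_prefix[OF le(1)] partial_sum_prefix[OF le(2)] by simp_all
    have "i \<le> length t"
    proof (rule ccontr)
      assume "\<not> i \<le> length t"
      then have "partial_sum t (i - 1) = partial_sum t i" by (simp add: partial_sum_length)
      then show False using i by simp
    qed
    then show "j \<in> seg P t" unfolding mem_seg using i i0(1,2) by (intro bexI[of _ i]) auto
  next
    assume "j \<in> seg P t"
    then obtain i where i: "i \<in> {1..length t}" "P i" "int (partial_sum t (i - 1)) \<le> j" "j < int (partial_sum t i)"
      unfolding mem_seg by blast
    then have le: "i \<le> n" using assms[of i] by simp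
    note le = le le_trans[OF diff_le_self le, of 1]
    have "i \<in> {1..length ?t}" using i(1) le by simp
    moreover have "int (partial_sum ?t (i - 1)) \<le> j" "j < int (partial_sum ?t i)"
      unfolding partial_sum_prefix[OF le(1)] partial_sum_prefix[OF le(2)] by (fact i)+
    ultimately show "j \<in> seg P ?t" unfolding mem_seg using i(2) by (intro bexI[of _ i]) auto
  qed
qed

section \<open>The two ferns on a common base\<close>

definition flip :: "int \<Rightarrow> int set \<Rightarrow> int set" where
  "flip L X = (\<lambda>j. L - 1 - j) ` X"

text \<open>The segments of the two ferns with indices in \<open>P\<close>.\<close>

definition fern :: "(nat \<Rightarrow> bool) \<Rightarrow> int \<Rightarrow> nat list \<Rightarrow> nat list \<Rightarrow> int set" where
  "fern P L as bs = seg P as \<union> flip L (seg P bs)"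

text \<open>The right fern is indexed from the east, so it enters the list reversed;
  \<open>sym\<close> says that the selection respects this renumbering, and \<open>mid\<close> that
  the middle entry, which contains the gap, is not selected.\<close>

lemma seg_two_ferns:
  fixes P P' :: "nat \<Rightarrow> bool"
  assumes a: "\<And>i. i \<le> length as \<Longrightarrow> P i \<Longrightarrow> i \<le> p" and b: "\<And>i. i \<le> length bs \<Longrightarrow> P i \<Longrightarrow> i \<le> q"
    and mid: "\<not> P (Suc p)" and sym: "\<And>i. 1 \<le> i \<Longrightarrow> i \<le> q \<Longrightarrow> P (q + 1 - i + p + 1) \<longleftrightarrow> P i"
    and tail: "partial_sum as p + c + partial_sum bs q = L"
  shows "seg P (map (entry as) [1..<Suc p] @ [c] @ rev (map (entry bs) [1..<Suc q])) = fern P (int L) as bs"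
proof -
  let ?A = "map (entry as) [1..<Suc p]" and ?B = "map (entry bs) [1..<Suc q]"
  have lens: "length ?A = p" "length ?B = q" by simp_all
  have "seg (\<lambda>i. P (i + p + 1)) (rev ?B) = (\<lambda>j. int (partial_sum bs q) - 1 - j) ` seg (\<lambda>i. P (q + 1 - i + p + 1)) ?B"
    by (simp only: seg_rev sum_list_prefix lens)
  also have "seg (\<lambda>i. P (q + 1 - i + p + 1)) ?B = seg P ?B"
    by (intro seg_cong sym) (simp_all only: lens)
  also have "\<dots> = seg P bs" using b by (rule seg_prefix)
  finally have B: "seg (\<lambda>i. P (i + p + 1)) (rev ?B) = (\<lambda>j. int (partial_sum bs q) - 1 - j) ` seg P bs" .
  have "seg P (?A @ [c] @ rev ?B) = seg P ?A \<union> (\<lambda>j. int (sum_list ?A) + j) `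
      (seg (\<lambda>i. P (i + p)) [c] \<union> (\<lambda>j. int c + j) ` seg (\<lambda>i. P (i + p + 1)) (rev ?B))"
    by (simp add: seg_append lens)
  also have "seg (\<lambda>i. P (i + p)) [c] = {}" using mid by simp
  also have "seg P ?A = seg P as" using a by (rule seg_prefix)
  also have "(\<lambda>j. int (sum_list ?A) + j) ` ({} \<union> (\<lambda>j. int c + j) ` seg (\<lambda>i. P (i + p + 1)) (rev ?B)) =
      flip (int L) (seg P bs)"
    unfolding B flip_def sum_list_prefix Un_empty_left image_image tail[symmetric]
    by (intro image_cong refl) simp
  finally show ?thesis unfolding fern_def .
qed

lemma dents_eq_seg: "{j. \<exists>i\<in>{1..length t div 2}. int (partial_sum t (2 * i - 1)) \<le> j \<and>
    j < int (partial_sum t (2 * i - 1) + entry t (2 * i))} = seg even t"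
proof (rule Set.set_eqI)
  fix j
  have ps: "partial_sum t (2 * i - 1) + entry t (2 * i) = partial_sum t (2 * i)" if "1 \<le> i" for i
    using partial_sum_Suc[of t "2 * i - 1"] that by simp
  show "j \<in> {j. \<exists>i\<in>{1..length t div 2}. int (partial_sum t (2 * i - 1)) \<le> j \<and>
    j < int (partial_sum t (2 * i - 1) + entry t (2 * i))} \<longleftrightarrow> j \<in> seg even t"
  proof
    assume "j \<in> {j. \<exists>i\<in>{1..length t div 2}. int (partial_sum t (2 * i - 1)) \<le> j \<and>
      j < int (partial_sum t (2 * i - 1) + entry t (2 * i))}"
    then obtain i where i: "i \<in> {1..length t div 2}" "int (partial_sum t (2 * i - 1)) \<le> j"
      "j < int (partial_sum t (2 * i - 1) + entry t (2 * i))" by blast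
    have "2 * i \<in> {1..length t}" using i(1) by auto
    moreover have "j < int (partial_sum t (2 * i))" using i(3) ps[of i] i(1) by (simp only: atLeastAtMost_iff)
    ultimately show "j \<in> seg even t" unfolding mem_seg by (intro bexI[of _ "2 * i"] conjI i(2)) simp_all
  next
    assume "j \<in> seg even t"
    then obtain k where k: "k \<in> {1..length t}" "even k" "int (partial_sum t (k - 1)) \<le> j" "j < int (partial_sum t k)"
      unfolding mem_seg by blast
    obtain i where ki: "k = 2 * i" using k(2) by (elim evenE)
    have i: "i \<in> {1..length t div 2}" using k(1) unfolding ki by auto
    then have "1 \<le> i" by simp
    show "j \<in> {j. \<exists>i\<in>{1..length t div 2}. int (partial_sum t (2 * i - 1)) \<le> j \<and>
      j < int (partial_sum t (2 * i - 1) + entry t (2 * i))}"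
      by (intro CollectI bexI[of _ i] conjI i) (use k(3,4) in \<open>simp_all only: ki ps[OF \<open>1 \<le> i\<close>]\<close>)
  qed
qed

lemma sum_odd_even: "odd_sum t + even_sum t = sum_list t"
proof -
  have "(\<Sum>i\<in>{1..length t}. entry t i) =
      (\<Sum>i\<in>{i \<in> {1..length t}. odd i} \<union> {i \<in> {1..length t}. even i}. entry t i)"
    by (rule sum.cong) auto
  also have "\<dots> = odd_sum t + even_sum t"
    unfolding odd_sum_def even_sum_def by (rule sum.union_disjoint) auto
  finally have "partial_sum t (length t) = odd_sum t + even_sum t" unfolding partial_sum_def .
  then show ?thesis by (simp add: partial_sum_length)
qed

text \<open>\<open>p\<close> and \<open>q\<close> are \<open>\<mu> - 1\<close> and
  \<open>\<nu> - 1\<close>, both odd. The leading zero shifts the indices by one, so the holes at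
  even places are the fern segments of odd index.\<close>

lemma t_plus_facts:
  fixes x y :: nat and as bs :: "nat list"
  defines "L \<equiv> x + y + sum_list as + sum_list bs"
  shows "seg even (t_plus x y as bs) = fern odd (int L) as bs" "sum_list (t_plus x y as bs) = L"
proof -
  define p where "p = 2 * ((seq_length as + 1) div 2) - 1"
  define q where "q = 2 * ((seq_length bs + 1) div 2) - 1"
  have len: "1 \<le> seq_length as" "1 \<le> seq_length bs" "length as \<le> seq_length as" "length bs \<le> seq_length bs"
    by (auto simp: seq_length_def Suc_le_eq)
  have fl: "nat \<lfloor>(real n + 1) / 2\<rfloor> = (n + 1) div 2" for n :: nat
  proof -
    have "\<lfloor>real (n + 1) / real 2\<rfloor> = int ((n + 1) div 2)" by (rule floor_divide_of_nat_eq)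
    then show ?thesis by (simp add: add.commute)
  qed
  have sp: "Suc p = 2 * ((seq_length as + 1) div 2)" "Suc q = 2 * ((seq_length bs + 1) div 2)"
    using len unfolding p_def q_def by auto
  let ?c = "entry as (Suc p) + x + y + entry bs (Suc q)"
  let ?t = "map (entry as) [1..<Suc p] @ [?c] @ rev (map (entry bs) [1..<Suc q])"
  have t: "t_plus x y as bs = 0 # ?t"
    unfolding t_plus_def Let_def fl sp by simp
  have ple: "seq_length as \<le> Suc p" "seq_length bs \<le> Suc q" unfolding sp by auto
  have "partial_sum as (Suc p) = sum_list as" "partial_sum bs (Suc q) = sum_list bs"
    using ple len by (intro partial_sum_length; simp)+
  then have tail: "partial_sum as p + ?c + partial_sum bs q = L"
    unfolding L_def by (simp add: partial_sum_Suc)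
  have pq: "odd p" "odd q" using sp by presburger+
  have "seg odd ?t = fern odd (int L) as bs"
  proof (rule seg_two_ferns[OF _ _ _ _ tail])
    show "i \<le> p" if "i \<le> length as" "odd i" for i
      using that le_trans[OF le_trans[OF that(1) len(3)] ple(1)] pq by (metis even_Suc le_SucE)
    show "i \<le> q" if "i \<le> length bs" "odd i" for i
      using that le_trans[OF le_trans[OF that(1) len(4)] ple(2)] pq by (metis even_Suc le_SucE)
    show "odd (q + 1 - i + p + 1) \<longleftrightarrow> odd i" if "1 \<le> i" "i \<le> q" for i using that pq by presburger
  qed (use pq in simp)
  moreover have "seg P (0 # s) = seg (\<lambda>i. P (Suc i)) s" for P s by simp
  moreover have "(\<lambda>i. even (Suc i)) = odd" by (rule ext) simp
  ultimately show "seg even (t_plus x y as bs) = fern odd (int L) as bs" unfolding t by (simp only:)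
  show "sum_list (t_plus x y as bs) = L"
    unfolding t using tail sum_list_prefix[of as p] sum_list_prefix[of bs q] by (simp del: upt_Suc)
qed

text \<open>\<open>p\<close> and \<open>q\<close> are \<open>\<mu>'\<close> and
  \<open>\<nu>'\<close>, both even, so parities agree without a shift; the final \<open>z\<close>
  sits at an even place and adds the segment beyond \<open>L\<close>.\<close>

lemma t_minus_facts:
  fixes x y z :: nat and as bs :: "nat list"
  defines "L \<equiv> x + y + sum_list as + sum_list bs"
  shows "seg even (t_minus x y z as bs) = fern even (int L) as bs \<union> {int L..<int (L + z)}"
    "sum_list (t_minus x y z as bs) = L + z"
proof -
  define p where "p = 2 * (seq_length as div 2)"
  define q where "q = 2 * (seq_length bs div 2)"
  have len: "length as \<le> seq_length as" "length bs \<le> seq_length bs" "1 \<le> seq_length as" "1 \<le> seq_length bs"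
    by (auto simp: seq_length_def Suc_le_eq)
  have cl: "nat \<lceil>(real n - 1) / 2\<rceil> = n div 2" if "1 \<le> n" for n :: nat
  proof (cases "even n")
    case True
    then obtain k where k: "n = 2 * k" by (elim evenE)
    have "\<lceil>(real n - 1) / 2\<rceil> = int k" by (rule ceiling_unique) (simp_all add: k)
    then show ?thesis by (simp add: k)
  next
    case False
    then obtain k where k: "n = 2 * k + 1" by (elim oddE)
    then show ?thesis by simp
  qed
  let ?c = "entry as (Suc p) + x + y + entry bs (Suc q)"
  let ?t = "map (entry as) [1..<Suc p] @ [?c] @ rev (map (entry bs) [1..<Suc q])"
  have t: "t_minus x y z as bs = ?t @ [z]"
    unfolding t_minus_def Let_def cl[OF len(3)] cl[OF len(4)] p_def q_def by simp
  have ple: "seq_length as \<le> Suc p" "seq_length bs \<le> Suc q" unfolding p_def q_def by auto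
  have "partial_sum as (Suc p) = sum_list as" "partial_sum bs (Suc q) = sum_list bs"
    using ple len by (intro partial_sum_length; simp)+
  then have tail: "partial_sum as p + ?c + partial_sum bs q = L"
    unfolding L_def by (simp add: partial_sum_Suc)
  have pq: "even p" "even q" unfolding p_def q_def by simp_all
  have s: "seg even ?t = fern even (int L) as bs"
  proof (rule seg_two_ferns[OF _ _ _ _ tail])
    show "i \<le> p" if "i \<le> length as" "even i" for i using that ple len pq by presburger
    show "i \<le> q" if "i \<le> length bs" "even i" for i using that ple len pq by presburger
    show "even (q + 1 - i + p + 1) \<longleftrightarrow> even i" if "1 \<le> i" "i \<le> q" for i using that pq by presburger
  qed (use pq in simp)
  have sl: "sum_list ?t = L"
    using tail sum_list_prefix[of as p] sum_list_prefix[of bs q] by (simp del: upt_Suc)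
  have "even (1 + length ?t)" using pq by simp
  then have "seg (\<lambda>i. even (i + length ?t)) [z] = {0..<int z}" by (simp only: seg.simps if_True) simp
  moreover have "(\<lambda>j. int L + j) ` {0..<int z} = {int L..<int (L + z)}"
    by (simp add: image_add_atLeastLessThan add.commute)
  ultimately show "seg even (t_minus x y z as bs) = fern even (int L) as bs \<union> {int L..<int (L + z)}"
    unfolding t seg_append[of even ?t] s sl by (simp only:)
  show "sum_list (t_minus x y z as bs) = L + z" unfolding t using sl by simp
qed

section \<open>Cutting along the line \<open>k = 0\<close>\<close>

lemma dents_eq: "dents t = seg even t"
  unfolding dents_def by (rule dents_eq_seg)

lemma K_eq_seg: "K t = dent_count (2 * even_sum t - 1) 0 (seg even t)"
  and Q'_eq_seg: "Q' t = dent_count (2 * even_sum t) 0 (seg even t)"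
proof -
  have 1: "dents t \<subseteq> {0..<int (odd_sum t + even_sum t)}"
    unfolding dents_eq sum_odd_even by (rule seg_subset)
  have 2: "card (dents t) = even_sum t" unfolding dents_eq card_seg even_sum_def ..
  show "K t = dent_count (2 * even_sum t - 1) 0 (seg even t)"
    "Q' t = dent_count (2 * even_sum t) 0 (seg even t)"
    using K_eq[OF 1 2] Q'_eq[OF 1 2] unfolding dents_eq by simp_all
qed

lemma mem_flip: "j \<in> flip L X \<longleftrightarrow> L - 1 - j \<in> X"
  by (auto simp: flip_def image_iff intro: bexI[of _ "L - 1 - j"])

lemma card_flip: "card (flip L X) = card X"
  unfolding flip_def by (rule card_image) (simp add: inj_on_def)

lemma fern_parts:
  assumes "a = sum_list as" "b = sum_list bs" "a + b \<le> L"
  shows "seg P as \<subseteq> {0..<int a}" "flip (int L) (seg P bs) \<subseteq> {int (L - b)..<int L}"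
    "finite (fern P (int L) as bs)" "fern P (int L) as bs \<subseteq> {0..<int L}"
    "card (fern P (int L) as bs) = card (seg P as) + card (seg P bs)"
    "fern P (int L) as bs \<union> fern (\<lambda>i. \<not> P i) (int L) as bs = {0..<int a} \<union> {int (L - b)..<int L}"
    "fern P (int L) as bs \<inter> fern (\<lambda>i. \<not> P i) (int L) as bs = {}"
proof -
  have A: "seg R as \<subseteq> {0..<int a}" for R using seg_subset[of R as] assms(1) by simp
  have B: "flip (int L) (seg R bs) \<subseteq> {int (L - b)..<int L}" for R
  proof
    fix j assume "j \<in> flip (int L) (seg R bs)"
    then have "int L - 1 - j \<in> {0..<int b}" unfolding mem_flip using seg_subset[of R bs] assms(2) by blast
    then show "j \<in> {int (L - b)..<int L}" using assms(3) by auto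
  qed
  show "seg P as \<subseteq> {0..<int a}" "flip (int L) (seg P bs) \<subseteq> {int (L - b)..<int L}" by (rule A, rule B)
  have fin: "finite (flip (int L) (seg R bs))" for R unfolding flip_def by simp
  show "finite (fern P (int L) as bs)" unfolding fern_def using fin by simp
  show "fern P (int L) as bs \<subseteq> {0..<int L}"
    unfolding fern_def using A[of P] B[of P] assms(3) by fastforce
  have dis: "{0..<int a} \<inter> {int (L - b)..<int L} = {}" using assms(3) by auto
  have d: "seg R as \<inter> flip (int L) (seg R' bs) = {}" for R R' using A[of R] B[of R'] dis by blast
  show "card (fern P (int L) as bs) = card (seg P as) + card (seg P bs)"
    unfolding fern_def by (subst card_Un_disjoint) (simp_all add: d fin card_flip)
  have fU: "flip (int L) (seg P bs) \<union> flip (int L) (seg (\<lambda>i. \<not> P i) bs) = {int (L - b)..<int L}"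
  proof -
    have "flip (int L) (seg P bs) \<union> flip (int L) (seg (\<lambda>i. \<not> P i) bs) = flip (int L) {0..<int b}"
      unfolding flip_def image_Un[symmetric] seg_complement[THEN conjunct1] assms(2) ..
    also have "\<dots> = {int (L - b)..<int L}" using assms(3) by (auto simp: mem_flip)
    finally show ?thesis .
  qed
  have fI: "flip (int L) (seg P bs) \<inter> flip (int L) (seg (\<lambda>i. \<not> P i) bs) = {}"
    using seg_complement[THEN conjunct2, of P bs] by (auto simp: mem_flip)
  have sU: "seg P as \<union> seg (\<lambda>i. \<not> P i) as = {0..<int a}" and sI: "seg P as \<inter> seg (\<lambda>i. \<not> P i) as = {}"
    using seg_complement[of P as] assms(1) by simp_all
  show "fern P (int L) as bs \<union> fern (\<lambda>i. \<not> P i) (int L) as bs = {0..<int a} \<union> {int (L - b)..<int L}"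
    unfolding fern_def sU[symmetric] fU[symmetric] by (simp only: Un_ac)
  show "fern P (int L) as bs \<inter> fern (\<lambda>i. \<not> P i) (int L) as bs = {}"
    unfolding fern_def using sI fI d[of P "\<lambda>i. \<not> P i"] d[of "\<lambda>i. \<not> P i" P] by blast
qed

lemma card_seg_odd_even: "card (seg odd t) = odd_sum t" "card (seg even t) = even_sum t"
  unfolding card_seg odd_sum_def even_sum_def by simp_all

text \<open>All holes are written as up-pointing: \<open>odd\<close> serves the upper half,
  \<open>even\<close> the reflected lower half. For \<open>odd\<close> this includes the triangle
  over the first segment of the left fern, which the half hole contains.\<close>

definition fern_holes :: "(nat \<Rightarrow> bool) \<Rightarrow> nat \<Rightarrow> nat list \<Rightarrow> nat list \<Rightarrow> region" where
  "fern_holes P L as bs =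
    \<Union> ((\<lambda>i. up_hole (partial_sum as (i - 1)) (entry as i)) ` {i \<in> {1..length as}. P i} \<union>
       (\<lambda>j. up_hole (L - partial_sum bs j) (entry bs j)) ` {j \<in> {1..length bs}. P j})"

lemma partial_sum_le: "partial_sum t i \<le> sum_list t"
proof (cases "i \<le> length t")
  case True
  have "partial_sum t i \<le> partial_sum t (length t)"
    unfolding partial_sum_def by (rule sum_mono2) (use True in auto)
  then show ?thesis by (simp add: partial_sum_length)
qed (simp add: partial_sum_length)

lemma partial_sum_step: "1 \<le> i \<Longrightarrow> partial_sum t i = partial_sum t (i - 1) + entry t i"
  using partial_sum_Suc[of t "i - 1"] by simp

lemma fern_holes_base:
  assumes "sum_list as + sum_list bs \<le> L"
  shows "Up j 0 \<in> fern_holes P L as bs \<longleftrightarrow> j \<in> fern P (int L) as bs"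
proof -
  have "(\<exists>i\<in>{i \<in> {1..length as}. P i}. Up j 0 \<in> up_hole (partial_sum as (i - 1)) (entry as i)) \<longleftrightarrow> j \<in> seg P as"
  proof -
    have "Up j 0 \<in> up_hole (partial_sum as (i - 1)) (entry as i) \<longleftrightarrow>
        int (partial_sum as (i - 1)) \<le> j \<and> j < int (partial_sum as i)" if "1 \<le> i" for i
      unfolding in_up_hole using partial_sum_step[OF that, of as] by auto
    then show ?thesis unfolding mem_seg by auto
  qed
  moreover have "(\<exists>i\<in>{i \<in> {1..length bs}. P i}. Up j 0 \<in> up_hole (L - partial_sum bs i) (entry bs i)) \<longleftrightarrow>
      j \<in> flip (int L) (seg P bs)"
  proof -
    have "Up j 0 \<in> up_hole (L - partial_sum bs i) (entry bs i) \<longleftrightarrow>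
        int (partial_sum bs (i - 1)) \<le> int L - 1 - j \<and> int L - 1 - j < int (partial_sum bs i)" if "1 \<le> i" for i
      unfolding in_up_hole using partial_sum_step[OF that, of bs] partial_sum_le[of bs i] assms by auto
    then show ?thesis unfolding mem_flip mem_seg by auto
  qed
  ultimately show ?thesis unfolding fern_holes_def fern_def Union_iff by (simp only: Un_iff bex_Un image_iff bex_simps)
qed

lemma entry_le_sums:
  assumes "i \<in> {1..length t}"
  shows "odd i \<Longrightarrow> entry t i \<le> odd_sum t" "even i \<Longrightarrow> entry t i \<le> even_sum t"
  unfolding odd_sum_def even_sum_def by (rule member_le_sum, use assms in auto)+

lemma hole_in_fern_holes:
  assumes "\<delta> = 0 \<or> \<delta> = 1"
    and "\<And>i. i \<in> {1..length as} \<Longrightarrow> P i \<Longrightarrow> int (entry as i) \<le> hi"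
    and "\<And>i. i \<in> {1..length bs} \<Longrightarrow> P i \<Longrightarrow> int (entry bs i) \<le> hi"
  shows "hole_in (trap \<delta> 0 hi W) (fern_holes P L as bs)"
  unfolding fern_holes_def
proof (rule hole_in_Union)
  fix R assume "R \<in> (\<lambda>i. up_hole (partial_sum as (i - 1)) (entry as i)) ` {i \<in> {1..length as}. P i} \<union>
       (\<lambda>j. up_hole (L - partial_sum bs j) (entry bs j)) ` {j \<in> {1..length bs}. P j}"
  then obtain c s where R: "R = up_hole c s" and s: "int s \<le> hi" using assms(2,3) by (elim UnE imageE) auto
  show "hole_in (trap \<delta> 0 hi W) R" unfolding R by (rule hole_in_up_hole[OF assms(1) s])
qed

lemma hole_in_Un: "hole_in R P \<Longrightarrow> hole_in R Q \<Longrightarrow> hole_in R (P \<union> Q)"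
  using hole_in_Union[of "{P, Q}" R] by auto

fun row_of :: "triangle \<Rightarrow> int" where
  "row_of (Up j k) = k"
| "row_of (Down j k) = k"

lemma row_of_mirror [simp]: "row_of (mirror t) = - row_of t - 1" by (cases t) auto

lemma row_of_trap: "t \<in> trap \<delta> 0 hi W \<Longrightarrow> 0 \<le> row_of t" by (cases t) auto

lemma row_of_up_hole: "t \<in> up_hole c s \<Longrightarrow> 0 \<le> row_of t" by (cases t) (auto simp: in_up_hole)

lemma row_of_fern_holes: "t \<in> fern_holes P L as bs \<Longrightarrow> 0 \<le> row_of t"
  unfolding fern_holes_def using row_of_up_hole by (elim UnionE UnE imageE) auto

lemma row_of_half_hole: "t \<in> N3_half_hole as \<Longrightarrow> 0 \<le> row_of t"
  by (cases t) (auto simp: in_half_hole)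

text \<open>Rows of non-negative and of negative height separate the halves, so each hole has to be
  removed from one half only.\<close>

lemma N3_eq:
  fixes x y z :: nat and as bs :: "nat list"
  defines "L \<equiv> N3_width x y as bs"
  shows "N3 x y z as bs =
    (trap 0 0 (N3_top y as bs) (int L) - (N3_half_hole as \<union> fern_holes odd L as bs)) \<union>
    mirror ` (trap 1 0 (N3_depth y z as bs) (int (L + z)) - (up_hole L z \<union> fern_holes even L as bs))"
proof -
  let ?Tu = "trap 0 0 (N3_top y as bs) (int L)" and ?Tl = "trap 1 0 (N3_depth y z as bs) (int (L + z))"
  let ?Fo = "fern_holes odd L as bs" and ?Fe = "fern_holes even L as bs"
  have up: "N3_upper x y as bs = ?Tu"
    unfolding N3_upper_def L_def by (rule triangles_in_trap) simp
  have lo: "N3_lower x y z as bs = mirror ` (?Tl - up_hole L z)"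
    unfolding L_def by (rule N3_lower_mirror)
  have ifh: "t \<in> (if even i then down_hole else up_hole) c s \<longleftrightarrow>
      (odd i \<and> t \<in> up_hole c s) \<or> (even i \<and> mirror t \<in> up_hole c s)" for t i c s
    by (simp add: down_hole_mirror mem_mirror_image)
  have first: "t \<in> N3_half_hole as" if "t \<in> up_hole (partial_sum as (1 - 1)) (entry as 1)" for t
    using that by (cases t) (auto simp: in_up_hole in_half_hole)
  have holes: "N3_half_hole as \<union> N3_a_holes as \<union> N3_b_holes L bs = N3_half_hole as \<union> ?Fo \<union> mirror ` ?Fe"
  proof (rule Set.set_eqI)
    fix t
    let ?ua = "\<lambda>t i. t \<in> up_hole (partial_sum as (i - 1)) (entry as i)"
    let ?ub = "\<lambda>t j. t \<in> up_hole (L - partial_sum bs j) (entry bs j)"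
    have F: "t \<in> fern_holes P L as bs \<longleftrightarrow> (\<exists>i\<in>{1..length as}. P i \<and> ?ua t i) \<or> (\<exists>j\<in>{1..length bs}. P j \<and> ?ub t j)" for P t
      unfolding fern_holes_def by auto
    have a: "t \<in> N3_a_holes as \<longleftrightarrow> (\<exists>i\<in>{2..length as}. (odd i \<and> ?ua t i) \<or> (even i \<and> ?ua (mirror t) i))"
      unfolding N3_a_holes_def UN_iff ifh ..
    have b: "t \<in> N3_b_holes L bs \<longleftrightarrow> (\<exists>j\<in>{1..length bs}. (odd j \<and> ?ub t j) \<or> (even j \<and> ?ub (mirror t) j))"
      unfolding N3_b_holes_def UN_iff ifh ..
    have o: "t \<in> N3_half_hole as \<or> (\<exists>i\<in>{1..length as}. odd i \<and> ?ua t i) \<longleftrightarrow>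
        t \<in> N3_half_hole as \<or> (\<exists>i\<in>{2..length as}. odd i \<and> ?ua t i)"
    proof -
      have "t \<in> N3_half_hole as \<or> i \<in> {2..length as}" if "i \<in> {1..length as}" "?ua t i" for i
        using that first[of t] by (cases "i = 1") auto
      moreover have "i \<in> {1..length as}" if "i \<in> {2..length as}" for i using that by simp
      moreover have aux: "h \<or> (\<exists>i\<in>I1. A i) \<longleftrightarrow> h \<or> (\<exists>i\<in>I2. A i)"
        if "\<And>i. i \<in> I1 \<Longrightarrow> A i \<Longrightarrow> h \<or> i \<in> I2" "\<And>i. i \<in> I2 \<Longrightarrow> i \<in> I1" for h A and I1 I2 :: "nat set"
        using that by blast
      ultimately show ?thesis by (intro aux) blast+
    qed
    have e: "(\<exists>i\<in>{1..length as}. even i \<and> ?ua (mirror t) i) \<longleftrightarrow> (\<exists>i\<in>{2..length as}. even i \<and> ?ua (mirror t) i)"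
    proof -
      have eq: "(i \<in> {1..length as} \<and> even i) \<longleftrightarrow> (i \<in> {2..length as} \<and> even i)" for i
        by (cases "i = 1") auto
      show ?thesis unfolding Bex_def conj_assoc[symmetric] eq ..
    qed
    show "t \<in> N3_half_hole as \<union> N3_a_holes as \<union> N3_b_holes L bs \<longleftrightarrow> t \<in> N3_half_hole as \<union> ?Fo \<union> mirror ` ?Fe"
    proof -
      have "(h \<or> (p2 \<or> q2)) \<or> (b1 \<or> b2) \<longleftrightarrow> (h \<or> (p1 \<or> b1)) \<or> (q1 \<or> b2)"
        if "h \<or> p1 \<longleftrightarrow> h \<or> p2" "q1 \<longleftrightarrow> q2" for h p1 p2 q1 q2 b1 b2
        using that by blast
      from this[OF o e] show ?thesis unfolding Un_iff mem_mirror_image F a b bex_disj_distrib .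
    qed
  qed
  have N: "N3 x y z as bs = (?Tu \<union> mirror ` (?Tl - up_hole L z)) - (N3_half_hole as \<union> ?Fo \<union> mirror ` ?Fe)"
    unfolding N3_def up lo L_def[symmetric] holes ..
  show ?thesis
  proof (rule Set.set_eqI)
    fix t
    show "t \<in> N3 x y z as bs \<longleftrightarrow> t \<in> (?Tu - (N3_half_hole as \<union> ?Fo)) \<union> mirror ` (?Tl - (up_hole L z \<union> ?Fe))"
    proof (cases "0 \<le> row_of t")
      case True
      then have "\<not> 0 \<le> row_of (mirror t)" by simp
      then have "mirror t \<notin> ?Tl" "mirror t \<notin> ?Fe" using row_of_trap row_of_fern_holes by blast+
      then show ?thesis unfolding N Un_iff Diff_iff mem_mirror_image by blast
    next
      case False
      then have "t \<notin> ?Tu" "t \<notin> ?Fo" "t \<notin> N3_half_hole as"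
        using row_of_trap row_of_fern_holes row_of_half_hole by blast+
      then show ?thesis unfolding N Un_iff Diff_iff mem_mirror_image by blast
    qed
  qed
qed

text \<open>\<open>J\<close> consists of the base positions that are free on both sides, the only
  places where a lozenge can cross the line.\<close>

lemma M_N3_cut:
  fixes x y z :: nat and as bs :: "nat list"
  defines "L \<equiv> N3_width x y as bs"
  defines "Tu \<equiv> trap 0 0 (N3_top y as bs) (int L)" and "Hu \<equiv> N3_half_hole as \<union> fern_holes odd L as bs"
    and "Tl \<equiv> trap 1 0 (N3_depth y z as bs) (int (L + z))" and "Hl \<equiv> up_hole L z \<union> fern_holes even L as bs"
  defines "J \<equiv> {j. Up j 0 \<in> Tu - Hu \<and> Up j 0 \<in> Tl - Hl}"
  shows "finite J" and "M_N3 x y z as bs = (\<Sum>S\<in>Pow J.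
    M axis_weight (Tu - Hu - (\<lambda>j. Up j 0) ` S) * M axis_weight (Tl - Hl - (\<lambda>j. Up j 0) ` S))"
proof -
  let ?w = "zigzag_weight (N3_west_zigzag y z as bs)"
  have fin: "finite Tu" "finite Tl" by (simp_all add: Tu_def Tl_def)
  have ru: "0 \<le> row_of t" if "t \<in> Tu" for t using row_of_trap that unfolding Tu_def .
  have rl: "0 \<le> row_of t" if "t \<in> Tl" for t using row_of_trap that unfolding Tl_def .
  have "(\<lambda>j. Up j 0) ` J \<subseteq> Tu" unfolding J_def by blast
  then show fJ: "finite J" using fin(1) by (rule finite_imageD[OF finite_subset]) (simp add: inj_on_def)
  \<comment> \<open>The upper western side of such a lozenge ends above the line, where the lower
    zigzag has no points. In particular the crossing lozenges have weight 1.\<close>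
  have w1: "?w {Up j k, Down j (k - 1)} = 1" if "0 \<le> k" for j k
  proof -
    have "(i, h + 1) \<notin> N3_west_zigzag y z as bs" if "{Up j k, Down j (k - 1)} = {Up i h, Down i (h - 1)}" for i h
    proof -
      have "h = k" using that by (auto simp: doubleton_eq_iff)
      then show ?thesis using \<open>0 \<le> k\<close> by (simp add: N3_west_zigzag_def height_def)
    qed
    then show ?thesis unfolding zigzag_weight_def by auto
  qed
  have "M_N3 x y z as bs = M ?w ((Tu - Hu) \<union> mirror ` (Tl - Hl))"
    unfolding M_N3_def N3_eq Tu_def Hu_def Tl_def Hl_def L_def ..
  also have "\<dots> = (\<Sum>S\<in>Pow J. (\<Prod>j\<in>S. ?w {Up j 0, Down j (- 1)}) *
      M ?w (Tu - Hu - (\<lambda>j. Up j 0) ` S) * M ?w (mirror ` (Tl - Hl) - (\<lambda>j. Down j (- 1)) ` S))"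
  proof (rule M_cut)
    show "finite (Tu - Hu)" "finite (mirror ` (Tl - Hl))" using fin by simp_all
    show "(Tu - Hu) \<inter> mirror ` (Tl - Hl) = {}"
    proof (rule equals0I)
      fix t assume "t \<in> (Tu - Hu) \<inter> mirror ` (Tl - Hl)"
      then have "t \<in> Tu" "mirror t \<in> Tl" unfolding Int_iff mem_mirror_image by simp_all
      then show False using ru[of t] rl[of "mirror t"] by simp
    qed
    show "inj_on (\<lambda>j. Up j 0) J" "inj_on (\<lambda>j. Down j (- 1)) J" by (simp_all add: inj_on_def)
    show "(\<lambda>j. Up j 0) ` J \<subseteq> Tu - Hu" unfolding J_def by blast
    show "(\<lambda>j. Down j (- 1)) ` J \<subseteq> mirror ` (Tl - Hl)"
    proof
      fix t assume "t \<in> (\<lambda>j. Down j (- 1)) ` J"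
      then obtain j where j: "j \<in> J" "t = Down j (- 1)" by blast
      have "mirror t = Up j 0" unfolding j(2) by simp
      then show "t \<in> mirror ` (Tl - Hl)" unfolding mem_mirror_image using j(1) by (simp add: J_def)
    qed
    show "lozenge {Up j 0, Down j (- 1)}" for j by (simp add: lozenge_iff)
    fix s t assume s: "s \<in> Tu - Hu" and t: "t \<in> mirror ` (Tl - Hl)" and st: "lozenge {s, t}"
    have t': "mirror t \<in> Tl - Hl" using t unfolding mem_mirror_image .
    have rs: "0 \<le> row_of s" using ru s by blast
    have rt: "row_of t < 0" using rl[of "mirror t"] t' by simp
    show "\<exists>j\<in>J. s = Up j 0 \<and> t = Down j (- 1)"
    proof (cases s)
      case (Up j k)
      show ?thesis
      proof (cases t)
        case t: (Up i h)
        then show ?thesis using st Up lozenge_iff(2) by metis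
      next
        case t: (Down i h)
        then have e: "i = j" "k = 0" "h = - 1" using st rs rt unfolding Up t lozenge_iff by auto
        have "mirror t = Up j 0" unfolding t e by simp
        then show ?thesis using s t' unfolding Up t e by (intro bexI[of _ j]) (simp_all add: J_def)
      qed
    next
      case (Down j k)
      show ?thesis
      proof (cases t)
        case t: (Up i h)
        then show ?thesis using st rs rt unfolding Down t lozenge_iff' by auto
      next
        case t: (Down i h)
        then show ?thesis using st Down lozenge_iff(3) by metis
      qed
    qed
  qed (rule fJ)
  also have "\<dots> = (\<Sum>S\<in>Pow J.
    M axis_weight (Tu - Hu - (\<lambda>j. Up j 0) ` S) * M axis_weight (Tl - Hl - (\<lambda>j. Up j 0) ` S))"
  proof (rule sum.cong[OF refl])
    fix S assume "S \<in> Pow J"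
    have 1: "(\<Prod>j\<in>S. ?w {Up j 0, Down j (- 1)}) = 1"
      using w1[of 0] by (intro prod.neutral ballI) simp
    have 2: "M ?w (Tu - Hu - (\<lambda>j. Up j 0) ` S) = M axis_weight (Tu - Hu - (\<lambda>j. Up j 0) ` S)"
    proof (rule M_cong_weight)
      fix l assume l: "lozenge l" "l \<subseteq> Tu - Hu - (\<lambda>j. Up j 0) ` S"
      then have lT: "l \<subseteq> Tu" by blast
      have "?w l = 1"
      proof (cases "\<exists>j k. l = {Up j k, Down j (k - 1)}")
        case True
        then obtain j k where jk: "l = {Up j k, Down j (k - 1)}" by blast
        then have "0 \<le> k" using lT ru[of "Up j k"] by simp
        then show ?thesis unfolding jk by (rule w1)
      next
        case False
        then show ?thesis unfolding zigzag_weight_def by auto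
      qed
      moreover have "axis_weight l = 1" by (rule unit_weight_trap[OF l(1) lT[unfolded Tu_def]])
      ultimately show "?w l = axis_weight l" by simp
    qed
    have "(\<lambda>j. Down j (- 1)) ` S = mirror ` (\<lambda>j. Up j 0) ` S" by (simp add: image_image)
    then have "mirror ` (Tl - Hl) - (\<lambda>j. Down j (- 1)) ` S = mirror ` (Tl - Hl - (\<lambda>j. Up j 0) ` S)"
      by (simp only: image_set_diff[OF inj_mirror])
    then have "M ?w (mirror ` (Tl - Hl) - (\<lambda>j. Down j (- 1)) ` S) =
        M (\<lambda>l. ?w (mirror ` l)) (Tl - Hl - (\<lambda>j. Up j 0) ` S)"
      by (simp only: M_image[OF inj_mirror lozenge_mirror])
    also have "\<dots> = M axis_weight (Tl - Hl - (\<lambda>j. Up j 0) ` S)"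
    proof (rule M_cong_weight)
      fix l assume "l \<subseteq> Tl - Hl - (\<lambda>j. Up j 0) ` S"
      then have "l \<subseteq> trap 1 0 (N3_depth y z as bs) (int (L + z))" unfolding Tl_def by blast
      then show "?w (mirror ` l) = axis_weight l"
        unfolding zigzag_weight_mirror by (rule zigzag_weight_trap)
    qed
    finally show "(\<Prod>j\<in>S. ?w {Up j 0, Down j (- 1)}) *
      M ?w (Tu - Hu - (\<lambda>j. Up j 0) ` S) * M ?w (mirror ` (Tl - Hl) - (\<lambda>j. Down j (- 1)) ` S) =
      M axis_weight (Tu - Hu - (\<lambda>j. Up j 0) ` S) * M axis_weight (Tl - Hl - (\<lambda>j. Up j 0) ` S)"
      unfolding 1 2 by simp
  qed
  finally show "M_N3 x y z as bs = (\<Sum>S\<in>Pow J.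
    M axis_weight (Tu - Hu - (\<lambda>j. Up j 0) ` S) * M axis_weight (Tl - Hl - (\<lambda>j. Up j 0) ` S))" .
qed

lemma base_in_half_hole: "0 \<le> j \<Longrightarrow> Up j 0 \<in> N3_half_hole as \<Longrightarrow> j \<in> seg odd as"
proof -
  assume j: "0 \<le> j" "Up j 0 \<in> N3_half_hole as"
  then have "j < int (entry as 1)" unfolding in_half_hole by simp
  moreover have "1 \<in> {1..length as}" using calculation j by (auto simp: entry_def split: if_splits)
  ultimately show "j \<in> seg odd as"
    unfolding mem_seg using j partial_sum_step[of 1 as] by (intro bexI[of _ 1]) auto
qed

text \<open>The holes are traded for the dent sets \<open>U\<close> and \<open>D\<close>. The upper
  half vanishes unless it has \<open>y + p\<close> dents, and this forces exactly \<open>y\<close>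
  crossings.\<close>

theorem M_N3_sum:
  fixes x y z :: nat and as bs :: "nat list"
  defines "a \<equiv> sum_list as" and "L \<equiv> N3_width x y as bs"
    and "p \<equiv> odd_sum as + odd_sum bs" and "q \<equiv> even_sum as + even_sum bs + z"
  defines "U \<equiv> fern odd (int L) as bs" and "D \<equiv> fern even (int L) as bs \<union> {int L..<int (L + z)}"
  shows "M_N3 x y z as bs = (\<Sum>S | S \<subseteq> {int a..<int (a + x + y)} \<and> card S = y.
      dent_count (2 * (y + p) - 1) 0 (U \<union> S) * dent_count (2 * (y + q)) 0 (D \<union> S))"
    and "card U = p" "card D = q" "finite U" "finite D"
    and "U \<inter> {int a..<int (a + x + y)} = {}" "D \<inter> {int a..<int (a + x + y)} = {}"
    and "U \<union> D = {0..<int a} \<union> {int (a + x + y)..<int (L + z)}" "U \<inter> D = {}"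
proof -
  define b where "b = sum_list bs"
  let ?G = "{int a..<int (a + x + y)}"
  have L: "L = x + y + a + b" unfolding L_def N3_width_def a_def b_def by simp
  have abL: "a + b \<le> L" using L by simp
  have Lb: "L - b = a + x + y" using L by simp
  have ev: "(\<lambda>i. \<not> odd i) = (even :: nat \<Rightarrow> bool)" by (rule ext) simp
  note fo = fern_parts[OF a_def[THEN meta_eq_to_obj_eq] b_def abL, where P = odd]
  note fe = fern_parts[OF a_def[THEN meta_eq_to_obj_eq] b_def abL, where P = even]
  let ?E = "fern even (int L) as bs"
  have UE: "U \<union> ?E = {0..<int a} \<union> {int (a + x + y)..<int L}" "U \<inter> ?E = {}"
    using fo(6,7) unfolding ev U_def Lb by simp_all
  show cU: "card U = p" unfolding U_def p_def fo(5) card_seg_odd_even ..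
  show fU: "finite U" unfolding U_def by (rule fo(3))
  have U0: "U \<subseteq> {0..<int L}" unfolding U_def by (rule fo(4))
  have E0: "?E \<subseteq> {0..<int L}" by (rule fe(4))
  have EZ: "?E \<inter> {int L..<int (L + z)} = {}" using E0 by auto
  show cD: "card D = q"
    unfolding D_def q_def using fe(3,5) EZ by (subst card_Un_disjoint) (simp_all add: card_seg_odd_even)
  show fD: "finite D" unfolding D_def using fe(3) by simp
  have D0: "D \<subseteq> {0..<int (L + z)}" unfolding D_def using E0 by auto
  have aL: "a + x + y \<le> L" using L by simp
  have GL: "?G \<inter> ({0..<int a} \<union> {int (a + x + y)..<int L}) = {}" "?G \<inter> {int L..<int (L + z)} = {}"
    "?G \<subseteq> {0..<int L}" using aL by auto
  show UG: "U \<inter> ?G = {}" using UE(1) GL(1) by blast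
  show DG: "D \<inter> ?G = {}" using UE(1) GL(1,2) unfolding D_def by blast
  have "U \<union> D = {0..<int a} \<union> {int (a + x + y)..<int L} \<union> {int L..<int (L + z)}"
    unfolding D_def Un_assoc[symmetric] UE(1) ..
  also have "\<dots> = {0..<int a} \<union> {int (a + x + y)..<int (L + z)}" using aL by auto
  finally show "U \<union> D = {0..<int a} \<union> {int (a + x + y)..<int (L + z)}" .
  show "U \<inter> D = {}" unfolding D_def using UE(2) U0 by auto

  define Tu where "Tu = trap 0 0 (N3_top y as bs) (int L)"
  define Hu where "Hu = N3_half_hole as \<union> fern_holes odd L as bs"
  define Tl where "Tl = trap 1 0 (N3_depth y z as bs) (int (L + z))"
  define Hl where "Hl = up_hole L z \<union> fern_holes even L as bs"
  define J where "J = {j. Up j 0 \<in> Tu - Hu \<and> Up j 0 \<in> Tl - Hl}"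
  note cut = M_N3_cut[where x = x and y = y and z = z and as = as and bs = bs, folded L_def, folded Tu_def Hu_def Tl_def Hl_def, folded J_def]
  have top: "N3_top y as bs = 2 * int (y + p) - 1" unfolding N3_top_def p_def by simp
  have dep: "N3_depth y z as bs = int (2 * (y + q))" unfolding N3_depth_def q_def by simp
  have absum: "sum_list as + sum_list bs \<le> L" using abL unfolding a_def b_def .
  have Hu_base: "Up j 0 \<in> Hu \<longleftrightarrow> j \<in> U" if "0 \<le> j" for j
    unfolding Hu_def Un_iff fern_holes_base[OF absum] U_def fern_def
    using base_in_half_hole[OF that] by blast
  have Hl_base: "Up j 0 \<in> Hl \<longleftrightarrow> j \<in> D" for j
    unfolding Hl_def Un_iff fern_holes_base[OF absum] D_def in_up_hole by auto
  have Tu_base: "Up j 0 \<in> Tu \<longleftrightarrow> 0 < y + p \<and> 0 \<le> j \<and> j < int L" for j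
    unfolding Tu_def top Up_in_trap by auto
  have Tl_base: "Up j 0 \<in> Tl \<longleftrightarrow> 0 < y + q \<and> 0 \<le> j \<and> j < int (L + z)" for j
    unfolding Tl_def dep Up_in_trap by auto
  \<comment> \<open>If one of the halves has no rows, nothing can cross; but then
    \<open>y = 0\<close>, and only the empty set is summed over in either description.\<close>
  have J: "J = (if 0 < y + p \<and> 0 < y + q then ?G else {})"
  proof (rule Set.set_eqI)
    fix j
    have "0 \<le> j \<and> j < int L \<and> j \<notin> U \<and> j \<notin> D \<longleftrightarrow> j \<in> ?G"
    proof
      assume j: "0 \<le> j \<and> j < int L \<and> j \<notin> U \<and> j \<notin> D"
      then have "j \<notin> {0..<int a} \<union> {int (a + x + y)..<int L}" unfolding UE(1)[symmetric] D_def by blast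
      then show "j \<in> ?G" using j by auto
    next
      assume "j \<in> ?G"
      then show "0 \<le> j \<and> j < int L \<and> j \<notin> U \<and> j \<notin> D" using UG DG GL(3) by auto
    qed
    then show "j \<in> J \<longleftrightarrow> j \<in> (if 0 < y + p \<and> 0 < y + q then ?G else {})"
      unfolding J_def using Hu_base[of j] Hl_base[of j] Tu_base[of j] Tl_base[of j] by auto
  qed
  have JG: "J \<subseteq> ?G" unfolding J by simp
  have upper: "M axis_weight (Tu - Hu - (\<lambda>j. Up j 0) ` S) =
      (if card S = y then dent_count (2 * (y + p) - 1) 0 (U \<union> S) else 0)" if S: "S \<in> Pow J" for S
  proof (cases "0 < y + p")
    case False
    then have "S = {}" "U = {}" using S J fU cU by auto
    moreover have "Tu = {}" unfolding Tu_def top using False by (auto simp: trap_def split: triangle.splits)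
    ultimately show ?thesis using False by (simp add: dent_count_def vset_def)
  next
    case True
    let ?r = "2 * (y + p) - 1"
    have top': "N3_top y as bs = int ?r" unfolding top using True by (cases "y + p") simp_all
    have aux: "Suc e \<le> 2 * (w + p)" if "e \<le> odd_sum as \<or> e \<le> odd_sum bs" "0 < w + p" for e w
      using that unfolding p_def by presburger
    have SG: "S \<subseteq> ?G" using S JG by blast
    have fS: "finite S" using SG by (rule finite_subset) simp
    have hole: "hole_in (trap 0 0 (N3_top y as bs) (int L)) Hu"
      unfolding Hu_def
    proof (rule hole_in_Un)
      have "entry as 1 \<le> odd_sum as" using entry_le_sums(1)[of 1 as] by (cases "as = []") (auto simp: entry_def Suc_le_eq)
      then show "hole_in (trap 0 0 (N3_top y as bs) (int L)) (N3_half_hole as)"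
        by (intro hole_in_half_hole) (simp add: top p_def)
      show "hole_in (trap 0 0 (N3_top y as bs) (int L)) (fern_holes odd L as bs)"
      proof (rule hole_in_fern_holes)
        show "int (entry as i) \<le> N3_top y as bs" if "i \<in> {1..length as}" "odd i" for i
        proof -
          have "Suc (entry as i) \<le> 2 * (y + p)" by (rule aux[OF disjI1[OF entry_le_sums(1)[OF that]] True])
          then have "int (Suc (entry as i)) \<le> int (2 * (y + p))" by (rule of_nat_mono)
          then show ?thesis unfolding top by simp
        qed
        show "int (entry bs i) \<le> N3_top y as bs" if "i \<in> {1..length bs}" "odd i" for i
        proof -
          have "Suc (entry bs i) \<le> 2 * (y + p)" by (rule aux[OF disjI2[OF entry_le_sums(1)[OF that]] True])
          then have "int (Suc (entry bs i)) \<le> int (2 * (y + p))" by (rule of_nat_mono)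
          then show ?thesis unfolding top by simp
        qed
      qed simp
    qed
    have "M axis_weight (Tu - Hu - (\<lambda>j. Up j 0) ` S) =
        M axis_weight (Tu - (\<lambda>j. Up j 0) ` ({j. Up j 0 \<in> Tu \<inter> Hu} \<union> S))"
      unfolding Tu_def
    proof (rule M_forced_holes[OF hole])
      fix j k :: int
      assume k: "0 \<le> k" "Up j (k + 1) \<in> trap 0 0 (N3_top y as bs) (int L)" "Up j (k + 1) \<in> Hu"
      \<comment> \<open>The half hole reaches positions \<open>j < 0\<close>, so the weight is read
        off from the type of the trapezoid and not from the position.\<close>
      have "Down j k \<in> trap 0 0 (N3_top y as bs) (int L)" by (rule hole_inD(5)[OF hole k])
      then show "axis_weight {Down j k, Up j (k + 1)} = 1"
        using k(2) by (intro unit_weight_trap) (simp_all only: lozenge_iff' insert_subset empty_subsetI, simp)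
    qed
    also have "{j. Up j 0 \<in> Tu \<inter> Hu} = U"
    proof (rule Set.set_eqI)
      fix j show "j \<in> {j. Up j 0 \<in> Tu \<inter> Hu} \<longleftrightarrow> j \<in> U"
        using Tu_base[of j] Hu_base[of j] True U0 by auto
    qed
    also have "M axis_weight (Tu - (\<lambda>j. Up j 0) ` (U \<union> S)) =
        (if card (U \<union> S) = (?r + 1) div 2 then dent_count ?r 0 (U \<union> S) else 0)"
      unfolding Tu_def top'
    proof (rule M_dented_trap)
      show "odd (int ?r + 0)" using True by simp
      show "int ?r - 0 = int ?r" by simp
      show "U \<union> S \<subseteq> {- ((0 + 0) div 2)..<int L - 0}" using U0 SG GL(3) by auto
      show "?r = 0 \<Longrightarrow> U \<union> S = {}" using True by simp
      \<comment> \<open>\<open>U\<close> avoids the gap of length \<open>x + y\<close>, which leaves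
        room for \<open>y\<close> further dents.\<close>
      have "p + y \<le> L"
      proof -
        have "card U \<le> card ({0..<int a} \<union> {int (a + x + y)..<int L})"
          by (rule card_mono) (use UE(1) in auto)
        also have "\<dots> \<le> card {0..<int a} + card {int (a + x + y)..<int L}" by (rule card_Un_le)
        finally show ?thesis using cU L by simp
      qed
      then show "int ((?r + 1) div 2) \<le> int L - 0 + (0 + 0) div 2" using True by simp
    qed simp
    also have "card (U \<union> S) = p + card S"
      using UG SG fU fS cU by (subst card_Un_disjoint) auto
    also have "(?r + 1) div 2 = y + p" using True by simp
    finally show ?thesis by simp
  qed
  have lower: "M axis_weight (Tl - Hl - (\<lambda>j. Up j 0) ` S) = dent_count (2 * (y + q)) 0 (D \<union> S)"
    if S: "S \<in> Pow J" "card S = y" for S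
  proof -
    let ?r = "2 * (y + q)"
    have aux: "Suc e \<le> 2 * (w + p)" if "e \<le> odd_sum as \<or> e \<le> odd_sum bs" "0 < w + p" for e w
      using that unfolding p_def by presburger
    have SG: "S \<subseteq> ?G" using S JG by blast
    have fS: "finite S" using SG by (rule finite_subset) simp
    have hole: "hole_in (trap 1 0 (N3_depth y z as bs) (int (L + z))) Hl"
      unfolding Hl_def
    proof (rule hole_in_Un)
      show "hole_in (trap 1 0 (N3_depth y z as bs) (int (L + z))) (up_hole L z)"
        by (intro hole_in_up_hole) (simp_all add: dep q_def)
      show "hole_in (trap 1 0 (N3_depth y z as bs) (int (L + z))) (fern_holes even L as bs)"
      proof (rule hole_in_fern_holes)
        show "int (entry as i) \<le> N3_depth y z as bs" if "i \<in> {1..length as}" "even i" for i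
          using entry_le_sums(2)[OF that] unfolding dep q_def by simp
        show "int (entry bs i) \<le> N3_depth y z as bs" if "i \<in> {1..length bs}" "even i" for i
          using entry_le_sums(2)[OF that] unfolding dep q_def by simp
      qed simp
    qed
    have "M axis_weight (Tl - Hl - (\<lambda>j. Up j 0) ` S) =
        M axis_weight (Tl - (\<lambda>j. Up j 0) ` ({j. Up j 0 \<in> Tl \<inter> Hl} \<union> S))"
      unfolding Tl_def
    proof (rule M_forced_holes[OF hole])
      fix j k :: int
      assume k: "0 \<le> k" "Up j (k + 1) \<in> Hl"
      have "0 \<le> j"
        using k(2) unfolding Hl_def fern_holes_def by (auto simp: in_up_hole)
      then show "axis_weight {Down j k, Up j (k + 1)} = 1" by (rule axis_weight_hole[OF k(1)])
    qed
    also have "{j. Up j 0 \<in> Tl \<inter> Hl} = D"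
    proof (cases "0 < y + q")
      case True
      show ?thesis
      proof (rule Set.set_eqI)
        fix j show "j \<in> {j. Up j 0 \<in> Tl \<inter> Hl} \<longleftrightarrow> j \<in> D"
          using Tl_base[of j] Hl_base[of j] True D0 by auto
      qed
    next
      case False
      then have "D = {}" using cD fD by simp
      then show ?thesis using Hl_base by auto
    qed
    also have "M axis_weight (Tl - (\<lambda>j. Up j 0) ` (D \<union> S)) =
        (if card (D \<union> S) = (?r + 1) div 2 then dent_count ?r 0 (D \<union> S) else 0)"
      unfolding Tl_def dep
    proof (rule M_dented_trap)
      have "card (D \<union> S) \<le> card {0..<int (L + z)}"
        by (rule card_mono) (use D0 SG GL(3) in auto)
      moreover have "card (D \<union> S) = q + y"
        using DG SG fD fS cD S by (subst card_Un_disjoint) auto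
      ultimately show "int ((?r + 1) div 2) \<le> int (L + z) - 0 + (0 + 1) div 2" by simp
      show "D \<union> S \<subseteq> {- ((0 + 1) div 2)..<int (L + z) - 0}" using D0 SG GL(3) by auto
      show "?r = 0 \<Longrightarrow> D \<union> S = {}" using cD fD S fS by simp
    qed simp_all
    also have "card (D \<union> S) = q + y"
      using DG SG fD fS cD S by (subst card_Un_disjoint) auto
    finally show ?thesis by simp
  qed
  have "M_N3 x y z as bs = (\<Sum>S\<in>Pow J.
    M axis_weight (Tu - Hu - (\<lambda>j. Up j 0) ` S) * M axis_weight (Tl - Hl - (\<lambda>j. Up j 0) ` S))"
    by (rule cut(2))
  also have "\<dots> = (\<Sum>S\<in>Pow J. if card S = y then
      dent_count (2 * (y + p) - 1) 0 (U \<union> S) * dent_count (2 * (y + q)) 0 (D \<union> S) else 0)"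
  proof (rule sum.cong[OF refl])
    fix S assume S: "S \<in> Pow J"
    show "M axis_weight (Tu - Hu - (\<lambda>j. Up j 0) ` S) * M axis_weight (Tl - Hl - (\<lambda>j. Up j 0) ` S) =
      (if card S = y then dent_count (2 * (y + p) - 1) 0 (U \<union> S) * dent_count (2 * (y + q)) 0 (D \<union> S) else 0)"
    proof (cases "card S = y")
      case True
      show ?thesis unfolding upper[OF S] lower[OF S True] using True by (simp only: if_True simp_thms)
    next
      case False
      then show ?thesis unfolding upper[OF S] by (simp only: if_False mult_zero_left)
    qed
  qed
  also have "\<dots> = (\<Sum>S\<in>{S \<in> Pow J. card S = y}.
      dent_count (2 * (y + p) - 1) 0 (U \<union> S) * dent_count (2 * (y + q)) 0 (D \<union> S))"
    by (rule sum.inter_filter[symmetric]) (simp add: J)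
  also have "{S \<in> Pow J. card S = y} = {S. S \<subseteq> ?G \<and> card S = y}"
  proof (cases "y = 0")
    case True
    have "S = {}" if "S \<subseteq> ?G" "card S = 0" for S
      using that finite_subset[OF that(1)] by simp
    then show ?thesis using True JG by auto
  next
    case False
    then have "J = ?G" unfolding J by simp
    then show ?thesis by auto
  qed
  finally show "M_N3 x y z as bs = (\<Sum>S | S \<subseteq> ?G \<and> card S = y.
      dent_count (2 * (y + p) - 1) 0 (U \<union> S) * dent_count (2 * (y + q)) 0 (D \<union> S))" .
qed

section \<open>Product formulas\<close>

lemma H2_Suc_Suc: "H2 (m + 2) = fact m * H2 m"
proof -
  have "H2 (m + 2) = (\<Prod>i<Suc (m div 2). fact (m + 2 - 2 * Suc i))"
    unfolding H2_def by (simp add: prod.atLeast1_atMost_eq del: fact_Suc)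
  also have "\<dots> = fact m * (\<Prod>i<m div 2. fact (m - 2 * Suc i))"
    unfolding prod.lessThan_Suc_shift by simp
  finally show ?thesis unfolding H2_def by (simp add: prod.atLeast1_atMost_eq)
qed

lemma fact_double:
  "(\<Prod>i<n. real (2 * i + 1)) * (\<Prod>i<n. 2 * real (Suc i)) = fact (2 * n)"
  "(\<Prod>i<n. 2 * real (Suc i)) * (\<Prod>i<Suc n. real (2 * i + 1)) = fact (2 * n + 1)"
proof -
  show 1: "(\<Prod>i<n. real (2 * i + 1)) * (\<Prod>i<n. 2 * real (Suc i)) = fact (2 * n)"
  proof (induction n)
    case (Suc n)
    have "(\<Prod>i<Suc n. real (2 * i + 1)) * (\<Prod>i<Suc n. 2 * real (Suc i)) =
        (\<Prod>i<n. real (2 * i + 1)) * (\<Prod>i<n. 2 * real (Suc i)) * (real (2 * n + 1) * (2 * real (Suc n)))"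
      by (simp only: prod.lessThan_Suc mult_ac)
    also have "\<dots> = fact (2 * Suc n)" unfolding Suc by (simp add: algebra_simps)
    finally show ?case .
  qed simp
  have "(\<Prod>i<n. 2 * real (Suc i)) * (\<Prod>i<Suc n. real (2 * i + 1)) =
      (\<Prod>i<n. real (2 * i + 1)) * (\<Prod>i<n. 2 * real (Suc i)) * real (2 * n + 1)"
    by (simp only: prod.lessThan_Suc mult_ac)
  then show "(\<Prod>i<n. 2 * real (Suc i)) * (\<Prod>i<Suc n. real (2 * i + 1)) = fact (2 * n + 1)"
    unfolding 1 by simp
qed

text \<open>Two consecutive rows together contribute one factorial by \<open>fact_double\<close>,
  the same that \<open>H2\<close> gains when its argument grows by two. For \<open>n = 0\<close> the
  truncated \<open>2 * n - 1\<close> is 0 and both sides are 1.\<close>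

lemma row_const_H2: "row_const (2 * n) = H2 (2 * n + 1)" "row_const (2 * n - 1) = H2 (2 * n)"
proof -
  show "row_const (2 * n) = H2 (2 * n + 1)"
  proof (induction n)
    case (Suc n)
    have "row_const (2 * Suc n) = row_const (2 * n) *
        ((\<Prod>i<n. 2 * real (Suc i)) * (\<Prod>i<Suc n. real (2 * i + 1)))"
      by simp
    also have "\<dots> = H2 (2 * n + 1) * fact (2 * n + 1)" unfolding Suc fact_double ..
    also have "\<dots> = H2 (2 * n + 1 + 2)" unfolding H2_Suc_Suc by (rule mult.commute)
    finally show ?case by (simp add: add.commute)
  qed (simp add: H2_def)
  show "row_const (2 * n - 1) = H2 (2 * n)"
  proof (induction n)
    case (Suc n)
    have e: "2 * Suc n - 1 = Suc (2 * n)" by simp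
    have "row_const (2 * n) = row_const (2 * n - 1) * (\<Prod>i<n. real (2 * i + 1))"
    proof (cases n)
      case (Suc k)
      then show ?thesis by simp
    qed simp
    then have "row_const (2 * Suc n - 1) = row_const (2 * n - 1) * ((\<Prod>i<n. real (2 * i + 1)) * (\<Prod>i<n. 2 * real (Suc i)))"
      unfolding e by simp
    also have "\<dots> = H2 (2 * n) * fact (2 * n)" unfolding Suc fact_double ..
    also have "\<dots> = H2 (2 * n + 2)" unfolding H2_Suc_Suc by (rule mult.commute)
    finally show ?case by simp
  qed (simp add: H2_def)
qed

lemma H2_pos: "0 < H2 n"
  unfolding H2_def by (intro prod_pos) simp

lemma vset_if: "finite A \<Longrightarrow> vset v A = (\<Prod>q\<in>A. \<Prod>p\<in>A. if p < q then v q - v p else 1)"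
  unfolding vset_def by (simp add: prod.inter_filter)

text \<open>As \<open>v\<close> is increasing, a mixed pair contributes its larger value minus its
  smaller one, an absolute value. The relative order of the two sets thus disappears from the cross
  factor.\<close>

lemma vset_Un:
  fixes v :: "int \<Rightarrow> real"
  assumes fin: "finite A" "finite B" and dis: "A \<inter> B = {}"
    and mono: "\<And>p q. p \<in> A \<union> B \<Longrightarrow> q \<in> A \<union> B \<Longrightarrow> p < q \<Longrightarrow> v p < v q"
  shows "vset v (A \<union> B) = vset v A * vset v B * (\<Prod>s\<in>B. \<Prod>u\<in>A. \<bar>v s - v u\<bar>)"
proof -
  let ?g = "\<lambda>q p. if p < q then v q - v p else 1"
  have split: "(\<Prod>p\<in>A \<union> B. f p) = (\<Prod>p\<in>A. f p) * (\<Prod>p\<in>B. f p)" for f :: "int \<Rightarrow> real"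
    using fin dis by (rule prod.union_disjoint)
  have cross: "(\<Prod>q\<in>A. \<Prod>p\<in>B. ?g q p) * (\<Prod>q\<in>B. \<Prod>p\<in>A. ?g q p) = (\<Prod>s\<in>B. \<Prod>u\<in>A. \<bar>v s - v u\<bar>)"
  proof -
    have "(\<Prod>q\<in>A. \<Prod>p\<in>B. ?g q p) = (\<Prod>s\<in>B. \<Prod>u\<in>A. ?g u s)" by (rule prod.swap)
    then have "(\<Prod>q\<in>A. \<Prod>p\<in>B. ?g q p) * (\<Prod>q\<in>B. \<Prod>p\<in>A. ?g q p) = (\<Prod>s\<in>B. \<Prod>u\<in>A. ?g u s * ?g s u)"
      by (simp only: prod.distrib)
    also have "\<dots> = (\<Prod>s\<in>B. \<Prod>u\<in>A. \<bar>v s - v u\<bar>)"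
    proof (intro prod.cong refl)
      fix s u assume "s \<in> B" "u \<in> A"
      then have ne: "s \<noteq> u" and m: "s < u \<Longrightarrow> v s < v u" "u < s \<Longrightarrow> v u < v s" using dis mono by auto
      show "?g u s * ?g s u = \<bar>v s - v u\<bar>"
      proof (cases "s < u")
        case True then show ?thesis using m(1) by simp
      next
        case False then show ?thesis using m(2) ne by simp
      qed
    qed
    finally show ?thesis .
  qed
  have "vset v (A \<union> B) = (\<Prod>q\<in>A. \<Prod>p\<in>A. ?g q p) * (\<Prod>q\<in>A. \<Prod>p\<in>B. ?g q p) *
      ((\<Prod>q\<in>B. \<Prod>p\<in>A. ?g q p) * (\<Prod>q\<in>B. \<Prod>p\<in>B. ?g q p))"
    using fin by (simp only: vset_if finite_Un split prod.distrib simp_thms mult_ac)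
  also have "\<dots> = (\<Prod>q\<in>A. \<Prod>p\<in>A. ?g q p) * (\<Prod>q\<in>B. \<Prod>p\<in>B. ?g q p) *
      ((\<Prod>q\<in>A. \<Prod>p\<in>B. ?g q p) * (\<Prod>q\<in>B. \<Prod>p\<in>A. ?g q p))" by (simp only: mult_ac)
  finally show ?thesis unfolding cross using fin by (simp only: vset_if)
qed

lemma vset_pos:
  assumes "finite A" "\<And>p q. p \<in> A \<Longrightarrow> q \<in> A \<Longrightarrow> p < q \<Longrightarrow> v p < v q"
  shows "0 < vset v A"
  unfolding vset_def using assms by (intro prod_pos ballI) auto

text \<open>The factor at \<open>f\<close> is \<open>(s - f) * (s + f + 1)\<close>, so two runs of
  consecutive integers arise. With \<open>prod_squares_above\<close> this is the origin of the Racah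
  weight.\<close>

lemma prod_squares_below:
  "a \<le> s \<Longrightarrow> (\<Prod>f<a. \<bar>(real s + 1/2)\<^sup>2 - (real f + 1/2)\<^sup>2\<bar>) = fact (s + a) / fact (s - a)"
proof (induction a)
  case (Suc a)
  have 1: "\<bar>(real s + 1/2)\<^sup>2 - (real a + 1/2)\<^sup>2\<bar> = real (s - a) * real (s + a + 1)"
  proof -
    have "(real s + 1/2)\<^sup>2 - (real a + 1/2)\<^sup>2 = real (s - a) * real (s + a + 1)"
      using Suc.prems by (simp add: of_nat_diff power2_eq_square algebra_simps)
    then show ?thesis by simp
  qed
  have 2: "fact (s - a) = real (s - a) * fact (s - Suc a)" using Suc.prems by (metis Suc_diff_Suc Suc_le_lessD fact_Suc)
  have 3: "fact (s + Suc a) = real (s + a + 1) * fact (s + a)" by simp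
  have aux: "x / (r * y) * (r * t) = t * x / y" if "r \<noteq> 0" for x y r t :: real using that by simp
  have "(\<Prod>f<Suc a. \<bar>(real s + 1/2)\<^sup>2 - (real f + 1/2)\<^sup>2\<bar>) = fact (s + a) / fact (s - a) * (real (s - a) * real (s + a + 1))"
    unfolding prod.lessThan_Suc 1 using Suc by simp
  also have "\<dots> = fact (s + Suc a) / fact (s - Suc a)"
    unfolding 2 3 by (rule aux) (use Suc.prems in simp)
  finally show ?case .
qed simp

lemma prod_squares_above:
  assumes "s < b"
  shows "(\<Prod>f = b..<b + n. \<bar>(real s + 1/2)\<^sup>2 - (real f + 1/2)\<^sup>2\<bar>) =
    fact (b + n - 1 - s) * fact (b + n + s) / (fact (b - 1 - s) * fact (b + s))"
proof (induction n)
  case (Suc n)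
  have 1: "\<bar>(real s + 1/2)\<^sup>2 - (real (b + n) + 1/2)\<^sup>2\<bar> = real (b + n - s) * real (b + n + s + 1)"
  proof -
    have "(real s + 1/2)\<^sup>2 - (real (b + n) + 1/2)\<^sup>2 = - (real (b + n - s) * real (b + n + s + 1))"
      using assms by (simp add: of_nat_diff power2_eq_square algebra_simps)
    then show ?thesis by (simp only: abs_minus_cancel abs_mult abs_of_nat)
  qed
  have pos: "0 < b + n - s" and e: "b + Suc n - 1 - s = b + n - s" "b + n - s - 1 = b + n - 1 - s"
    "b + Suc n + s = Suc (b + n + s)" using assms by auto
  have 2: "fact (b + Suc n - 1 - s) = real (b + n - s) * fact (b + n - 1 - s)"
    by (simp only: e fact_reduce[OF pos])
  have 3: "fact (b + Suc n + s) = real (b + n + s + 1) * fact (b + n + s)"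
    unfolding e by simp
  have aux: "x * y / w * (r * t) = r * x * (t * y) / w" for x y r t w :: real by simp
  have "(\<Prod>f = b..<b + Suc n. \<bar>(real s + 1/2)\<^sup>2 - (real f + 1/2)\<^sup>2\<bar>) =
      fact (b + n - 1 - s) * fact (b + n + s) / (fact (b - 1 - s) * fact (b + s)) *
      (real (b + n - s) * real (b + n + s + 1))"
    using Suc by (simp only: add_Suc_right prod.atLeastLessThan_Suc le_add1 1)
  then show ?case unfolding 2 3 by (simp only: aux)
qed (use assms in simp)

lemma H_ratio: "H (n + k) = H n * (\<Prod>i<k. fact (n + i))"
  by (induction k) (simp_all add: H_def del: fact_Suc)

lemma H_pos: "0 < H n"
  unfolding H_def by (intro prod_pos) simp

lemma pochhammer_fact_quotient: "pochhammer (real x + 1) n = fact (x + n) / fact x"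
proof (induction n)
  case (Suc n)
  have "fact (x + Suc n) = fact (x + n) * (real x + 1 + real n)" by (simp add: algebra_simps)
  then show ?case unfolding pochhammer_Suc Suc by simp
qed simp

text \<open>Factor \<open>i\<close> is the quotient of \<open>fact (x + m + 2 * y - 1 - i)\<close>
  and \<open>fact (x + i)\<close>; reversing the order of the numerators makes both arguments
  increase with \<open>i\<close>.\<close>

lemma T_prod_fact:
  "T_prod (real x + 1) (int m + 2 * int y - 1) y = (\<Prod>i<y. fact (x + m + y + i) / fact (x + i))"
proof -
  have "T_prod (real x + 1) (int m + 2 * int y - 1) y = (\<Prod>i<y. fact (x + m + y + (y - Suc i)) / fact (x + i))"
    unfolding T_prod_def
  proof (rule prod.cong[OF refl])
    fix i assume "i \<in> {..<y}"
    then have i: "i < y" by simp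
    have n: "nat (int m + 2 * int y - 1 - 2 * int i) = m + 2 * y - 1 - 2 * i" using i by simp
    have e: "x + i + (m + 2 * y - 1 - 2 * i) = x + m + y + (y - Suc i)" using i by simp
    have r: "real x + 1 + real i = real (x + i) + 1" by simp
    show "pochhammer (real x + 1 + real i) (nat (int m + 2 * int y - 1 - 2 * int i)) =
        fact (x + m + y + (y - Suc i)) / fact (x + i)"
      unfolding n r pochhammer_fact_quotient e ..
  qed
  also have "\<dots> = (\<Prod>i<y. fact (x + m + y + i)) / (\<Prod>i<y. fact (x + i))"
    unfolding prod_dividef using prod.nat_diff_reindex[of "\<lambda>i. fact (x + m + y + i) :: real" y] by simp
  finally show ?thesis by (simp only: prod_dividef)
qed

text \<open>The factor \<open>R\<close> of the theorem, with \<open>\<beta>\<close> for \<open>b + z\<close>.\<close>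

definition R_factor :: "nat \<Rightarrow> nat \<Rightarrow> nat \<Rightarrow> nat \<Rightarrow> real" where
  "R_factor x y a \<beta> = T_prod (real x + 1) (2 * int a + int \<beta> + 2 * int y - 1) y
     * T_prod (real x + real a + 1) (int \<beta> + 2 * int y - 1) y
     / (T_prod 1 (2 * int a + int \<beta> + 2 * int y - 1) y * T_prod (real a + 1) (int \<beta> + 2 * int y - 1) y)"

lemma R_factor_fact:
  "R_factor x y a \<beta> = (\<Prod>i<y. fact (x + (2 * a + \<beta>) + y + i) / fact (x + i)) *
     (\<Prod>i<y. fact (x + a + \<beta> + y + i) / fact (x + a + i)) /
     ((\<Prod>i<y. fact (0 + (2 * a + \<beta>) + y + i) / fact (0 + i)) * (\<Prod>i<y. fact (a + \<beta> + y + i) / fact (a + i)))"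
proof -
  have e: "2 * int a + int \<beta> + 2 * int y - 1 = int (2 * a + \<beta>) + 2 * int y - 1"
    "real x + real a + 1 = real (x + a) + 1" "(1 :: real) = real 0 + 1" by simp_all
  show ?thesis
    unfolding R_factor_def e(1,2) T_prod_fact
    using T_prod_fact[of 0 "2 * a + \<beta>" y] by simp
qed

lemma R_factor_0: "R_factor 0 y a \<beta> = 1" "R_factor x 0 a \<beta> = 1"
proof -
  have "(\<Prod>i<y. fact (0 + (2 * a + \<beta>) + y + i) / fact (0 + i)) \<noteq> (0 :: real)"
    "(\<Prod>i<y. fact (a + \<beta> + y + i) / fact (a + i)) \<noteq> (0 :: real)"
    by (simp_all add: prod_zero_iff)
  then show "R_factor 0 y a \<beta> = 1" unfolding R_factor_fact by (simp only: add_0 divide_self_if mult_eq_0_iff) simp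
  show "R_factor x 0 a \<beta> = 1" unfolding R_factor_fact by simp
qed

text \<open>The numbers \<open>N - i\<close> run through \<open>x, ..., x + y - 1\<close> backwards,
  hence the two reversals. The quotient of \<open>H\<close> values equals the product of all
  \<open>fact (2 * a + \<beta> + y + i)\<close> and \<open>fact (\<beta> + i)\<close>; the former
  cancel against the denominator of \<open>R_factor\<close>.\<close>

lemma racah_product_eq:
  assumes "x + y = N + 1"
  shows "(\<Prod>i<y. fact (a + i) * fact (a + N + 1 + \<beta> + i) * fact (\<beta> + i) * fact (2 * a + N + 1 + \<beta> + i) * fact i
       / (fact (N - i) * fact (a + N - i) * fact (\<beta> + a + y + i))) =
    H (2 * a + \<beta> + 2 * y) * H (\<beta> + y) / (H (2 * a + \<beta> + y) * H \<beta>) * R_factor x y a \<beta>"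
proof -
  have y2: "2 * a + \<beta> + 2 * y = 2 * a + \<beta> + y + y" by simp
  have Hq: "H (2 * a + \<beta> + 2 * y) * H (\<beta> + y) / (H (2 * a + \<beta> + y) * H \<beta>) =
      (\<Prod>i<y. fact (2 * a + \<beta> + y + i)) * (\<Prod>i<y. fact (\<beta> + i))"
    unfolding y2 H_ratio[of "2 * a + \<beta> + y" y] H_ratio[of \<beta> y]
    using H_pos[of "2 * a + \<beta> + y"] H_pos[of \<beta>] by simp
  have rev1: "(\<Prod>i<y. fact (N - i) :: real) = (\<Prod>i<y. fact (x + i))"
  proof -
    have "(\<Prod>i<y. fact (N - i) :: real) = (\<Prod>i<y. fact (x + (y - Suc i)))"
      using assms by (intro prod.cong refl arg_cong[where f = fact]) auto
    then show ?thesis using prod.nat_diff_reindex[of "\<lambda>i. fact (x + i) :: real" y] by simp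
  qed
  have rev2: "(\<Prod>i<y. fact (a + N - i) :: real) = (\<Prod>i<y. fact (x + a + i))"
  proof -
    have "(\<Prod>i<y. fact (a + N - i) :: real) = (\<Prod>i<y. fact (x + a + (y - Suc i)))"
      using assms by (intro prod.cong refl arg_cong[where f = fact]) auto
    then show ?thesis using prod.nat_diff_reindex[of "\<lambda>i. fact (x + a + i) :: real" y] by simp
  qed
  have e: "x + (2 * a + \<beta>) + y + i = 2 * a + N + 1 + \<beta> + i" "x + a + \<beta> + y + i = a + N + 1 + \<beta> + i"
    "0 + (2 * a + \<beta>) + y + i = 2 * a + \<beta> + y + i" "a + \<beta> + y + i = \<beta> + a + y + i" "0 + i = i" for i
    using assms by simp_all
  have nz: "(\<Prod>i<y. fact (g i)) \<noteq> (0 :: real)" for g by (simp add: prod_zero_iff)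
  have aux: "A1 * A2 * A3 * A4 * A5 / (B1 * B2 * B3) = C1 * A3 * (A4 / B1 * (A2 / B2) / (C1 / A5 * (B3 / A1)))"
    if "C1 \<noteq> 0" "A5 \<noteq> 0" "B3 \<noteq> 0" "A1 \<noteq> 0" "B1 \<noteq> 0" "B2 \<noteq> 0" for A1 A2 A3 A4 A5 B1 B2 B3 C1 :: real
    using that by (simp add: field_simps)
  show ?thesis
    unfolding R_factor_fact Hq e prod_dividef prod.distrib rev1 rev2 by (rule aux) (rule nz)+
qed

section \<open>The enumeration\<close>

lemma dent_count_odd_rows:
  assumes "finite X" "card X = n"
  shows "dent_count (2 * n - 1) 0 X = vset (\<lambda>j. (xi 0 j)\<^sup>2) X / H2 (2 * n)"
proof (cases "n = 0")
  case True
  then have "X = {}" using assms by simp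
  then show ?thesis using True by (simp add: dent_count_def vset_def H2_def)
next
  case False
  then have "odd (2 * n - 1)" by simp
  then show ?thesis unfolding dent_count_def row_const_H2 by simp
qed

lemma dent_count_even_rows:
  "dent_count (2 * n) 0 X = (\<Prod>j\<in>X. xi 0 j) * vset (\<lambda>j. (xi 0 j)\<^sup>2) X / H2 (2 * n + 1)"
  unfolding dent_count_def row_const_H2 by simp

lemma xi_squared_mono: "0 \<le> i \<Longrightarrow> i < j \<Longrightarrow> (xi 0 i)\<^sup>2 < (xi 0 j)\<^sup>2"
proof -
  assume "0 \<le> i" "i < j"
  then have "real_of_int i < real_of_int j" "0 \<le> real_of_int i" by simp_all
  then show ?thesis unfolding xi_def by (intro power_strict_mono) auto
qed

lemma xi_nat: "xi 0 (int s) = real s + 1/2"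
  by (simp add: xi_def)

lemma vset_image_int: "vset v (int ` S) = vset (\<lambda>s. v (int s)) S"
proof -
  have "{p. p \<in> int ` S \<and> p < int q} = int ` {p. p \<in> S \<and> p < q}" for q by auto
  then show ?thesis unfolding vset_def by (simp add: prod.reindex)
qed

lemma prod_int_interval: "(\<Prod>f\<in>{int m..<int n}. g f) = (\<Prod>f = m..<n. g (int f))"
  unfolding image_int_atLeastLessThan[symmetric] by (simp add: prod.reindex)

lemma sum_int_subsets:
  "(\<Sum>S | S \<subseteq> {int m..<int n} \<and> card S = y. f S) = (\<Sum>S | S \<subseteq> {m..<n} \<and> card S = y. f (int ` S))"
proof (rule sum.reindex_cong[where l = "(`) int"])
  show "inj_on ((`) int) {S. S \<subseteq> {m..<n} \<and> card S = y}"
    by (intro inj_onI) (simp add: inj_image_eq_iff)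
  show "{S. S \<subseteq> {int m..<int n} \<and> card S = y} = (`) int ` {S. S \<subseteq> {m..<n} \<and> card S = y}"
    unfolding image_int_atLeastLessThan[symmetric]
    by (auto simp: subset_image_iff card_image image_iff)
qed simp

text \<open>The parts of the two counts that are free of \<open>S\<close> are \<open>K\<close> and
  \<open>Q'\<close> up to the row constants, which belong to \<open>y + p\<close> and
  \<open>y + q\<close> instead of \<open>p\<close> and \<open>q\<close>; this gives the quotient of
  \<open>H2\<close> values.\<close>

theorem M_N3_formula:
  fixes x y z :: nat and as bs :: "nat list"
  defines "a \<equiv> sum_list as" and "\<beta> \<equiv> sum_list bs + z"
    and "p \<equiv> odd_sum as + odd_sum bs" and "q \<equiv> even_sum as + even_sum bs + z"
  shows "M_N3 x y z as bs = K (t_plus x y as bs) * Q' (t_minus x y z as bs) * ((1/2) ^ y *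
      (H2 (2 * p) * H2 (2 * q + 1) / (H2 (2 * (y + p)) * H2 (2 * (y + q) + 1))) *
      (H (2 * a + \<beta> + 2 * y) * H (\<beta> + y) / (H (2 * a + \<beta> + y) * H \<beta>) * R_factor x y a \<beta>))"
    and "0 < K (t_plus x y as bs)" "0 < Q' (t_minus x y z as bs)"
proof -
  define L where "L = N3_width x y as bs"
  define U where "U = fern odd (int L) as bs"
  define D where "D = fern even (int L) as bs \<union> {int L..<int (L + z)}"
  define b' where "b' = a + x + y"
  define c where "c = a + x + y + \<beta>"
  let ?v = "\<lambda>j. (xi 0 j)\<^sup>2" and ?G = "{int a..<int b'}"
  have Lz: "L + z = c" unfolding L_def c_def N3_width_def a_def \<beta>_def by simp
  note sums_U = M_N3_sum(2,4,6)[where x = x and y = y and as = as and bs = bs,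
      folded L_def, folded U_def D_def, folded a_def p_def q_def, folded b'_def, unfolded Lz]
  note sums_D = M_N3_sum(1,3,5,7-9)[where x = x and y = y and z = z and as = as and bs = bs,
      folded L_def, folded U_def D_def, folded a_def p_def q_def, folded b'_def, unfolded Lz]
  note sums = sums_D(1) sums_U(1) sums_D(2) sums_U(2) sums_D(3) sums_U(3) sums_D(4-6)
  have L': "x + y + sum_list as + sum_list bs = L" unfolding L_def N3_width_def ..
  have sp: "seg even (t_plus x y as bs) = U" and sm: "seg even (t_minus x y z as bs) = D"
    unfolding t_plus_facts t_minus_facts L' U_def D_def by simp_all
  have ep: "even_sum (t_plus x y as bs) = p" using sums(2) card_seg_odd_even(2)[of "t_plus x y as bs"] sp by simp
  have em: "even_sum (t_minus x y z as bs) = q" using sums(3) card_seg_odd_even(2)[of "t_minus x y z as bs"] sm by simp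
  have UD0: "U \<union> D \<subseteq> {0..}" unfolding sums(8) by auto
  have mono: "?v i < ?v j" if "0 \<le> i" "i < j" for i j using that by (rule xi_squared_mono)
  have Kp: "K (t_plus x y as bs) = vset ?v U / H2 (2 * p)"
    unfolding K_eq_seg ep sp by (rule dent_count_odd_rows[OF sums(4,2)])
  have Qm: "Q' (t_minus x y z as bs) = (\<Prod>j\<in>D. xi 0 j) * vset ?v D / H2 (2 * q + 1)"
    unfolding Q'_eq_seg em sm by (rule dent_count_even_rows)
  have "0 < vset ?v U" using UD0 by (intro vset_pos sums(4) mono) auto
  then show "0 < K (t_plus x y as bs)" unfolding Kp using H2_pos by simp
  have "0 < vset ?v D" using UD0 by (intro vset_pos sums(5) mono) auto
  moreover have "0 < (\<Prod>j\<in>D. xi 0 j)"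
  proof (rule prod_pos)
    fix j assume "j \<in> D"
    then have "0 \<le> real_of_int j" using UD0 by auto
    then show "0 < xi 0 j" by (simp add: xi_def)
  qed
  ultimately show "0 < Q' (t_minus x y z as bs)" unfolding Qm using H2_pos by simp
  \<comment> \<open>The contribution of one crossing position: its distance from the axis, due to
    type \<open>Q'\<close>, and its differences to all dents of \<open>U\<close> and
    \<open>D\<close>, which together form the two intervals outside the gap.\<close>
  define W where "W s = xi 0 s * ((\<Prod>f\<in>{0..<int a}. \<bar>?v s - ?v f\<bar>) * (\<Prod>f\<in>{int b'..<int c}. \<bar>?v s - ?v f\<bar>))" for s
  define C where "C = vset ?v U / H2 (2 * (y + p)) * ((\<Prod>j\<in>D. xi 0 j) * vset ?v D / H2 (2 * (y + q) + 1))"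
  have term_S: "dent_count (2 * (y + p) - 1) 0 (U \<union> S) * dent_count (2 * (y + q)) 0 (D \<union> S) =
      C * ((vset ?v S)\<^sup>2 * (\<Prod>s\<in>S. W s))" if S: "S \<subseteq> ?G" "card S = y" for S
  proof -
    have fS: "finite S" using S(1) by (rule finite_subset) simp
    have S0: "S \<subseteq> {0..}" using S(1) by auto
    have US: "U \<inter> S = {}" "D \<inter> S = {}" using sums(6,7) S(1) by blast+
    have cUS: "card (U \<union> S) = y + p" using US fS sums(2,4) S(2) by (simp add: card_Un_disjoint)
    have vU: "vset ?v (U \<union> S) = vset ?v U * vset ?v S * (\<Prod>s\<in>S. \<Prod>u\<in>U. \<bar>?v s - ?v u\<bar>)"
      using UD0 S0 by (intro vset_Un sums(4) fS US mono) auto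
    have vD: "vset ?v (D \<union> S) = vset ?v D * vset ?v S * (\<Prod>s\<in>S. \<Prod>u\<in>D. \<bar>?v s - ?v u\<bar>)"
      using UD0 S0 by (intro vset_Un sums(5) fS US mono) auto
    have xD: "(\<Prod>j\<in>D \<union> S. xi 0 j) = (\<Prod>j\<in>D. xi 0 j) * (\<Prod>j\<in>S. xi 0 j)"
      using sums(5) fS US(2) by (rule prod.union_disjoint)
    have fUS: "finite (U \<union> S)" using sums(4) fS by simp
    have W: "(\<Prod>s\<in>S. W s) = (\<Prod>s\<in>S. xi 0 s) * ((\<Prod>s\<in>S. \<Prod>u\<in>U. \<bar>?v s - ?v u\<bar>) * (\<Prod>s\<in>S. \<Prod>u\<in>D. \<bar>?v s - ?v u\<bar>))"
    proof -
      have "{0..<int a} \<inter> {int b'..<int c} = {}" unfolding b'_def by auto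
      then have "(\<Prod>f\<in>{0..<int a}. g f) * (\<Prod>f\<in>{int b'..<int c}. g f) = (\<Prod>u\<in>U. g u) * (\<Prod>u\<in>D. g u)" for g :: "int \<Rightarrow> real"
        using prod.union_disjoint[OF sums(4,5,9), of g] unfolding sums(8)
        by (subst (asm) prod.union_disjoint) simp_all
      then show ?thesis unfolding W_def prod.distrib[symmetric] by simp
    qed
    have aux: "u * s * su / h * (xd * xs * (d * s * sd) / k) = u / h * (xd * d / k) * (s\<^sup>2 * (xs * (su * sd)))"
      for u s su h xd xs d sd k :: real by (simp add: power2_eq_square)
    show ?thesis
      unfolding dent_count_odd_rows[OF fUS cUS] dent_count_even_rows vU vD xD W C_def by (rule aux)
  qed
  have "M_N3 x y z as bs = (\<Sum>S | S \<subseteq> ?G \<and> card S = y. C * ((vset ?v S)\<^sup>2 * (\<Prod>s\<in>S. W s)))"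
    unfolding sums(1) by (rule sum.cong[OF refl]) (rule term_S, simp_all)
  also have "\<dots> = C * (\<Sum>S | S \<subseteq> {a..<b'} \<and> card S = y. (vset ?v (int ` S))\<^sup>2 * (\<Prod>s\<in>int ` S. W s))"
    unfolding sum_distrib_left[symmetric] sum_int_subsets ..
  also have "(\<Sum>S | S \<subseteq> {a..<b'} \<and> card S = y. (vset ?v (int ` S))\<^sup>2 * (\<Prod>s\<in>int ` S. W s)) =
      (\<Sum>S | S \<subseteq> {a..<b'} \<and> card S = y. (1/2) ^ y * ((vset (\<lambda>s. (real s + 1/2)\<^sup>2) S)\<^sup>2 * (\<Prod>s\<in>S. racah_weight a b' c s)))"
  proof (rule sum.cong[OF refl])
    fix S assume "S \<in> {S. S \<subseteq> {a..<b'} \<and> card S = y}"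
    then have S: "S \<subseteq> {a..<b'}" "card S = y" by simp_all
    \<comment> \<open>The distance \<open>s + 1/2\<close> is half of \<open>2 * s + 1\<close>; over
      the \<open>y\<close> elements of \<open>S\<close> this produces the power of 2 in the
      theorem.\<close>
    have "W (int s) = 1/2 * racah_weight a b' c s" if "s \<in> S" for s
    proof -
      have s: "a \<le> s" "s < b'" using S(1) that by auto
      have 1: "(\<Prod>f\<in>{0..<int a}. \<bar>?v (int s) - ?v f\<bar>) = fact (s + a) / fact (s - a)"
        using prod_int_interval[of "\<lambda>f. \<bar>?v (int s) - ?v f\<bar>" 0 a] prod_squares_below[OF s(1)]
        by (simp add: xi_nat lessThan_atLeast0)
      have 2: "(\<Prod>f\<in>{int b'..<int c}. \<bar>?v (int s) - ?v f\<bar>) =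
          fact (c - 1 - s) * fact (c + s) / (fact (b' - 1 - s) * fact (b' + s))"
        using prod_squares_above[OF s(2), of \<beta>] unfolding prod_int_interval xi_nat c_def b'_def .
      have aux: "(r + 1/2) * (A / B * (E * F / (G * I))) = 1/2 * ((2 * r + 1) * A * E * F / (B * G * I))"
        for r A B E F G I :: real by (simp add: field_simps)
      show ?thesis unfolding W_def 1 2 unfolding xi_nat racah_weight_def by (rule aux)
    qed
    then have "(\<Prod>s\<in>S. W (int s)) = (\<Prod>s\<in>S. 1/2 * racah_weight a b' c s)" by (intro prod.cong refl)
    also have "\<dots> = (1/2) ^ y * (\<Prod>s\<in>S. racah_weight a b' c s)" using S(2) by (simp only: prod.distrib prod_constant)
    finally have "(\<Prod>s\<in>int ` S. W s) = (1/2) ^ y * (\<Prod>s\<in>S. racah_weight a b' c s)" by (simp add: prod.reindex)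
    then show "(vset ?v (int ` S))\<^sup>2 * (\<Prod>s\<in>int ` S. W s) =
        (1/2) ^ y * ((vset (\<lambda>s. (real s + 1/2)\<^sup>2) S)\<^sup>2 * (\<Prod>s\<in>S. racah_weight a b' c s))"
      unfolding vset_image_int xi_nat by (simp only: mult.left_commute)
  qed
  also have "\<dots> = (1/2) ^ y * (H (2 * a + \<beta> + 2 * y) * H (\<beta> + y) / (H (2 * a + \<beta> + y) * H \<beta>) * R_factor x y a \<beta>)"
    unfolding sum_distrib_left[symmetric]
  proof (rule arg_cong[where f = "(*) ((1/2) ^ y)"])
    show "(\<Sum>S | S \<subseteq> {a..<b'} \<and> card S = y. (vset (\<lambda>s. (real s + 1/2)\<^sup>2) S)\<^sup>2 * (\<Prod>s\<in>S. racah_weight a b' c s)) =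
      H (2 * a + \<beta> + 2 * y) * H (\<beta> + y) / (H (2 * a + \<beta> + y) * H \<beta>) * R_factor x y a \<beta>"
    \<comment> \<open>\<open>N + 1\<close> is to be the number of positions in the gap, and for
      \<open>y = 0\<close> the gap may be empty.\<close>
    proof (cases "y = 0")
      case True
      have "S = {}" if "S \<subseteq> {a..<b'}" "card S = 0" for S using that finite_subset[OF that(1)] by simp
      then have "{S. S \<subseteq> {a..<b'} \<and> card S = y} = {{}}" using True by auto
      then show ?thesis using True R_factor_0(2) H_pos[of "2 * a + \<beta>"] H_pos[of \<beta>] by (simp add: vset_def)
    next
      case False
      define N where "N = x + y - 1"
      have N: "x + y = N + 1" "y \<le> N + 1" unfolding N_def using False by simp_all
      have "b' = a + N + 1" "c = a + N + 1 + \<beta>" unfolding b'_def c_def using N(1) by simp_all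
      then show ?thesis using sum_subsets_racah[OF N(2), of a \<beta>] racah_product_eq[OF N(1), of a \<beta>] by (simp only:)
    qed
  qed
  finally have "M_N3 x y z as bs = C * ((1/2) ^ y * (H (2 * a + \<beta> + 2 * y) * H (\<beta> + y) / (H (2 * a + \<beta> + y) * H \<beta>) * R_factor x y a \<beta>))" .
  moreover have "C = vset ?v U / H2 (2 * p) * ((\<Prod>j\<in>D. xi 0 j) * vset ?v D / H2 (2 * q + 1)) *
      (H2 (2 * p) * H2 (2 * q + 1) / (H2 (2 * (y + p)) * H2 (2 * (y + q) + 1)))"
    unfolding C_def using H2_pos[of "2 * p"] H2_pos[of "2 * q + 1"] by simp
  ultimately show "M_N3 x y z as bs = K (t_plus x y as bs) * Q' (t_minus x y z as bs) * ((1/2) ^ y *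
      (H2 (2 * p) * H2 (2 * q + 1) / (H2 (2 * (y + p)) * H2 (2 * (y + q) + 1))) *
      (H (2 * a + \<beta> + 2 * y) * H (\<beta> + y) / (H (2 * a + \<beta> + y) * H \<beta>) * R_factor x y a \<beta>))"
    unfolding Kp Qm by (simp only: mult_ac)
qed

lemma t_plus_add: "t_plus x y as bs = t_plus (x + y) 0 as bs"
  unfolding t_plus_def by (simp add: add.assoc)

lemma t_minus_add: "t_minus x y z as bs = t_minus (x + y) 0 z as bs"
  unfolding t_minus_def by (simp add: add.assoc)

text \<open>For \<open>y = 0\<close> no lozenge crosses the line. Since the sequences involve only
  \<open>x + y\<close>, this expresses \<open>K\<close> and \<open>Q'\<close> for general
  \<open>y\<close> as the count of a region.\<close>

lemma M_N3_no_dents: "M_N3 n 0 z as bs = K (t_plus n 0 as bs) * Q' (t_minus n 0 z as bs)"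
  unfolding M_N3_formula(1)[of n 0] R_factor_0 using H2_pos H_pos by (simp add: less_imp_neq[symmetric])

theorem theorem2p14:
  fixes x y z :: nat and as bs :: "nat list"
    and a b o_a e_a o_b e_b :: nat and R :: real
  assumes "a = sum_list as" and "b = sum_list bs"
    and "o_a = odd_sum as" and "e_a = even_sum as"
    and "o_b = odd_sum bs" and "e_b = even_sum bs"
    and "R = T_prod (real x + 1) (2 * int a + int b + 2 * int y + int z - 1) y
             * T_prod (real x + real a + 1) (int b + 2 * int y + int z - 1) y
             / (T_prod 1 (2 * int a + int b + 2 * int y + int z - 1) y
                * T_prod (real a + 1) (int b + 2 * int y + int z - 1) y)"
  shows "M_N3 y 0 z as bs \<noteq> 0
    \<and> M_N3 x y z as bs = M_N3 (x + y) 0 z as bs * M_N3 0 y z as bs / M_N3 y 0 z as bs * R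
    \<and> M_N3 x y z as bs =
        2 powi (- int y) * K (t_plus x y as bs) * Q' (t_minus x y z as bs)
        * (H2 (2 * o_a + 2 * o_b) * H2 (2 * e_a + 2 * e_b + 2 * z + 1)
           / (H2 (2 * o_a + 2 * o_b + 2 * y) * H2 (2 * e_a + 2 * e_b + 2 * y + 2 * z + 1)))
        * (H (2 * a + b + 2 * y + z) * H (b + y + z) / (H (2 * a + b + y + z) * H (b + z)))
        * R"
proof (intro conjI)
  let ?p = "odd_sum as + odd_sum bs" and ?q = "even_sum as + even_sum bs + z" and ?\<beta> = "sum_list bs + z"
  define E where "E = (1/2) ^ y *
      (H2 (2 * ?p) * H2 (2 * ?q + 1) / (H2 (2 * (y + ?p)) * H2 (2 * (y + ?q) + 1))) *
      (H (2 * a + ?\<beta> + 2 * y) * H (?\<beta> + y) / (H (2 * a + ?\<beta> + y) * H ?\<beta>))"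
  have T: "2 * int a + int b + 2 * int y + int z - 1 = 2 * int a + int ?\<beta> + 2 * int y - 1"
    "int b + 2 * int y + int z - 1 = int ?\<beta> + 2 * int y - 1" using assms(2) by simp_all
  have R: "R = R_factor x y a ?\<beta>" unfolding assms(7) R_factor_def T ..
  have M: "M_N3 n y z as bs = K (t_plus n y as bs) * Q' (t_minus n y z as bs) * (E * R_factor n y a ?\<beta>)" for n
    unfolding M_N3_formula(1)[of n y] E_def assms(1) by (simp only: mult_ac)
  have KQ: "K (t_plus n 0 as bs) * Q' (t_minus n 0 z as bs) \<noteq> 0" for n
    using M_N3_formula(2)[of n 0 as bs] M_N3_formula(3)[of n 0 z as bs] by simp
  show "M_N3 y 0 z as bs \<noteq> 0" unfolding M_N3_no_dents by (rule KQ)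
  \<comment> \<open>\<open>R_factor\<close> is 1 at \<open>x = 0\<close>, so \<open>E\<close>, which
    is free of \<open>x\<close>, is the ratio of the counts for \<open>0, y, z\<close> and
    \<open>y, 0, z\<close>. The first form of the theorem is the closed form with \<open>E\<close>
    replaced by this ratio.\<close>
  have 0: "M_N3 0 y z as bs = K (t_plus y 0 as bs) * Q' (t_minus y 0 z as bs) * E"
    unfolding M R_factor_0 t_plus_add[of 0 y] t_minus_add[of 0 y] by simp
  have xy: "M_N3 x y z as bs = M_N3 (x + y) 0 z as bs * (E * R)"
    unfolding M M_N3_no_dents R t_plus_add[of x y] t_minus_add[of x y] ..
  show "M_N3 x y z as bs = M_N3 (x + y) 0 z as bs * M_N3 0 y z as bs / M_N3 y 0 z as bs * R"
    unfolding xy 0 M_N3_no_dents[of y] using KQ[of y] by simp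
  have e: "2 * o_a + 2 * o_b = 2 * ?p" "2 * e_a + 2 * e_b + 2 * z + 1 = 2 * ?q + 1"
    "2 * o_a + 2 * o_b + 2 * y = 2 * (y + ?p)" "2 * e_a + 2 * e_b + 2 * y + 2 * z + 1 = 2 * (y + ?q) + 1"
    "2 * a + b + 2 * y + z = 2 * a + ?\<beta> + 2 * y" "b + y + z = ?\<beta> + y" "2 * a + b + y + z = 2 * a + ?\<beta> + y"
    "b + z = ?\<beta>"
    using assms(2-6) by simp_all
  have "(2 :: real) powi (- int y) = (1/2) ^ y" by (simp add: power_int_minus power_one_over inverse_eq_divide)
  then show "M_N3 x y z as bs =
        2 powi (- int y) * K (t_plus x y as bs) * Q' (t_minus x y z as bs)
        * (H2 (2 * o_a + 2 * o_b) * H2 (2 * e_a + 2 * e_b + 2 * z + 1)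
           / (H2 (2 * o_a + 2 * o_b + 2 * y) * H2 (2 * e_a + 2 * e_b + 2 * y + 2 * z + 1)))
        * (H (2 * a + b + 2 * y + z) * H (b + y + z) / (H (2 * a + b + y + z) * H (b + z)))
        * R"
    unfolding M[of x] e(3-8) R E_def unfolding e(1,2) by (simp only: mult_ac)
qed

end
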